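(* The Cantor set $E=\bigcap_{k=0}^\infty E_k\subset\mathbb{R}^{N+1}$ (constructed in the context) is removable for bounded $\frac12$-fractional caloric functions.
   Context: $N\ge 1$. Construction of $E$: let $E_0=Q^0=[0,1]^{N+1}$. Replace $Q^0$ by $2^{N+1}$ disjoint closed cubes $Q^1_i$ (sides parallel to the axes) of side length $2^{-(N+1)/N}$, all contained in $Q^0$ and each containing one vertex of $Q^0$. Inductively, in generation $k$ replace each cube $Q^{k-1}_j$ of the previous generation by $2^{N+1}$ cubes $Q^k_i$ of side length $2^{-k(N+1)/N}$ contained in $Q^{k-1}_j$ and located in the same relative position to $Q^{k-1}_j$ as $Q^1_1,\dots,Q^1_{2^{N+1}}$ with respect to $Q^0$. $E_k$ is the union of the $2^{k(N+1)}$ cubes $Q_i^k$ of generation $k$, and $E=\bigcap_{k\ge0}E_k$. Removability: points of $\mathbb{R}^{N+1}$ are $\bar x=(x,t)$, $x\in\mathbb{R}^N$, $t\in\mathbb{R}$, and $\Theta^{1/2}=(-\Delta_x)^{1/2}+\partial_t$, where $(-\Delta_x)^{1/2}$ acts in $x$ with Fourier multiplier $|\xi|$. A compact set $E$ is removable for bounded $\frac12$-fractional caloric functions if every bounded function $f:\mathbb{R}^{N+1}\to\mathbb{R}$ satisfying $\Theta^{1/2}f=0$ in $\mathbb{R}^{N+1}\setminus E$ (in the sense of distributions) also satisfies $\Theta^{1/2}f=0$ in all of $\mathbb{R}^{N+1}$. *)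

theory Defs
  imports "HOL-Analysis.Analysis"
begin

text \<open>
  \<open>\<real>\<^sup>N\<^sup>+\<^sup>1\<close> is modelled as \<open>(real ^ 'n) \<times> real\<close> with \<open>N = CARD('n) \<ge> 1\<close>; a point is \<open>(x, t)\<close>.
\<close>

subsection \<open>The Cantor set\<close>

definition cantor_side :: "'n::finite itself \<Rightarrow> nat \<Rightarrow> real" where
  "cantor_side _ k = 2 powr (- (real k * (real CARD('n) + 1) / real CARD('n)))"

definition unit_cube_vertices :: "'a::euclidean_space set" where
  "unit_cube_vertices = {v. \<forall>b\<in>Basis. v \<bullet> b = 0 \<or> v \<bullet> b = 1}"

definition axis_cube :: "'a::euclidean_space \<Rightarrow> real \<Rightarrow> 'a set" where
  "axis_cube a s = cbox a (a + s *\<^sub>R One)"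

text \<open>
  The lower corners of the cubes of generation \<open>k\<close>.  The only axis-parallel closed cube of side
  \<open>s' \<le> s\<close> contained in \<open>axis_cube a s\<close> and containing its vertex \<open>a + s *\<^sub>R v\<close>, for \<open>v\<close> a vertex
  of the unit cube, is \<open>axis_cube (a + (s - s') *\<^sub>R v) s'\<close>.
\<close>
fun cantor_corners :: "nat \<Rightarrow> ((real ^ 'n::finite) \<times> real) set" where
  "cantor_corners 0 = {0}"
| "cantor_corners (Suc k) =
     {a + (cantor_side TYPE('n) k - cantor_side TYPE('n) (Suc k)) *\<^sub>R v | a v.
        a \<in> cantor_corners k \<and> v \<in> unit_cube_vertices}"

definition cantor_cubes :: "nat \<Rightarrow> ((real ^ 'n::finite) \<times> real) set set" where
  "cantor_cubes k = (\<lambda>a. axis_cube a (cantor_side TYPE('n) k)) ` cantor_corners k"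

definition cantor_set :: "((real ^ 'n::finite) \<times> real) set" where
  "cantor_set = (\<Inter>k. \<Union>(cantor_cubes k))"

lemma axis_cube_in_axis_cube_iff:
  fixes a c v :: "'a::euclidean_space"
  assumes "0 \<le> s'" "s' \<le> s" "v \<in> unit_cube_vertices"
  shows "axis_cube c s' \<subseteq> axis_cube a s \<and> a + s *\<^sub>R v \<in> axis_cube c s'
           \<longleftrightarrow> c = a + (s - s') *\<^sub>R v"
proof
  assume L: "axis_cube c s' \<subseteq> axis_cube a s \<and> a + s *\<^sub>R v \<in> axis_cube c s'"
  have c: "c \<in> axis_cube a s" "c + s' *\<^sub>R One \<in> axis_cube a s"
  proof -
    have "c \<in> axis_cube c s'" "c + s' *\<^sub>R One \<in> axis_cube c s'"
      using assms(1) by (auto simp: axis_cube_def mem_box inner_add_left)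
    then show "c \<in> axis_cube a s" "c + s' *\<^sub>R One \<in> axis_cube a s"
      using L by blast+
  qed
  show "c = a + (s - s') *\<^sub>R v"
  proof (rule euclidean_eqI)
    fix b :: 'a assume b: "b \<in> Basis"
    have "v \<bullet> b = 0 \<or> v \<bullet> b = 1" using assms(3) b by (auto simp: unit_cube_vertices_def)
    moreover have "a \<bullet> b \<le> c \<bullet> b" "c \<bullet> b + s' \<le> a \<bullet> b + s"
      using c b by (auto simp: axis_cube_def mem_box inner_add_left)
    moreover have "c \<bullet> b \<le> a \<bullet> b + s * (v \<bullet> b)" "a \<bullet> b + s * (v \<bullet> b) \<le> c \<bullet> b + s'"
      using L b by (auto simp: axis_cube_def mem_box inner_add_left)
    ultimately show "c \<bullet> b = (a + (s - s') *\<^sub>R v) \<bullet> b"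
      by (auto simp: inner_add_left)
  qed
next
  assume c: "c = a + (s - s') *\<^sub>R v"
  have v: "v \<bullet> b = 0 \<or> v \<bullet> b = 1" if "b \<in> Basis" for b
    using assms(3) that by (auto simp: unit_cube_vertices_def)
  have lo: "a \<bullet> b \<le> c \<bullet> b" and hi: "c \<bullet> b + s' \<le> a \<bullet> b + s"
    and m: "c \<bullet> b \<le> a \<bullet> b + s * (v \<bullet> b)" "a \<bullet> b + s * (v \<bullet> b) \<le> c \<bullet> b + s'"
    if "b \<in> Basis" for b
    using v[OF that] assms(1,2) by (auto simp: c inner_add_left)
  show "axis_cube c s' \<subseteq> axis_cube a s \<and> a + s *\<^sub>R v \<in> axis_cube c s'"
    using lo hi m unfolding axis_cube_def subset_iff mem_box
    by (fastforce simp: inner_add_left)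
qed

subsection \<open>Test functions\<close>

fun C_times :: "nat \<Rightarrow> ('a::real_normed_vector \<Rightarrow> 'b::real_normed_vector) \<Rightarrow> bool" where
  "C_times 0 f \<longleftrightarrow> continuous_on UNIV f"
| "C_times (Suc k) f \<longleftrightarrow>
     (\<forall>x. f differentiable (at x)) \<and> (\<forall>v. C_times k (\<lambda>x. frechet_derivative f (at x) v))"

definition test_function_on :: "'a::euclidean_space set \<Rightarrow> ('a \<Rightarrow> complex) \<Rightarrow> bool" where
  "test_function_on U \<phi> \<longleftrightarrow>
     (\<forall>k. C_times k \<phi>) \<and> compact (closure {x. \<phi> x \<noteq> 0}) \<and> closure {x. \<phi> x \<noteq> 0} \<subseteq> U"

subsection \<open>The operator and removability\<close>

text \<open>
  With the normalisation \<open>\<integral> g(x) exp(-\<i> x\<cdot>\<xi>) dx\<close> the multiplier of \<open>-\<Delta>\<close> is \<open>|\<xi>|\<^sup>2\<close>, so that of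
  \<open>(-\<Delta>)\<^sup>1\<^sup>/\<^sup>2\<close> is exactly \<open>|\<xi>|\<close>.
\<close>
definition fourier :: "('a::euclidean_space \<Rightarrow> complex) \<Rightarrow> 'a \<Rightarrow> complex" where
  "fourier g \<xi> = (\<integral>x. cis (- (x \<bullet> \<xi>)) * g x \<partial>lborel)"

definition inverse_fourier :: "('a::euclidean_space \<Rightarrow> complex) \<Rightarrow> 'a \<Rightarrow> complex" where
  "inverse_fourier h x = (\<integral>\<xi>. cis (x \<bullet> \<xi>) * h \<xi> \<partial>lborel) / of_real ((2 * pi) ^ DIM('a))"

definition half_laplacian :: "('a::euclidean_space \<Rightarrow> complex) \<Rightarrow> 'a \<Rightarrow> complex" where
  "half_laplacian g = inverse_fourier (\<lambda>\<xi>. of_real (norm \<xi>) * fourier g \<xi>)"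

text \<open>The formal transpose \<open>(-\<Delta>\<^sub>x)\<^sup>1\<^sup>/\<^sup>2 - \<partial>\<^sub>t\<close> of \<open>\<Theta>\<^sup>1\<^sup>/\<^sup>2 = (-\<Delta>\<^sub>x)\<^sup>1\<^sup>/\<^sup>2 + \<partial>\<^sub>t\<close>.\<close>
definition theta_transpose ::
  "((real ^ 'n::finite) \<times> real \<Rightarrow> complex) \<Rightarrow> (real ^ 'n) \<times> real \<Rightarrow> complex" where
  "theta_transpose \<phi> = (\<lambda>(x, t).
     half_laplacian (\<lambda>y. \<phi> (y, t)) x - vector_derivative (\<lambda>s. \<phi> (x, s)) (at t))"

text \<open>
  \<open>\<Theta>\<^sup>1\<^sup>/\<^sup>2 f = 0\<close> in the open set \<open>U\<close> in the sense of distributions, for \<open>f\<close> bounded and measurable: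
  then the integrand below is integrable, because \<open>(-\<Delta>\<^sub>x)\<^sup>1\<^sup>/\<^sup>2 \<phi>\<close> is continuous, compactly
  supported in \<open>t\<close> and \<open>O(|x|\<^sup>-\<^sup>N\<^sup>-\<^sup>1)\<close> in \<open>x\<close>.
\<close>
definition half_caloric_on ::
  "((real ^ 'n::finite) \<times> real) set \<Rightarrow> ((real ^ 'n) \<times> real \<Rightarrow> real) \<Rightarrow> bool" where
  "half_caloric_on U f \<longleftrightarrow>
     (\<forall>\<phi>. test_function_on U \<phi> \<longrightarrow>
        (\<integral>p. of_real (f p) * theta_transpose \<phi> p \<partial>lebesgue) = 0)"

definition removable_bounded_half_caloric :: "((real ^ 'n::finite) \<times> real) set \<Rightarrow> bool" where
  "removable_bounded_half_caloric K \<longleftrightarrow>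
     compact K \<and>
     (\<forall>f. f \<in> borel_measurable lebesgue \<and> bounded (range f) \<and> half_caloric_on (- K) f
        \<longrightarrow> half_caloric_on UNIV f)"

end

theory Submission
  imports Defs "HOL-Probability.Probability"
begin

text \<open>
  Testing \<open>T = \<Theta>\<^sup>1\<^sup>/\<^sup>2 f\<close> against bumps adapted to the Cantor cubes turns \<open>T\<close> into an additive function
  \<open>\<nu>\<close> of cubes.  Scale invariance of the operator gives \<open>|\<nu>(Q)| \<le> C l(Q)\<^sup>N\<close>, and \<open>l(Q)\<^sup>N\<close> is exactly the
  natural mass of \<open>Q\<close>; hence \<open>T\<close> is determined by \<open>\<nu>\<close>, and \<open>T = 0\<close> as soon as \<open>\<nu> = 0\<close>.

  Suppose \<open>\<nu> \<noteq> 0\<close>, let \<open>D\<close> be the supremum of \<open>|\<nu>(Q)| / l(Q)\<^sup>N\<close>, and let \<open>Q\<close> nearly attain it: on \<open>Q\<close>,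
  up to a unimodular factor, \<open>\<nu>\<close> is almost \<open>D\<close> times the natural measure.  Let \<open>P\<close> be the Poisson kernel
  and \<open>\<Phi>(x, t) = \<theta>(t) P(x - x\<^sub>0, t\<^sub>1 - t)\<close> with a cut-off \<open>\<theta>\<close> in time and an apex \<open>(x\<^sub>0, t\<^sub>1)\<close> slightly above
  a top corner of \<open>Q\<close>.  A cut-off in time commutes with \<open>(-\<Delta>\<^sub>x)\<^sup>1\<^sup>/\<^sup>2\<close>, so the transposed operator maps \<open>\<Phi>\<close> to
  \<open>- \<theta>' P\<close>, whose \<open>L\<^sup>1\<close> norm stays bounded however close the apex is to \<open>Q\<close>; therefore \<open>|T(\<Phi>)| \<le> C\<close>.
  On the other hand \<open>\<Phi> \<ge> 0\<close>, and each of the \<open>m\<close> generations between \<open>Q\<close> and the distance of the apex adds a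
  fixed amount to the integral of \<open>\<Phi>\<close> against the natural measure, so that \<open>|T(\<Phi>)| \<ge> D (c m - C')\<close>.  This is
  impossible for large \<open>m\<close>.
\<close>

section \<open>Smooth functions\<close>

text \<open>Growth alone cannot give \<nu> = 0: Lebesgue measure on a compact piece of a slice t =
  const also grows like l^N, yet the function it generates through the Poisson kernel is bounded, so
  that piece is not removable. What decides is that the Cantor set has comparable mass below the
  apex at every scale down to that of the apex, a slice only at one. \<nu> has no sign, so \<Phi>
  might meet cancellation; near-extremality excludes it provided the deficit is tiny against the
  maximum of \<Phi>, so the tolerance depends on m. What lies outside Q is harmless because the time
  cut-off lives at the scale of Q: at distance d the kernel is at most of order l(Q) / d^(N+1),
  which against D times the natural mass sums geometrically over the generations above Q. The
  operator is given by a multiplier, but L^1 estimates call for positive kernels: it is recovered as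
  the limit of difference quotients of the Poisson semigroup, whose transform comes from Gaussians
  by subordination. Compact support of \<Phi> in space needs a cut-off, whose commutator has L^1
  norm as small as desired once the cut-off is wide enough.\<close>

text \<open>\<open>C_times\<close> relative to an open set; needed because the Poisson kernel is singular at the origin.\<close>
fun smooth_upto :: "nat \<Rightarrow> 'a::real_normed_vector set \<Rightarrow> ('a \<Rightarrow> 'b::real_normed_vector) \<Rightarrow> bool" where
  "smooth_upto 0 S f \<longleftrightarrow> continuous_on S f"
| "smooth_upto (Suc k) S f \<longleftrightarrow>
     (\<forall>x\<in>S. f differentiable (at x)) \<and> (\<forall>v. smooth_upto k S (\<lambda>x. frechet_derivative f (at x) v))"

lemma C_times_iff_smooth_upto: "C_times k f \<longleftrightarrow> smooth_upto k UNIV f"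
  by (induction k arbitrary: f) auto

lemma smooth_upto_cong:
  assumes "open S" "\<And>x. x \<in> S \<Longrightarrow> f x = g x" "smooth_upto k S f"
  shows "smooth_upto k S g"
  using assms(2,3)
proof (induction k arbitrary: f g)
  case 0
  then show ?case by (metis continuous_on_cong smooth_upto.simps(1))
next
  case (Suc k)
  have *: "(g has_derivative frechet_derivative f (at x)) (at x)" if "x \<in> S" for x
  proof -
    have "(f has_derivative frechet_derivative f (at x)) (at x)"
      using Suc.prems that frechet_derivative_works by auto
    then show ?thesis
      using has_derivative_transform_within_open[of f _ x UNIV S g] assms(1) that Suc.prems(1) by simp
  qed
  have eq: "frechet_derivative f (at x) v = frechet_derivative g (at x) v" if "x \<in> S" for x v
    using frechet_derivative_at[OF *[OF that]] by simp
  have "smooth_upto k S (\<lambda>x. frechet_derivative g (at x) v)" for v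
    using Suc.IH[of "\<lambda>x. frechet_derivative f (at x) v"] eq Suc.prems by auto
  then show ?case using * by (auto simp: differentiable_def)
qed

lemma smooth_upto_Un:
  "open S \<Longrightarrow> open T \<Longrightarrow> smooth_upto k S f \<Longrightarrow> smooth_upto k T f \<Longrightarrow> smooth_upto k (S \<union> T) f"
  by (induction k arbitrary: f) (auto intro: continuous_on_open_Un)

text \<open>\<open>frechet_derivative\<close> is a choice operator, so a concrete derivative is
  exchanged for it by uniqueness. This is the introduction rule behind the closure lemmas
  below.\<close>

lemma smooth_upto_SucI:
  assumes "open S" "\<And>x. x \<in> S \<Longrightarrow> (f has_derivative f' x) (at x)" "\<And>v. smooth_upto k S (\<lambda>x. f' x v)"
  shows "smooth_upto (Suc k) S f"
proof -
  have "f' x v = frechet_derivative f (at x) v" if "x \<in> S" for x v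
    using frechet_derivative_at[OF assms(2)[OF that]] by simp
  then have "smooth_upto k S (\<lambda>x. frechet_derivative f (at x) v)" for v
    by (rule smooth_upto_cong[OF assms(1) _ assms(3)])
  then show ?thesis using assms(2) by (auto simp: differentiable_def)
qed

lemma smooth_upto_Suc_has_derivative:
  "smooth_upto (Suc k) S f \<Longrightarrow> x \<in> S \<Longrightarrow> (f has_derivative frechet_derivative f (at x)) (at x)"
  using frechet_derivative_works by auto

lemma smooth_upto_SucD: "smooth_upto (Suc k) S f \<Longrightarrow> smooth_upto k S f"
proof (induction k arbitrary: f)
  case 0
  then show ?case
    by (auto intro!: continuous_at_imp_continuous_on differentiable_imp_continuous_within)
next
  case (Suc k)
  then show ?case by (metis smooth_upto.simps(2))
qed

section \<open>Closure of smoothness under algebra and composition\<close>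

lemma smooth_upto_const [simp]: "open S \<Longrightarrow> smooth_upto k S (\<lambda>x. c)"
proof (induction k arbitrary: c)
  case (Suc k)
  show ?case
    by (rule smooth_upto_SucI[where f'="\<lambda>x v. 0"]) (use Suc in auto)
qed simp

lemma smooth_upto_bounded_linear:
  assumes "bounded_linear A" "open S"
  shows "smooth_upto k S A"
proof (cases k)
  case 0
  then show ?thesis using assms by (simp add: linear_continuous_on)
next
  case (Suc j)
  show ?thesis unfolding Suc
    by (rule smooth_upto_SucI[where f'="\<lambda>x v. A v"]) (use assms in \<open>auto intro: bounded_linear_imp_has_derivative\<close>)
qed

lemma smooth_upto_add:
  assumes "open S" "smooth_upto k S f" "smooth_upto k S g"
  shows "smooth_upto k S (\<lambda>x. f x + g x)"
  using assms(2,3)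
proof (induction k arbitrary: f g)
  case 0
  then show ?case by (auto intro: continuous_intros)
next
  case (Suc k)
  show ?case
  proof (rule smooth_upto_SucI[OF assms(1)])
    show "((\<lambda>x. f x + g x) has_derivative
        (\<lambda>v. frechet_derivative f (at x) v + frechet_derivative g (at x) v)) (at x)" if "x \<in> S" for x
      using has_derivative_add[OF smooth_upto_Suc_has_derivative[OF Suc.prems(1) that]
          smooth_upto_Suc_has_derivative[OF Suc.prems(2) that]] .
    show "smooth_upto k S (\<lambda>x. frechet_derivative f (at x) v + frechet_derivative g (at x) v)" for v
      using Suc.prems by (intro Suc.IH) auto
  qed
qed

text \<open>The Leibniz rule reproduces the form of the statement, so one induction on the order
  serves multiplication, scaling and inner product alike. The undifferentiated factor has to be
  weakened by one order, which is where \<open>smooth_upto_SucD\<close> enters.\<close>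

lemma (in bounded_bilinear) smooth_upto_bilinear:
  assumes "open S" "smooth_upto k S f" "smooth_upto k S g"
  shows "smooth_upto k S (\<lambda>x. prod (f x) (g x))"
  using assms(2,3)
proof (induction k arbitrary: f g)
  case 0
  then show ?case by (auto intro: continuous_on)
next
  case (Suc k)
  show ?case
  proof (rule smooth_upto_SucI[OF assms(1)])
    show "((\<lambda>x. prod (f x) (g x)) has_derivative
       (\<lambda>v. prod (f x) (frechet_derivative g (at x) v) + prod (frechet_derivative f (at x) v) (g x))) (at x)"
      if "x \<in> S" for x
      using FDERIV[OF smooth_upto_Suc_has_derivative[OF Suc.prems(1) that]
          smooth_upto_Suc_has_derivative[OF Suc.prems(2) that]] .
    fix v
    show "smooth_upto k S (\<lambda>x. prod (f x) (frechet_derivative g (at x) v)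
        + prod (frechet_derivative f (at x) v) (g x))"
      using Suc.prems smooth_upto_SucD[OF Suc.prems(1)] smooth_upto_SucD[OF Suc.prems(2)]
      by (intro smooth_upto_add[OF assms(1)] Suc.IH) auto
  qed
qed

lemmas smooth_upto_mult = bounded_bilinear.smooth_upto_bilinear[OF bounded_bilinear_mult]
lemmas smooth_upto_scaleR = bounded_bilinear.smooth_upto_bilinear[OF bounded_bilinear_scaleR]
lemmas smooth_upto_inner = bounded_bilinear.smooth_upto_bilinear[OF bounded_bilinear_inner]

lemma smooth_upto_linear_comp:
  assumes "bounded_linear A" "open S" "smooth_upto k S f"
  shows "smooth_upto k S (\<lambda>x. A (f x))"
  using assms(3)
proof (induction k arbitrary: f)
  case 0
  then show ?case
    using assms(1) by (auto intro: bounded_linear.continuous_on)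
next
  case (Suc k)
  show ?case
  proof (rule smooth_upto_SucI[OF assms(2)])
    show "((\<lambda>x. A (f x)) has_derivative (\<lambda>v. A (frechet_derivative f (at x) v))) (at x)" if "x \<in> S" for x
      using bounded_linear.has_derivative[OF assms(1) smooth_upto_Suc_has_derivative[OF Suc.prems that]] .
    show "smooth_upto k S (\<lambda>x. A (frechet_derivative f (at x) v))" for v
      using Suc.prems by (intro Suc.IH) auto
  qed
qed

lemma smooth_upto_diff:
  fixes f g :: "'a::real_normed_vector \<Rightarrow> 'b::real_normed_vector"
  assumes "open S" "smooth_upto k S f" "smooth_upto k S g"
  shows "smooth_upto k S (\<lambda>x. f x - g x)"
  using smooth_upto_add[OF assms(1,2) smooth_upto_linear_comp[OF bounded_linear_minus[OF bounded_linear_ident] assms(1,3)]]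
  by simp

lemma smooth_upto_of_real:
  assumes "open S" "smooth_upto k S f"
  shows "smooth_upto k S (\<lambda>x. of_real (f x) :: 'b::real_normed_algebra_1)"
  by (rule smooth_upto_linear_comp[OF bounded_linear_of_real assms])

lemma smooth_upto_prod:
  fixes f :: "'i \<Rightarrow> 'a::real_normed_vector \<Rightarrow> real"
  assumes "open S" "\<And>i. i \<in> I \<Longrightarrow> smooth_upto k S (f i)"
  shows "smooth_upto k S (\<lambda>x. \<Prod>i\<in>I. f i x)"
proof (cases "finite I")
  case True
  then show ?thesis using assms(2)
    by (induction I) (auto intro!: smooth_upto_mult smooth_upto_const assms(1))
qed (use assms in simp)

text \<open>The outer function depends on a real variable, so its derivative in direction
  \<open>h\<close> is \<open>h\<close> times one function of the point. The chain rule thus becomes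
  a product to which the induction hypothesis applies; for a general outer function the direction
  itself would vary with the point.\<close>

lemma smooth_upto_compose_real:
  fixes F :: "real \<Rightarrow> 'b::real_normed_vector"
  assumes "open S" "open T" "smooth_upto k T F" "smooth_upto k S f" "\<And>x. x \<in> S \<Longrightarrow> f x \<in> T"
  shows "smooth_upto k S (\<lambda>x. F (f x))"
  using assms(3,4)
proof (induction k arbitrary: F)
  case 0
  then show ?case
    using assms(5) continuous_on_compose2[of T F S f] by auto
next
  case (Suc k)
  have fk: "smooth_upto k S f" using Suc.prems smooth_upto_SucD by blast
  show ?case
  proof (rule smooth_upto_SucI[OF assms(1)])
    fix x assume x: "x \<in> S"
    have F: "(F has_derivative frechet_derivative F (at (f x))) (at (f x))"
      using smooth_upto_Suc_has_derivative[OF Suc.prems(1)] assms(5) x by blast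
    have "((\<lambda>x. F (f x)) has_derivative
        (\<lambda>v. frechet_derivative F (at (f x)) (frechet_derivative f (at x) v))) (at x)"
      by (rule has_derivative_compose[OF smooth_upto_Suc_has_derivative[OF Suc.prems(2) x] F])
    moreover have "frechet_derivative F (at (f x)) h = h *\<^sub>R frechet_derivative F (at (f x)) 1" for h
      using linear_scale[OF has_derivative_linear[OF F], of h 1] by simp
    then have "(\<lambda>v. frechet_derivative F (at (f x)) (frechet_derivative f (at x) v))
        = (\<lambda>v. frechet_derivative f (at x) v *\<^sub>R frechet_derivative F (at (f x)) 1)"
      by (intro ext)
    ultimately show "((\<lambda>x. F (f x)) has_derivative
        (\<lambda>v. frechet_derivative f (at x) v *\<^sub>R frechet_derivative F (at (f x)) 1)) (at x)"
      by (simp only:)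
  next
    fix v
    show "smooth_upto k S (\<lambda>x. frechet_derivative f (at x) v *\<^sub>R frechet_derivative F (at (f x)) 1)"
      by (intro smooth_upto_scaleR[OF assms(1)] Suc.IH) (use Suc.prems fk in auto)
  qed
qed

text \<open>The inner map is affine, so differentiating in direction \<open>v\<close> differentiates
  \<open>f\<close> in the fixed direction \<open>A v\<close>, and the induction continues with that
  derivative.\<close>

lemma smooth_upto_compose_affine:
  assumes "open S" "bounded_linear A" "smooth_upto k T f" "\<And>x. x \<in> S \<Longrightarrow> a + A x \<in> T"
  shows "smooth_upto k S (\<lambda>x. f (a + A x))"
  using assms(3)
proof (induction k arbitrary: f)
  case 0
  have "continuous_on S (\<lambda>x. a + A x)"
    using assms(2) by (intro continuous_intros linear_continuous_on)
  then show ?case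
    using 0 assms(4) continuous_on_compose2[of T f S "\<lambda>x. a + A x"] by auto
next
  case (Suc k)
  show ?case
  proof (rule smooth_upto_SucI[OF assms(1)])
    fix x assume x: "x \<in> S"
    have F: "(f has_derivative frechet_derivative f (at (a + A x))) (at (a + A x))"
      using smooth_upto_Suc_has_derivative[OF Suc.prems] assms(4) x by blast
    have "((\<lambda>x. a + A x) has_derivative A) (at x)"
      using assms(2) by (auto intro!: derivative_eq_intros bounded_linear_imp_has_derivative)
    from has_derivative_compose[OF this F]
    show "((\<lambda>x. f (a + A x)) has_derivative
        (\<lambda>v. frechet_derivative f (at (a + A x)) (A v))) (at x)" .
  next
    fix v
    show "smooth_upto k S (\<lambda>x. frechet_derivative f (at (a + A x)) (A v))"
      by (rule Suc.IH) (use Suc.prems in auto)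
  qed
qed

lemma smooth_upto_powr: "smooth_upto k {0<..} (\<lambda>y::real. y powr a)"
proof (induction k arbitrary: a)
  case 0
  then show ?case by (auto intro!: continuous_intros)
next
  case (Suc k)
  show ?case
  proof (rule smooth_upto_SucI)
    fix y :: real assume "y \<in> {0<..}"
    then have "((\<lambda>y. y powr a) has_real_derivative a * y powr (a - 1)) (at y)"
      by (intro has_real_derivative_powr) auto
    then show "((\<lambda>y. y powr a) has_derivative (\<lambda>v. v * (a * y powr (a - 1)))) (at y)"
      by (simp add: has_field_derivative_def mult_commute_abs)
  qed (auto intro!: smooth_upto_mult Suc)
qed

subsection \<open>Cut-off functions\<close>

text \<open>The powers of \<open>1 / x\<close> make the family closed under differentiation up to
  linear combinations, so smoothness is proved for all \<open>n\<close> by a single induction on the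
  order.\<close>

definition exp_inv :: "nat \<Rightarrow> real \<Rightarrow> real" where
  "exp_inv n x = (if x > 0 then exp (- (1/x)) / x ^ n else 0)"

lemma exp_inv_tendsto_0: "(exp_inv n \<longlongrightarrow> 0) (at 0)"
proof -
  have "((\<lambda>y::real. y ^ n / exp y) \<longlongrightarrow> 0) at_top"
    by (rule tendsto_power_div_exp_0)
  then have "((\<lambda>x::real. inverse x ^ n / exp (inverse x)) \<longlongrightarrow> 0) (at_right 0)"
    by (rule filterlim_compose[OF _ filterlim_inverse_at_top_right])
  then have "(exp_inv n \<longlongrightarrow> 0) (at_right 0)"
    by (rule Lim_transform_eventually)
      (auto simp: eventually_at_right_field exp_inv_def exp_minus divide_simps power_inverse intro!: exI[of _ 1])
  moreover have "(exp_inv n \<longlongrightarrow> 0) (at_left 0)"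
    by (rule Lim_transform_eventually[OF tendsto_const])
      (auto simp: eventually_at_left_field exp_inv_def intro!: exI[of _ "-1"])
  ultimately show ?thesis by (simp add: filterlim_at_split)
qed

lemma exp_inv_has_derivative:
  "(exp_inv n has_real_derivative exp_inv (n+2) x - real n * exp_inv (n+1) x) (at x)"
proof -
  consider "x < 0" | "x = 0" | "x > 0" by linarith
  then show ?thesis
  proof cases
    case 1
    then have "((\<lambda>x. 0) has_real_derivative exp_inv (n+2) x - real n * exp_inv (n+1) x) (at x)"
      by (auto simp: exp_inv_def)
    then show ?thesis
      by (rule has_field_derivative_transform_within_open[where S="{..<0}"])
        (use 1 in \<open>auto simp: exp_inv_def\<close>)
  next
    case 2
    \<comment> \<open>At 0 the difference quotient of \<open>exp_inv n\<close> is
      \<open>exp_inv (Suc n)\<close>, which is already known to tend to 0.\<close>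
    have "((\<lambda>h. exp_inv n h / h) \<longlongrightarrow> 0) (at 0)"
      by (rule Lim_transform_eventually[OF exp_inv_tendsto_0[of "Suc n"]])
        (auto simp: exp_inv_def eventually_at_filter field_simps)
    then have "(exp_inv n has_real_derivative 0) (at 0)"
      by (simp add: DERIV_def exp_inv_def)
    then show ?thesis using 2 by (simp add: exp_inv_def)
  next
    case 3
    have "((\<lambda>x. exp (- (1/x)) / x ^ n) has_real_derivative exp_inv (n+2) x - real n * exp_inv (n+1) x) (at x)"
    proof (cases n)
      case 0
      then show ?thesis using 3
        by (auto intro!: derivative_eq_intros simp: exp_inv_def field_simps power2_eq_square)
    next
      case (Suc m)
      then show ?thesis using 3
        by (auto intro!: derivative_eq_intros simp: exp_inv_def divide_simps)
          (cases m; auto simp: algebra_simps power2_eq_square)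
    qed
    then show ?thesis
      by (rule has_field_derivative_transform_within_open[where S="{0<..}"])
        (use 3 in \<open>auto simp: exp_inv_def\<close>)
  qed
qed

lemma smooth_upto_exp_inv: "smooth_upto k UNIV (exp_inv n)"
proof (induction k arbitrary: n)
  case 0
  have "isCont (exp_inv n) x" for x
    using exp_inv_has_derivative DERIV_isCont by blast
  then show ?case by (simp add: continuous_at_imp_continuous_on)
next
  case (Suc k)
  show ?case
    by (rule smooth_upto_SucI[where f'="\<lambda>x v. v * (exp_inv (n+2) x - real n * exp_inv (n+1) x)"])
      (use Suc exp_inv_has_derivative in \<open>auto intro!: smooth_upto_mult smooth_upto_diff
          simp: has_field_derivative_def mult_commute_abs\<close>)
qed

definition smooth_step :: "real \<Rightarrow> real" where
  "smooth_step x = exp_inv 0 x / (exp_inv 0 x + exp_inv 0 (1 - x))"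

lemma exp_inv_0_pos: "exp_inv 0 x + exp_inv 0 (1 - x) > 0" "exp_inv 0 x \<ge> 0"
  by (auto simp: exp_inv_def add_pos_pos)

lemma smooth_step_range: "0 \<le> smooth_step x" "smooth_step x \<le> 1"
  using exp_inv_0_pos[of x] exp_inv_0_pos(2)[of "1-x"] by (auto simp: smooth_step_def divide_simps)

lemma smooth_step_0 [simp]: "x \<le> 0 \<Longrightarrow> smooth_step x = 0"
  by (simp add: smooth_step_def exp_inv_def)

lemma smooth_step_1 [simp]: "x \<ge> 1 \<Longrightarrow> smooth_step x = 1"
  by (simp add: smooth_step_def exp_inv_def)

lemma smooth_upto_smooth_step: "smooth_upto k UNIV smooth_step"
proof -
  have 1: "smooth_upto k UNIV (\<lambda>x. exp_inv 0 (1 + (- x)))"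
    by (rule smooth_upto_compose_affine[where T=UNIV]) (auto intro: bounded_linear_minus bounded_linear_ident smooth_upto_exp_inv)
  have "smooth_upto k UNIV (\<lambda>x. (exp_inv 0 x + exp_inv 0 (1 + (- x))) powr (-1))"
  proof (rule smooth_upto_compose_real[where T="{0<..}" and F="\<lambda>y. y powr (-1)"])
    show "smooth_upto k UNIV (\<lambda>x. exp_inv 0 x + exp_inv 0 (1 + (- x)))"
      by (rule smooth_upto_add[OF _ smooth_upto_exp_inv 1]) simp
    show "exp_inv 0 x + exp_inv 0 (1 + (- x)) \<in> {0<..}" for x :: real
      using exp_inv_0_pos(1)[of x] by simp
  qed ((rule smooth_upto_powr | simp)+)
  then have "smooth_upto k UNIV (\<lambda>x. exp_inv 0 x * (exp_inv 0 x + exp_inv 0 (1 + (- x))) powr (-1))"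
    by (intro smooth_upto_mult smooth_upto_exp_inv) auto
  then show ?thesis
  proof (rule smooth_upto_cong[rotated 2])
    fix x :: real
    have "0 < exp_inv 0 x + exp_inv 0 (1 + (- x))" using exp_inv_0_pos(1)[of x] by simp
    then show "exp_inv 0 x * (exp_inv 0 x + exp_inv 0 (1 + (- x))) powr (-1) = smooth_step x"
      by (subst powr_minus_divide) (simp add: smooth_step_def)
  qed auto
qed

text \<open>The shift by 2 places the descent of each factor from 1 to 0 between distance
  \<open>\<delta>\<close> and \<open>2 * \<delta>\<close> from the unit interval. The bump is
  therefore constant on a neighbourhood of the cube, which later makes relations between bumps hold
  near the Cantor set and not only on it.\<close>

definition cube_bump :: "real \<Rightarrow> 'a::euclidean_space \<Rightarrow> real" where
  "cube_bump \<delta> p = (\<Prod>b\<in>Basis. smooth_step (2 + (p \<bullet> b) / \<delta>) * smooth_step (2 + (1 - p \<bullet> b) / \<delta>))"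

lemma smooth_upto_cube_bump: "smooth_upto k UNIV (cube_bump \<delta> :: 'a::euclidean_space \<Rightarrow> real)"
proof -
  have 1: "smooth_upto k UNIV (\<lambda>p::'a. smooth_step (2 + (p \<bullet> b) / \<delta>))" for b
    by (rule smooth_upto_compose_affine[where A="\<lambda>p. (p \<bullet> b) / \<delta>" and T=UNIV])
      (auto intro!: smooth_upto_smooth_step bounded_linear_divide[THEN bounded_linear_compose] bounded_linear_inner_left)
  have 2: "smooth_upto k UNIV (\<lambda>p::'a. smooth_step ((2 + 1 / \<delta>) + - ((p \<bullet> b) / \<delta>)))" for b
    by (rule smooth_upto_compose_affine[where A="\<lambda>p. - ((p \<bullet> b) / \<delta>)" and T=UNIV])
      (auto intro!: smooth_upto_smooth_step bounded_linear_minus bounded_linear_divide[THEN bounded_linear_compose] bounded_linear_inner_left)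
  have 3: "(\<lambda>p::'a. smooth_step ((2 + 1 / \<delta>) + - ((p \<bullet> b) / \<delta>))) = (\<lambda>p. smooth_step (2 + (1 - p \<bullet> b) / \<delta>))" for b
    by (simp add: diff_divide_distrib algebra_simps)
  show ?thesis
    unfolding cube_bump_def by (intro smooth_upto_prod smooth_upto_mult 1 2[unfolded 3]) auto
qed

lemma cube_bump_range: "0 \<le> cube_bump \<delta> p" "cube_bump \<delta> p \<le> 1"
  using smooth_step_range by (auto simp: cube_bump_def intro!: prod_nonneg prod_le_1 mult_le_one)

lemma cube_bump_eq_1:
  assumes "\<delta> > 0" "\<And>b. b \<in> Basis \<Longrightarrow> - \<delta> \<le> p \<bullet> b \<and> p \<bullet> b \<le> 1 + \<delta>"
  shows "cube_bump \<delta> p = 1"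
  unfolding cube_bump_def
proof (rule prod.neutral, rule ballI)
  fix b :: 'a assume "b \<in> Basis"
  from assms(2)[OF this] have "2 + (p \<bullet> b) / \<delta> \<ge> 1" "2 + (1 - p \<bullet> b) / \<delta> \<ge> 1"
    using assms(1) by (auto simp: field_simps)
  then show "smooth_step (2 + (p \<bullet> b) / \<delta>) * smooth_step (2 + (1 - p \<bullet> b) / \<delta>) = 1" by simp
qed

lemma cube_bump_eq_0:
  assumes "\<delta> > 0" "b \<in> Basis" "p \<bullet> b \<le> - 2 * \<delta> \<or> p \<bullet> b \<ge> 1 + 2 * \<delta>"
  shows "cube_bump \<delta> p = 0"
proof -
  have "2 + (p \<bullet> b) / \<delta> \<le> 0 \<or> 2 + (1 - p \<bullet> b) / \<delta> \<le> 0"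
    using assms(1,3) by (auto simp: field_simps)
  then show ?thesis
    unfolding cube_bump_def using assms(2)
    by (intro prod_zero bexI[of _ b]) (auto dest: smooth_step_0)
qed

section \<open>The Poisson kernel\<close>

subsection \<open>Subordination\<close>

text \<open>The distribution function is an antiderivative of the Gaussian density with known limits
  at both ends; the subordination formula evaluates an improper integral through it.\<close>

lemma cdf_std_normal_has_derivative:
  "(cdf std_normal_distribution has_real_derivative std_normal_density x) (at x)"
proof -
  let ?K = "cdf std_normal_distribution"
  interpret S: real_distribution std_normal_distribution by (rule real_dist_normal_dist)
  have cont: "isCont std_normal_density x" for x
    unfolding std_normal_density_def by (intro continuous_intros) auto
  obtain F where F: "\<And>x::real. (F has_real_derivative std_normal_density x) (at x)"
    using einterval_antiderivative[of "-\<infinity>" \<infinity> std_normal_density] cont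
    by (auto simp: has_real_derivative_iff_has_vector_derivative)
  have diff: "?K y - ?K z = F y - F z" if "z < y" for y z
  proof -
    have "measure std_normal_distribution {z<..y} = (LINT w|lborel. indicator {z<..y} w * std_normal_density w)"
      unfolding measure_def
      by (subst emeasure_density)
        (auto simp: integral_eq_nn_integral indicator_def intro!: arg_cong[where f=enn2real] nn_integral_cong)
    also have "\<dots> = (LINT w|lborel. indicator {z..y} w *\<^sub>R std_normal_density w)"
      by (intro integral_cong_AE) (auto simp: indicator_def intro!: AE_I[where N="{z}"])
    also have "\<dots> = F y - F z"
    proof (rule integral_FTC_Icc)
      show "(F has_vector_derivative std_normal_density w) (at w within {z..y})" for w
        using F[of w] by (simp add: has_real_derivative_iff_has_vector_derivative has_vector_derivative_at_within)
      show "continuous_on {z..y} std_normal_density"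
        using cont by (simp add: continuous_at_imp_continuous_on)
    qed (use that in simp)
    finally show ?thesis using S.cdf_diff_eq[OF that] by simp
  qed
  define c where "c = ?K 0 - F 0"
  have "?K y = F y + c" for y unfolding c_def
    using diff[of 0 y] diff[of y 0] by (cases "y = 0"; cases "y < 0") auto
  then have "?K = (\<lambda>y. F y + c)" by auto
  moreover have "((\<lambda>y. F y + c) has_real_derivative std_normal_density x) (at x)"
    using F[of x] by (auto intro!: derivative_eq_intros)
  ultimately show ?thesis by simp
qed

text \<open>Subordination: \<open>exp (- b)\<close> is an average over \<open>v\<close> of Gaussians
  in \<open>b\<close>. With \<open>b = s * norm \<xi>\<close> this reduces the Fourier analysis of
  the Poisson kernel to that of Gaussians.\<close>

lemma std_normal_subordination_pos:
  assumes b: "b > 0"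
  shows "has_bochner_integral lborel (\<lambda>v. std_normal_density v * exp (- (b\<^sup>2 / (2 * v\<^sup>2)))) (exp (- b))"
proof -
  interpret S: real_distribution std_normal_distribution by (rule real_dist_normal_dist)
  let ?K = "cdf std_normal_distribution"
  let ?f = "\<lambda>v. std_normal_density v * exp (- (b\<^sup>2 / (2 * v\<^sup>2)))"
  \<comment> \<open>an antiderivative on \<open>v > 0\<close>, found by completing the square as \<open>(v \<plusminus> b / v)\<^sup>2\<close>\<close>
  define H where "H v = (exp b * ?K (v + b / v) + exp (- b) * ?K (v - b / v)) / 2" for v
  have der: "(H has_real_derivative ?f v) (at v)" if "v > 0" for v
  proof -
    have 1: "exp b * std_normal_density (v + b / v) = ?f v"
      using that by (simp add: std_normal_density_def exp_add[symmetric] field_simps power2_eq_square)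
    have 2: "exp (- b) * std_normal_density (v - b / v) = ?f v"
      using that by (simp add: std_normal_density_def exp_add[symmetric] field_simps power2_eq_square)
    have "(H has_real_derivative
        (exp b * (std_normal_density (v + b / v) * (1 - b / v\<^sup>2))
         + exp (- b) * (std_normal_density (v - b / v) * (1 + b / v\<^sup>2))) / 2) (at v)"
      unfolding H_def using that
      by (auto intro!: derivative_eq_intros DERIV_chain2[OF cdf_std_normal_has_derivative] simp: power2_eq_square)
    also have "(exp b * (std_normal_density (v + b / v) * (1 - b / v\<^sup>2))
         + exp (- b) * (std_normal_density (v - b / v) * (1 + b / v\<^sup>2))) / 2
        = (?f v * (1 - b / v\<^sup>2) + ?f v * (1 + b / v\<^sup>2)) / 2"
      unfolding mult.assoc[symmetric] 1 2 ..
    also have "\<dots> = ?f v" by (simp add: algebra_simps)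
    finally show ?thesis .
  qed
  have cont: "isCont ?f v" if "v > 0" for v
    unfolding std_normal_density_def using that by (intro continuous_intros) auto
  have A0: "(H \<longlongrightarrow> (exp b * 1 + exp (- b) * 0) / 2) (at_right 0)"
    unfolding H_def
  proof (intro tendsto_intros)
    show "((\<lambda>v. ?K (v + b / v)) \<longlongrightarrow> 1) (at_right 0)"
      by (rule filterlim_compose[OF S.cdf_lim_at_top_prob]) (use b in real_asymp)
    show "((\<lambda>v. ?K (v - b / v)) \<longlongrightarrow> 0) (at_right 0)"
      by (rule filterlim_compose[OF S.cdf_lim_at_bot]) (use b in real_asymp)
  qed auto
  have B0: "(H \<longlongrightarrow> (exp b * 1 + exp (- b) * 1) / 2) at_top"
    unfolding H_def
  proof (intro tendsto_intros)
    show "((\<lambda>v. ?K (v + b / v)) \<longlongrightarrow> 1) at_top"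
      by (rule filterlim_compose[OF S.cdf_lim_at_top_prob]) (use b in real_asymp)
    show "((\<lambda>v. ?K (v - b / v)) \<longlongrightarrow> 1) at_top"
      by (rule filterlim_compose[OF S.cdf_lim_at_top_prob]) (use b in real_asymp)
  qed auto
  have A: "((H \<circ> real_of_ereal) \<longlongrightarrow> exp b / 2) (at_right (0::ereal))"
    using A0 unfolding zero_ereal_def by (simp add: ereal_tendsto_simps)
  have B: "((H \<circ> real_of_ereal) \<longlongrightarrow> (exp b + exp (- b)) / 2) (at_left (\<infinity>::ereal))"
    using B0 by (simp add: ereal_tendsto_simps)
  have I: "set_integrable lborel (einterval 0 \<infinity>) ?f" "(LBINT v=0..\<infinity>. ?f v) = exp (- b) / 2"
    using interval_integral_FTC_nonneg[of 0 \<infinity> H ?f "exp b / 2" "(exp b + exp (- b)) / 2"] der cont A B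
    by (auto simp: field_simps)
  have e: "einterval 0 \<infinity> = {0<..}" by (auto simp: einterval_def)
  have "has_bochner_integral lborel (\<lambda>v. indicator {0<..} v *\<^sub>R ?f v) (exp (- b) / 2)"
    using I unfolding e interval_lebesgue_integral_def set_integrable_def set_lebesgue_integral_def
    by (simp add: has_bochner_integral_iff)
  then have "has_bochner_integral lborel (\<lambda>v. indicator {0..} v *\<^sub>R ?f v) (exp (- b) / 2)"
    by (rule has_bochner_integral_cong_AE[THEN iffD1, rotated -1])
      (auto simp: indicator_def intro!: AE_I[where N="{0}"])
  from has_bochner_integral_even_function[OF this] show ?thesis
    by (simp add: std_normal_density_def)
qed

lemma std_normal_subordination:
  assumes "b \<ge> 0"
  shows "has_bochner_integral lborel (\<lambda>v. std_normal_density v * exp (- (b\<^sup>2 / (2 * v\<^sup>2)))) (exp (- b))"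
proof (cases "b = 0")
  case True
  then show ?thesis
    using integral_std_normal_moment_even[of 0] integrable_std_normal_moment[of 0]
    by (simp add: has_bochner_integral_iff)
qed (use assms std_normal_subordination_pos in auto)

subsection \<open>Gaussian integrals\<close>

lemma cis_borel_measurable [measurable]: "cis \<in> borel_measurable borel"
  by (intro borel_measurable_continuous_onI continuous_intros)

text \<open>This is the characteristic function of the standard normal law after the dilation by
  \<open>c = sqrt (2 * a)\<close>.\<close>

lemma has_bochner_integral_gaussian_1:
  assumes a: "a > (0::real)"
  shows "has_bochner_integral lborel (\<lambda>x. cis (x * t) * of_real (exp (- a * x\<^sup>2)))
           (of_real (sqrt (pi / a) * exp (- t\<^sup>2 / (4 * a))))"
proof -
  define c where "c = sqrt (2 * a)"
  have c: "c > 0" "c\<^sup>2 = 2 * a" using a by (auto simp: c_def)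
  let ?f = "\<lambda>x. std_normal_density x *\<^sub>R iexp (t / c * x)"
  have int: "integrable lborel ?f"
  proof -
    have "integrable lborel std_normal_density" using integrable_std_normal_moment[of 0] by simp
    then show ?thesis
      by (rule Bochner_Integration.integrable_bound) (auto simp: norm_mult)
  qed
  have "(LINT x|lborel. ?f x) = char std_normal_distribution (t / c)"
    unfolding char_def by (subst integral_density) auto
  also have "\<dots> = of_real (exp (- (t / c)\<^sup>2 / 2))"
    by (simp add: char_std_normal_distribution)
  finally have v: "(LINT x|lborel. ?f x) = of_real (exp (- (t / c)\<^sup>2 / 2))" .
  have "has_bochner_integral lborel (\<lambda>x. ?f (0 + c * x)) (inverse \<bar>c\<bar> *\<^sub>R of_real (exp (- (t / c)\<^sup>2 / 2)))"
    using int v c lborel_has_bochner_integral_real_affine_iff[of c ?f "of_real (exp (- (t / c)\<^sup>2 / 2))" 0]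
    by (simp add: has_bochner_integral_iff)
  then have "has_bochner_integral lborel (\<lambda>x. of_real (sqrt (2 * pi)) * ?f (0 + c * x))
      (of_real (sqrt (2 * pi)) * (inverse \<bar>c\<bar> *\<^sub>R of_real (exp (- (t / c)\<^sup>2 / 2))))"
    by (rule has_bochner_integral_mult_right)
  moreover have "of_real (sqrt (2 * pi)) * ?f (0 + c * x) = cis (x * t) * of_real (exp (- a * x\<^sup>2))" for x
    using c by (simp add: std_normal_density_def cis_conv_exp scaleR_conv_of_real power_mult_distrib mult_ac)
  moreover have "of_real (sqrt (2 * pi)) * (inverse \<bar>c\<bar> *\<^sub>R of_real (exp (- (t / c)\<^sup>2 / 2)))
      = (of_real (sqrt (pi / a) * exp (- t\<^sup>2 / (4 * a))) :: complex)"
    using c(1) a by (simp add: power_divide c(2) scaleR_conv_of_real real_sqrt_divide field_simps)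
       (simp add: c_def real_sqrt_mult)
  ultimately show ?thesis by simp
qed

text \<open>Lebesgue measure is the image of the product measure over \<open>Basis\<close>, so an
  integrand that splits into coordinates integrates factor by factor.\<close>

lemma has_bochner_integral_lborel_prod:
  fixes f :: "'a::euclidean_space \<Rightarrow> real \<Rightarrow> complex"
  assumes "\<And>b. b \<in> Basis \<Longrightarrow> has_bochner_integral lborel (f b) (I b)"
  shows "has_bochner_integral lborel (\<lambda>x::'a. \<Prod>b\<in>Basis. f b (x \<bullet> b)) (\<Prod>b\<in>Basis. I b)"
proof -
  interpret product_sigma_finite "\<lambda>_::'a. lborel :: real measure" ..
  have int: "\<And>b. b \<in> Basis \<Longrightarrow> integrable lborel (f b)" and v: "\<And>b. b \<in> Basis \<Longrightarrow> integral\<^sup>L lborel (f b) = I b"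
    using assms by (auto simp: has_bochner_integral_iff)
  have [measurable]: "b \<in> Basis \<Longrightarrow> f b \<in> borel_measurable borel" for b
    using int[of b] borel_measurable_integrable[of lborel "f b"] by simp
  have M: "(\<lambda>x::'a. \<Prod>b\<in>Basis. f b (x \<bullet> b)) \<in> borel_measurable borel"
    by measurable
  have "has_bochner_integral (\<Pi>\<^sub>M b\<in>(Basis::'a set). lborel) (\<lambda>x. \<Prod>b\<in>Basis. f b (x b)) (\<Prod>b\<in>Basis. I b)"
    using product_integrable_prod[of Basis f] product_integral_prod[of Basis f] int v
    by (simp add: has_bochner_integral_iff)
  then have "has_bochner_integral (\<Pi>\<^sub>M b\<in>(Basis::'a set). lborel)
      (\<lambda>x. \<Prod>b\<in>Basis. f b ((\<Sum>c\<in>Basis. x c *\<^sub>R c) \<bullet> b)) (\<Prod>b\<in>Basis. I b)"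
    by (simp cong: prod.cong)
  then show ?thesis
    unfolding lborel_eq[where 'a='a] using M by (subst has_bochner_integral_distr) auto
qed

lemma has_bochner_integral_gaussian:
  fixes \<xi> :: "'a::euclidean_space"
  assumes a: "a > (0::real)"
  shows "has_bochner_integral lborel (\<lambda>x. cis (x \<bullet> \<xi>) * of_real (exp (- a * (norm x)\<^sup>2)))
           (of_real (sqrt (pi / a) ^ DIM('a) * exp (- (norm \<xi>)\<^sup>2 / (4 * a))))"
proof -
  have n: "(norm (x::'a))\<^sup>2 = (\<Sum>b\<in>Basis. (x \<bullet> b)\<^sup>2)" for x
    unfolding power2_norm_eq_inner by (subst euclidean_inner) (simp add: power2_eq_square)
  have "has_bochner_integral lborel (\<lambda>x. \<Prod>b\<in>Basis. cis ((x \<bullet> b) * (\<xi> \<bullet> b)) * of_real (exp (- a * (x \<bullet> b)\<^sup>2)))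
     (\<Prod>b\<in>Basis. of_real (sqrt (pi / a) * exp (- (\<xi> \<bullet> b)\<^sup>2 / (4 * a))))"
    by (rule has_bochner_integral_lborel_prod[OF has_bochner_integral_gaussian_1[OF a]])
  moreover have "(\<Prod>b\<in>Basis. cis ((x \<bullet> b) * (\<xi> \<bullet> b)) * of_real (exp (- a * (x \<bullet> b)\<^sup>2)))
      = cis (x \<bullet> \<xi>) * of_real (exp (- a * (norm x)\<^sup>2))" for x
    by (simp add: prod.distrib n euclidean_inner[of x \<xi>] cis_conv_exp exp_sum[symmetric]
        of_real_prod[symmetric] sum_distrib_left sum_negf del: of_real_prod of_real_exp)
  moreover have "(\<Prod>b\<in>Basis. of_real (sqrt (pi / a) * exp (- (\<xi> \<bullet> b)\<^sup>2 / (4 * a))))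
      = (of_real (sqrt (pi / a) ^ DIM('a) * exp (- (norm \<xi>)\<^sup>2 / (4 * a))) :: complex)"
    by (simp add: prod.distrib n exp_sum[symmetric]
        of_real_prod[symmetric] sum_negf sum_divide_distrib del: of_real_prod of_real_exp)
  ultimately show ?thesis by simp
qed

subsection \<open>The kernel and its Fourier transform\<close>

text \<open>With \<open>n = DIM('a)\<close> this is the classical normalising constant
  Gamma((n+1)/2) / pi^((n+1)/2) of the Poisson kernel, in the form in which the Gaussian average
  delivers it.\<close>

definition poisson_const :: "'a::euclidean_space itself \<Rightarrow> real" where
  "poisson_const _ = (LINT w|lborel. std_normal_density w * \<bar>w\<bar> ^ DIM('a)) / sqrt (2 * pi) ^ DIM('a)"

definition poisson :: "real \<Rightarrow> 'a::euclidean_space \<Rightarrow> real" where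
  "poisson s x = poisson_const TYPE('a) * s / norm (x, s) ^ (DIM('a) + 1)"

lemma poisson_const_pos: "poisson_const TYPE('a::euclidean_space) > 0"
proof -
  let ?g = "\<lambda>w. std_normal_density w * \<bar>w\<bar> ^ DIM('a)"
  have "integrable lborel ?g" by (rule integrable_std_normal_moment_abs)
  moreover have "\<not> (AE w in lborel. ?g w = 0)"
  proof
    assume "AE w in lborel. ?g w = 0"
    moreover have "AE w::real in lborel. w \<noteq> 0"
      by (auto intro!: AE_I[where N="{0}"])
    ultimately have "AE w::real in lborel. False"
      by eventually_elim (auto simp: std_normal_density_def)
    then show False by (simp add: eventually_False ae_filter_eq_bot_iff)
  qed
  ultimately have "(LINT w|lborel. ?g w) \<noteq> 0"
    by (subst integral_nonneg_eq_0_iff_AE) auto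
  moreover have "(LINT w|lborel. ?g w) \<ge> 0" by (auto intro!: integral_nonneg)
  ultimately have "(LINT w|lborel. ?g w) > 0" by linarith
  then show ?thesis by (simp add: poisson_const_def)
qed

lemma norm_Pair_power2: "(norm (x, s::real))\<^sup>2 = (norm x)\<^sup>2 + s\<^sup>2"
  by (simp add: norm_Pair)

lemma norm_Pair_pos: "s > 0 \<Longrightarrow> norm (x, s::real) > 0"
  by (simp add: zero_prod_def)

lemma has_bochner_integral_of_realD:
  "has_bochner_integral M (\<lambda>x. complex_of_real (f x)) (of_real c) \<Longrightarrow> has_bochner_integral M f c"
  by (simp add: has_bochner_integral_iff complex_of_real_integrable_eq)

text \<open>The two exponentials merge into the Gaussian density at \<open>q * v\<close> with
  \<open>q = norm (x, s) / s\<close>; the dilation by \<open>q\<close> then leaves the absolute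
  moment that defines \<open>poisson_const\<close>.\<close>

lemma has_bochner_integral_poisson:
  fixes x :: "'a::euclidean_space"
  assumes s: "s > 0"
  shows "has_bochner_integral lborel
    (\<lambda>v. std_normal_density v * (\<bar>v\<bar> / (s * sqrt (2 * pi))) ^ DIM('a) * exp (- (v\<^sup>2 / (2 * s\<^sup>2)) * (norm x)\<^sup>2))
    (poisson s x)"
proof -
  define q where "q = norm (x, s) / s"
  have q: "q > 0" "q\<^sup>2 = 1 + (norm x)\<^sup>2 / s\<^sup>2"
    using s norm_Pair_pos[OF s, of x] by (auto simp: q_def power_divide norm_Pair_power2 add_divide_distrib)
  let ?g = "\<lambda>w. std_normal_density w * \<bar>w\<bar> ^ DIM('a)"
  let ?m = "LINT w|lborel. ?g w"
  have "has_bochner_integral lborel (\<lambda>v. ?g (0 + q * v)) (inverse \<bar>q\<bar> *\<^sub>R ?m)"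
    using lborel_has_bochner_integral_real_affine_iff[of q ?g ?m 0] q(1) integrable_std_normal_moment_abs
    by (simp add: has_bochner_integral_iff)
  then have "has_bochner_integral lborel (\<lambda>v. ?g (0 + q * v) * (1 / (q * s * sqrt (2 * pi))) ^ DIM('a))
      (inverse \<bar>q\<bar> *\<^sub>R ?m * (1 / (q * s * sqrt (2 * pi))) ^ DIM('a))"
    by (rule has_bochner_integral_mult_left)
  moreover have "?g (0 + q * v) * (1 / (q * s * sqrt (2 * pi))) ^ DIM('a)
      = std_normal_density v * (\<bar>v\<bar> / (s * sqrt (2 * pi))) ^ DIM('a) * exp (- (v\<^sup>2 / (2 * s\<^sup>2)) * (norm x)\<^sup>2)" for v
  proof -
    have "std_normal_density (q * v) = std_normal_density v * exp (- (v\<^sup>2 / (2 * s\<^sup>2)) * (norm x)\<^sup>2)"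
      using s by (simp add: std_normal_density_def power_mult_distrib q(2) exp_add[symmetric] field_simps)
    moreover have "\<bar>q * v\<bar> ^ DIM('a) * (1 / (q * s * sqrt (2 * pi))) ^ DIM('a) = (\<bar>v\<bar> / (s * sqrt (2 * pi))) ^ DIM('a)"
      using q(1) by (simp add: power_mult_distrib[symmetric] abs_mult)
    ultimately show ?thesis by (simp add: mult_ac)
  qed
  moreover have "inverse \<bar>q\<bar> *\<^sub>R ?m * (1 / (q * s * sqrt (2 * pi))) ^ DIM('a) = poisson s x"
  proof -
    have "q * s = norm (x, s)" using s by (simp add: q_def)
    moreover have "inverse q = s / norm (x, s)" by (simp add: q_def)
    ultimately show ?thesis
      using q(1) by (simp add: poisson_def poisson_const_def power_divide power_mult_distrib mult_ac)
  qed
  ultimately show ?thesis by simp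
qed

lemma poisson_nonneg: "s \<ge> 0 \<Longrightarrow> poisson s x \<ge> 0"
  unfolding poisson_def
  by (intro divide_nonneg_nonneg mult_nonneg_nonneg less_imp_le[OF poisson_const_pos]) auto

lemma poisson_minus [simp]: "poisson s (- x) = poisson s x"
  by (simp add: poisson_def norm_Pair)

lemma poisson_borel_measurable [measurable (raw)]:
  fixes f :: "'b \<Rightarrow> 'a::euclidean_space"
  assumes [measurable]: "s \<in> borel_measurable M" "f \<in> borel_measurable M"
  shows "(\<lambda>w. poisson (s w) (f w)) \<in> borel_measurable M"
  unfolding poisson_def norm_Pair by measurable

lemma AE_lborel_nonzero: "AE v::real in lborel. v \<noteq> 0"
  by (auto intro!: AE_I[where N="{0}"])

text \<open>Constants of the Gaussian mixture: by the first identity each weighted Gaussian in space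
  has mass 1, the second is its counterpart on the frequency side. The excluded value
  \<open>v = 0\<close> is a null set.\<close>

lemma gaussian_scale_eq:
  assumes "s > 0" "v \<noteq> (0::real)"
  shows "(\<bar>v\<bar> / (s * sqrt (2 * pi))) ^ n * sqrt (pi / (v\<^sup>2 / (2 * s\<^sup>2))) ^ n = 1"
    and "sqrt (pi / (s\<^sup>2 / (2 * v\<^sup>2))) ^ n = (2 * pi) ^ n * (\<bar>v\<bar> / (s * sqrt (2 * pi))) ^ n"
proof -
  have "sqrt (pi / (v\<^sup>2 / (2 * s\<^sup>2))) = sqrt (2 * pi) * s / \<bar>v\<bar>"
    using assms by (simp add: real_sqrt_divide real_sqrt_mult mult_ac)
  then show "(\<bar>v\<bar> / (s * sqrt (2 * pi))) ^ n * sqrt (pi / (v\<^sup>2 / (2 * s\<^sup>2))) ^ n = 1"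
    using assms by (simp add: power_mult_distrib[symmetric])
  have "sqrt (2 * pi) * sqrt (2 * pi) = 2 * pi" by simp
  then have "2 * pi * (\<bar>v\<bar> / (s * sqrt (2 * pi))) = sqrt (2 * pi) * \<bar>v\<bar> / s"
    using assms by (simp add: field_simps)
  moreover have "sqrt (pi / (s\<^sup>2 / (2 * v\<^sup>2))) = sqrt (2 * pi) * \<bar>v\<bar> / s"
    using assms by (simp add: real_sqrt_divide real_sqrt_mult mult_ac)
  ultimately have "sqrt (pi / (s\<^sup>2 / (2 * v\<^sup>2))) = 2 * pi * (\<bar>v\<bar> / (s * sqrt (2 * pi)))"
    by (simp only:)
  then show "sqrt (pi / (s\<^sup>2 / (2 * v\<^sup>2))) ^ n = (2 * pi) ^ n * (\<bar>v\<bar> / (s * sqrt (2 * pi))) ^ n"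
    by (simp only: power_mult_distrib)
qed

text \<open>The kernel is a mixture over \<open>v\<close> of Gaussians in \<open>x\<close>, so by
  Fubini its transform is the mixture of their transforms, which subordination sums to an
  exponential. The mixture is absolutely integrable because the Gaussian with parameter
  \<open>v\<close> carries mass \<open>std_normal_density v\<close>.\<close>

lemma has_bochner_integral_cis_poisson:
  fixes \<xi> :: "'a::euclidean_space"
  assumes s: "s > 0"
  shows "has_bochner_integral lborel (\<lambda>x. cis (x \<bullet> \<xi>) * of_real (poisson s x)) (of_real (exp (- s * norm \<xi>)))"
proof -
  let ?w = "\<lambda>v. std_normal_density v * (\<bar>v\<bar> / (s * sqrt (2 * pi))) ^ DIM('a)"
  let ?F = "\<lambda>v (x::'a). of_real (?w v) * (cis (x \<bullet> \<xi>) * of_real (exp (- (v\<^sup>2 / (2 * s\<^sup>2)) * (norm x)\<^sup>2)))"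
  have g: "has_bochner_integral lborel (\<lambda>x::'a. cis (x \<bullet> \<eta>) * of_real (exp (- (v\<^sup>2 / (2 * s\<^sup>2)) * (norm x)\<^sup>2)))
     (of_real (sqrt (pi / (v\<^sup>2 / (2 * s\<^sup>2))) ^ DIM('a) * exp (- (norm \<eta>)\<^sup>2 / (4 * (v\<^sup>2 / (2 * s\<^sup>2))))))"
    if "v \<noteq> 0" for v and \<eta> :: 'a
    using has_bochner_integral_gaussian[of "v\<^sup>2 / (2 * s\<^sup>2)" \<eta>] that s by simp
  have F: "has_bochner_integral lborel (?F v) (of_real (std_normal_density v * exp (- ((s * norm \<xi>)\<^sup>2 / (2 * v\<^sup>2)))))"
    if "v \<noteq> 0" for v
  proof -
    have "of_real (?w v) * of_real (sqrt (pi / (v\<^sup>2 / (2 * s\<^sup>2))) ^ DIM('a) * exp (- (norm \<xi>)\<^sup>2 / (4 * (v\<^sup>2 / (2 * s\<^sup>2)))))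
       = (of_real (std_normal_density v * ((\<bar>v\<bar> / (s * sqrt (2 * pi))) ^ DIM('a) * sqrt (pi / (v\<^sup>2 / (2 * s\<^sup>2))) ^ DIM('a))
           * exp (- (norm \<xi>)\<^sup>2 / (4 * (v\<^sup>2 / (2 * s\<^sup>2))))) :: complex)"
      by (simp only: of_real_mult mult_ac)
    also have "\<dots> = of_real (std_normal_density v * exp (- ((s * norm \<xi>)\<^sup>2 / (2 * v\<^sup>2))))"
      unfolding gaussian_scale_eq(1)[OF s that] by (simp add: power_mult_distrib mult_ac)
    finally have eq: "of_real (?w v) * of_real (sqrt (pi / (v\<^sup>2 / (2 * s\<^sup>2))) ^ DIM('a) * exp (- (norm \<xi>)\<^sup>2 / (4 * (v\<^sup>2 / (2 * s\<^sup>2)))))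
      = (of_real (std_normal_density v * exp (- ((s * norm \<xi>)\<^sup>2 / (2 * v\<^sup>2)))) :: complex)" .
    show ?thesis
      using has_bochner_integral_mult_right[OF g[OF that, of \<xi>], of "of_real (?w v)"] unfolding eq .
  qed
  have N: "(LINT x|lborel. norm (?F v x)) = std_normal_density v" if "v \<noteq> 0" for v
  proof -
    have "has_bochner_integral lborel (\<lambda>x::'a. exp (- (v\<^sup>2 / (2 * s\<^sup>2)) * (norm x)\<^sup>2)) (sqrt (pi / (v\<^sup>2 / (2 * s\<^sup>2))) ^ DIM('a))"
      using g[OF that, of 0] by (intro has_bochner_integral_of_realD) simp
    then have "(LINT x|lborel. ?w v * exp (- (v\<^sup>2 / (2 * s\<^sup>2)) * (norm (x::'a))\<^sup>2)) = ?w v * sqrt (pi / (v\<^sup>2 / (2 * s\<^sup>2))) ^ DIM('a)"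
      by (simp add: has_bochner_integral_iff)
    also have "\<dots> = std_normal_density v"
      using gaussian_scale_eq(1)[OF s that, of "DIM('a)"] by (simp only: mult.assoc)
    finally have *: "(LINT x|lborel. ?w v * exp (- (v\<^sup>2 / (2 * s\<^sup>2)) * (norm (x::'a))\<^sup>2)) = std_normal_density v" .
    have "0 \<le> ?w v" using s by simp
    then have "norm (?F v x) = ?w v * exp (- (v\<^sup>2 / (2 * s\<^sup>2)) * (norm (x::'a))\<^sup>2)" for x
      by (simp only: norm_mult norm_of_real norm_cis abs_of_nonneg abs_exp_cancel mult_1)
    then show ?thesis using * by (simp only:)
  qed
  have int: "integrable (lborel \<Otimes>\<^sub>M lborel) (\<lambda>(v, x). ?F v x)"
  proof (rule lborel_pair.Fubini_integrable)
    show "(\<lambda>(v, x). ?F v x) \<in> borel_measurable (lborel \<Otimes>\<^sub>M lborel)"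
      unfolding split_beta by measurable
    have "integrable lborel std_normal_density" using integrable_std_normal_moment[of 0] by simp
    then show "integrable lborel (\<lambda>v. LINT x|lborel. norm (case (v, x) of (v, x) \<Rightarrow> ?F v x))"
      by (rule integrable_cong_AE_imp) (use AE_lborel_nonzero in \<open>auto elim!: eventually_mono dest: N\<close>)
    show "AE v in lborel. integrable lborel (\<lambda>x. case (v, x) of (v, x) \<Rightarrow> ?F v x)"
      using AE_lborel_nonzero by eventually_elim (use F in \<open>auto simp: has_bochner_integral_iff\<close>)
  qed
  have inner: "(LINT v|lborel. ?F v x) = cis (x \<bullet> \<xi>) * of_real (poisson s x)" for x
  proof -
    have "(LINT v|lborel. ?F v x) = (LINT v|lborel. cis (x \<bullet> \<xi>) * of_real (?w v * exp (- (v\<^sup>2 / (2 * s\<^sup>2)) * (norm x)\<^sup>2)))"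
      by (intro Bochner_Integration.integral_cong) auto
    also have "\<dots> = cis (x \<bullet> \<xi>) * of_real (LINT v|lborel. ?w v * exp (- (v\<^sup>2 / (2 * s\<^sup>2)) * (norm x)\<^sup>2))"
      by (simp only: integral_mult_right_zero integral_complex_of_real)
    finally show ?thesis
      using has_bochner_integral_poisson[OF s, of x] by (simp add: has_bochner_integral_iff)
  qed
  have "(LINT x|lborel. cis (x \<bullet> \<xi>) * of_real (poisson s x)) = (LINT x|lborel. LINT v|lborel. ?F v x)"
    by (simp only: inner)
  also have "\<dots> = (LINT v|lborel. LINT x|lborel. ?F v x)"
    using lborel_pair.Fubini_integral[OF int] .
  also have "\<dots> = (LINT v|lborel. of_real (std_normal_density v * exp (- ((s * norm \<xi>)\<^sup>2 / (2 * v\<^sup>2)))))"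
    by (intro integral_cong_AE) (use AE_lborel_nonzero in \<open>auto elim!: eventually_mono dest: F simp: has_bochner_integral_iff\<close>)
  also have "\<dots> = of_real (exp (- s * norm \<xi>))"
    using std_normal_subordination[of "s * norm \<xi>"] s by (simp add: has_bochner_integral_iff del: of_real_mult of_real_exp)
  finally have "(LINT x|lborel. cis (x \<bullet> \<xi>) * of_real (poisson s x)) = of_real (exp (- s * norm \<xi>))" .
  moreover have "integrable lborel (\<lambda>x. cis (x \<bullet> \<xi>) * of_real (poisson s x))"
    using lborel_pair.integrable_snd[OF int] by (simp only: inner)
  ultimately show ?thesis by (simp add: has_bochner_integral_iff)
qed

text \<open>The inverse transform is obtained by subordinating a second time, now in the frequency
  variable, instead of inverting the previous lemma.\<close>

lemma has_bochner_integral_cis_exp_norm: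
  fixes x :: "'a::euclidean_space"
  assumes s: "s > 0"
  shows "has_bochner_integral lborel (\<lambda>\<xi>. cis (x \<bullet> \<xi>) * of_real (exp (- s * norm \<xi>)))
     (of_real ((2 * pi) ^ DIM('a) * poisson s x))"
proof -
  let ?F = "\<lambda>v (\<xi>::'a). of_real (std_normal_density v) * (cis (x \<bullet> \<xi>) * of_real (exp (- (s\<^sup>2 / (2 * v\<^sup>2)) * (norm \<xi>)\<^sup>2)))"
  let ?w = "\<lambda>v. std_normal_density v * (\<bar>v\<bar> / (s * sqrt (2 * pi))) ^ DIM('a)"
  have g: "has_bochner_integral lborel (\<lambda>\<xi>::'a. cis (y \<bullet> \<xi>) * of_real (exp (- (s\<^sup>2 / (2 * v\<^sup>2)) * (norm \<xi>)\<^sup>2)))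
     (of_real ((2 * pi) ^ DIM('a) * (\<bar>v\<bar> / (s * sqrt (2 * pi))) ^ DIM('a) * exp (- (v\<^sup>2 / (2 * s\<^sup>2)) * (norm y)\<^sup>2)))"
    if "v \<noteq> 0" for v and y :: 'a
    using has_bochner_integral_gaussian[of "s\<^sup>2 / (2 * v\<^sup>2)" y] that s
    unfolding gaussian_scale_eq(2)[OF s that] by (simp add: inner_commute mult_ac)
  have F: "has_bochner_integral lborel (?F v) (of_real ((2 * pi) ^ DIM('a) * (?w v * exp (- (v\<^sup>2 / (2 * s\<^sup>2)) * (norm x)\<^sup>2))))"
    if "v \<noteq> 0" for v
    using has_bochner_integral_mult_right[OF g[OF that, of x], of "of_real (std_normal_density v)"]
    by (simp add: mult_ac)
  have N: "(LINT \<xi>|lborel. norm (?F v \<xi>)) = ?w v * (2 * pi) ^ DIM('a)" if "v \<noteq> 0" for v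
  proof -
    have "has_bochner_integral lborel (\<lambda>\<xi>::'a. exp (- (s\<^sup>2 / (2 * v\<^sup>2)) * (norm \<xi>)\<^sup>2))
        ((2 * pi) ^ DIM('a) * (\<bar>v\<bar> / (s * sqrt (2 * pi))) ^ DIM('a))"
      using g[OF that, of 0] by (intro has_bochner_integral_of_realD) simp
    then show ?thesis using s by (simp add: norm_mult abs_mult has_bochner_integral_iff)
  qed
  have int: "integrable (lborel \<Otimes>\<^sub>M lborel) (\<lambda>(v, \<xi>). ?F v \<xi>)"
  proof (rule lborel_pair.Fubini_integrable)
    show "(\<lambda>(v, \<xi>). ?F v \<xi>) \<in> borel_measurable (lborel \<Otimes>\<^sub>M lborel)"
      unfolding split_beta by measurable
    have "integrable lborel (\<lambda>v. ?w v * (2 * pi) ^ DIM('a))"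
      using integrable_std_normal_moment_abs[of "DIM('a)"]
      by (simp add: power_divide del: power_mult_distrib)
    then show "integrable lborel (\<lambda>v. LINT \<xi>|lborel. norm (case (v, \<xi>) of (v, \<xi>) \<Rightarrow> ?F v \<xi>))"
      by (rule integrable_cong_AE_imp) (use AE_lborel_nonzero in \<open>auto elim!: eventually_mono dest: N\<close>)
    show "AE v in lborel. integrable lborel (\<lambda>\<xi>. case (v, \<xi>) of (v, \<xi>) \<Rightarrow> ?F v \<xi>)"
      using AE_lborel_nonzero by eventually_elim (use F in \<open>auto simp: has_bochner_integral_iff\<close>)
  qed
  have inner: "(LINT v|lborel. ?F v \<xi>) = cis (x \<bullet> \<xi>) * of_real (exp (- s * norm \<xi>))" for \<xi>
  proof -
    have "(LINT v|lborel. ?F v \<xi>) = (LINT v|lborel. cis (x \<bullet> \<xi>) * of_real (std_normal_density v * exp (- ((s * norm \<xi>)\<^sup>2 / (2 * v\<^sup>2)))))"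
      by (intro Bochner_Integration.integral_cong) (auto simp: power_mult_distrib)
    also have "\<dots> = cis (x \<bullet> \<xi>) * of_real (LINT v|lborel. std_normal_density v * exp (- ((s * norm \<xi>)\<^sup>2 / (2 * v\<^sup>2))))"
      by (simp only: integral_mult_right_zero integral_complex_of_real)
    finally show ?thesis
      using std_normal_subordination[of "s * norm \<xi>"] s by (simp add: has_bochner_integral_iff)
  qed
  have "(LINT \<xi>|lborel. cis (x \<bullet> \<xi>) * of_real (exp (- s * norm \<xi>))) = (LINT \<xi>|lborel. LINT v|lborel. ?F v \<xi>)"
    by (simp only: inner)
  also have "\<dots> = (LINT v|lborel. LINT \<xi>|lborel. ?F v \<xi>)"
    using lborel_pair.Fubini_integral[OF int] .
  also have "\<dots> = (LINT v|lborel. of_real ((2 * pi) ^ DIM('a) * (?w v * exp (- (v\<^sup>2 / (2 * s\<^sup>2)) * (norm x)\<^sup>2))))"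
    by (intro integral_cong_AE) (use AE_lborel_nonzero in \<open>auto elim!: eventually_mono dest: F simp: has_bochner_integral_iff\<close>)
  also have "\<dots> = of_real ((2 * pi) ^ DIM('a) * (LINT v|lborel. (?w v * exp (- (v\<^sup>2 / (2 * s\<^sup>2)) * (norm x)\<^sup>2))))"
    by (simp only: integral_complex_of_real integral_mult_right_zero)
  also have "\<dots> = of_real ((2 * pi) ^ DIM('a) * poisson s x)"
    using has_bochner_integral_poisson[OF s, of x] by (simp add: has_bochner_integral_iff)
  finally have "(LINT \<xi>|lborel. cis (x \<bullet> \<xi>) * of_real (exp (- s * norm \<xi>))) = of_real ((2 * pi) ^ DIM('a) * poisson s x)" .
  moreover have "integrable lborel (\<lambda>\<xi>. cis (x \<bullet> \<xi>) * of_real (exp (- s * norm \<xi>)))"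
    using lborel_pair.integrable_snd[OF int] by (simp only: inner)
  ultimately show ?thesis by (simp add: has_bochner_integral_iff)
qed

lemma has_bochner_integral_poisson_1:
  assumes "s > 0"
  shows "has_bochner_integral lborel (poisson s :: 'a::euclidean_space \<Rightarrow> real) 1"
  using has_bochner_integral_cis_poisson[OF assms, of "0::'a"]
  by (intro has_bochner_integral_of_realD) simp

lemma integrable_poisson: "s > 0 \<Longrightarrow> integrable lborel (poisson s :: 'a::euclidean_space \<Rightarrow> real)"
  using has_bochner_integral_poisson_1 by (auto simp: has_bochner_integral_iff)

lemma nn_integral_poisson:
  assumes "s > 0"
  shows "(\<integral>\<^sup>+x. ennreal (poisson s (x::'a::euclidean_space)) \<partial>lborel) = 1"
  using has_bochner_integral_poisson_1[OF assms, where 'a='a] assms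
  by (subst nn_integral_eq_integral) (auto simp: has_bochner_integral_iff intro!: AE_I2 poisson_nonneg)

text \<open>The kernel is replaced by its frequency integral, and Fubini collects the transform of
  \<open>g\<close>. Both the semigroup law and the identification of \<open>half_laplacian\<close>
  rest on this formula.\<close>

lemma poisson_convolution_fourier:
  fixes g :: "'a::euclidean_space \<Rightarrow> complex"
  assumes g: "integrable lborel g" and s: "s > 0"
  shows "(LINT y|lborel. g y * of_real (poisson s (x - y)))
    = (LINT \<xi>|lborel. cis (x \<bullet> \<xi>) * (of_real (exp (- s * norm \<xi>)) * fourier g \<xi>)) / of_real ((2 * pi) ^ DIM('a))"
proof -
  let ?F = "\<lambda>y \<xi>. g y * (cis ((x - y) \<bullet> \<xi>) * of_real (exp (- s * norm \<xi>)))"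
  have [measurable]: "g \<in> borel_measurable borel" using borel_measurable_integrable[OF g] by simp
  have hb: "has_bochner_integral lborel (?F y) (g y * of_real ((2 * pi) ^ DIM('a) * poisson s (x - y)))" for y
    by (rule has_bochner_integral_mult_right[OF has_bochner_integral_cis_exp_norm[OF s]])
  have int: "integrable (lborel \<Otimes>\<^sub>M lborel) (\<lambda>(y, \<xi>). ?F y \<xi>)"
  proof (rule lborel_pair.Fubini_integrable)
    show "(\<lambda>(y, \<xi>). ?F y \<xi>) \<in> borel_measurable (lborel \<Otimes>\<^sub>M lborel)"
      unfolding split_beta by measurable
    show "integrable lborel (\<lambda>y. LINT \<xi>|lborel. norm (case (y, \<xi>) of (y, \<xi>) \<Rightarrow> ?F y \<xi>))"
      using g by (simp add: norm_mult)
    show "AE y in lborel. integrable lborel (\<lambda>\<xi>. case (y, \<xi>) of (y, \<xi>) \<Rightarrow> ?F y \<xi>)"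
      using hb by (auto simp: has_bochner_integral_iff)
  qed
  have "(LINT y|lborel. g y * of_real (poisson s (x - y))) * of_real ((2 * pi) ^ DIM('a))
     = (LINT y|lborel. g y * of_real ((2 * pi) ^ DIM('a) * poisson s (x - y)))"
    by (subst integral_mult_left_zero[symmetric]) (simp add: mult_ac)
  also have "\<dots> = (LINT y|lborel. LINT \<xi>|lborel. ?F y \<xi>)"
    by (intro Bochner_Integration.integral_cong refl has_bochner_integral_integral_eq[OF hb, symmetric])
  also have "\<dots> = (LINT \<xi>|lborel. LINT y|lborel. ?F y \<xi>)"
    using lborel_pair.Fubini_integral[OF int] by simp
  also have "\<dots> = (LINT \<xi>|lborel. cis (x \<bullet> \<xi>) * (of_real (exp (- s * norm \<xi>)) * fourier g \<xi>))"
  proof (rule Bochner_Integration.integral_cong[OF refl])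
    fix \<xi> :: 'a
    have "?F y \<xi> = (cis (x \<bullet> \<xi>) * of_real (exp (- s * norm \<xi>))) * (cis (- (y \<bullet> \<xi>)) * g y)" for y
    proof -
      have "cis ((x - y) \<bullet> \<xi>) = cis (x \<bullet> \<xi>) * cis (- (y \<bullet> \<xi>))"
        by (simp add: inner_diff_left cis_mult)
      then show ?thesis by (simp only: mult_ac)
    qed
    then have "(LINT y|lborel. ?F y \<xi>) = (cis (x \<bullet> \<xi>) * of_real (exp (- s * norm \<xi>))) * fourier g \<xi>"
      unfolding fourier_def by (simp only: integral_mult_right_zero)
    then show "(LINT y|lborel. ?F y \<xi>) = cis (x \<bullet> \<xi>) * (of_real (exp (- s * norm \<xi>)) * fourier g \<xi>)"
      by (simp only: mult.assoc)
  qed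
  finally show ?thesis by (simp add: field_simps)
qed

lemma poisson_semigroup:
  fixes x :: "'a::euclidean_space"
  assumes s: "s > 0" and t: "t > 0"
  shows "(LINT y|lborel. poisson s y * poisson t (x - y)) = poisson (s + t) x"
proof -
  have "fourier (\<lambda>y. of_real (poisson s y)) \<xi> = of_real (exp (- s * norm \<xi>))" for \<xi> :: 'a
    using has_bochner_integral_cis_poisson[OF s, of "- \<xi>"] by (simp add: fourier_def has_bochner_integral_iff)
  then have "(LINT y|lborel. of_real (poisson s y) * of_real (poisson t (x - y)))
     = (LINT \<xi>|lborel. cis (x \<bullet> \<xi>) * of_real (exp (- (s + t) * norm \<xi>))) / of_real ((2 * pi) ^ DIM('a))"
    using poisson_convolution_fourier[of "\<lambda>y. of_real (poisson s y)" t x] integrable_poisson[OF s] t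
    by (simp add: complex_of_real_integrable_eq algebra_simps exp_add[symmetric] flip: of_real_mult)
  also have "\<dots> = of_real (poisson (s + t) x)"
    using has_bochner_integral_cis_exp_norm[of "s + t" x] s t
    by (simp add: has_bochner_integral_iff)
  finally show ?thesis
    by (simp flip: of_real_mult)
qed

section \<open>Test functions\<close>

lemma test_function_on_iff:
  "test_function_on U \<phi> \<longleftrightarrow>
     (\<forall>k. smooth_upto k UNIV \<phi>) \<and> compact (closure {x. \<phi> x \<noteq> 0}) \<and> closure {x. \<phi> x \<noteq> 0} \<subseteq> U"
  by (simp add: test_function_on_def C_times_iff_smooth_upto)

lemma test_function_smooth: "test_function_on U \<phi> \<Longrightarrow> smooth_upto k UNIV \<phi>"
  by (simp add: test_function_on_iff)

lemma test_functionI: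
  assumes "\<And>k. smooth_upto k UNIV \<phi>" "\<And>x. x \<notin> K \<Longrightarrow> \<phi> x = 0" "compact K"
  shows "test_function_on UNIV \<phi>"
proof -
  have "closure {x. \<phi> x \<noteq> 0} \<subseteq> K"
    using assms(2) by (intro closure_minimal compact_imp_closed assms(3)) auto
  then show ?thesis
    using assms(1,3) compact_Int_closed[of K "closure {x. \<phi> x \<noteq> 0}"]
    by (auto simp: test_function_on_iff Int_absorb1)
qed

lemma test_function_support:
  assumes "test_function_on U \<phi>"
  obtains K where "compact K" "\<And>x. x \<notin> K \<Longrightarrow> \<phi> x = 0"
proof
  show "compact (closure {x. \<phi> x \<noteq> 0})" using assms by (simp add: test_function_on_iff)
  show "\<phi> x = 0" if "x \<notin> closure {x. \<phi> x \<noteq> 0}" for x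
    using that closure_subset[of "{x. \<phi> x \<noteq> 0}"] by blast
qed

lemma test_function_continuous: "test_function_on U \<phi> \<Longrightarrow> continuous_on UNIV \<phi>"
  using test_function_smooth[of U \<phi> 0] by simp

lemma test_function_measurable: "test_function_on U \<phi> \<Longrightarrow> \<phi> \<in> borel_measurable borel"
  by (intro borel_measurable_continuous_onI test_function_continuous)

lemma test_function_has_derivative:
  "test_function_on U \<phi> \<Longrightarrow> (\<phi> has_derivative frechet_derivative \<phi> (at x)) (at x)"
  by (rule smooth_upto_Suc_has_derivative[OF test_function_smooth]) auto

lemma test_function_frechet:
  assumes "test_function_on U \<phi>"
  shows "test_function_on UNIV (\<lambda>x. frechet_derivative \<phi> (at x) v)"
proof -
  obtain K where K: "compact K" "\<And>x. x \<notin> K \<Longrightarrow> \<phi> x = 0" using test_function_support[OF assms] by blast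
  show ?thesis
  proof (rule test_functionI[OF _ _ K(1)])
    show "smooth_upto k UNIV (\<lambda>x. frechet_derivative \<phi> (at x) v)" for k
      using test_function_smooth[OF assms, of "Suc k"] by simp
    fix x assume x: "x \<notin> K"
    have "(\<phi> has_derivative (\<lambda>_. 0)) (at x)"
      by (rule has_derivative_transform_within_open[OF has_derivative_const, of "- K" x 0])
        (use x K compact_imp_closed in \<open>auto simp: open_Compl\<close>)
    then show "frechet_derivative \<phi> (at x) v = 0"
      using frechet_derivative_at by metis
  qed
qed

lemma test_function_add:
  assumes "test_function_on UNIV \<phi>" "test_function_on UNIV \<psi>"
  shows "test_function_on UNIV (\<lambda>x. \<phi> x + \<psi> x)"
proof -
  obtain K where K: "compact K" "\<And>x. x \<notin> K \<Longrightarrow> \<phi> x = 0" using test_function_support[OF assms(1)] by blast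
  obtain L where L: "compact L" "\<And>x. x \<notin> L \<Longrightarrow> \<psi> x = 0" using test_function_support[OF assms(2)] by blast
  show ?thesis
    by (rule test_functionI[of _ "K \<union> L"])
      (use K L in \<open>auto intro!: smooth_upto_add test_function_smooth[OF assms(1)] test_function_smooth[OF assms(2)]\<close>)
qed

lemma test_function_mult:
  assumes "test_function_on UNIV \<phi>" "\<And>k. smooth_upto k UNIV \<psi>"
  shows "test_function_on UNIV (\<lambda>x. \<phi> x * \<psi> x)" "test_function_on UNIV (\<lambda>x. \<psi> x * \<phi> x)"
proof -
  obtain K where K: "compact K" "\<And>x. x \<notin> K \<Longrightarrow> \<phi> x = 0" using test_function_support[OF assms(1)] by blast
  show "test_function_on UNIV (\<lambda>x. \<phi> x * \<psi> x)"
    by (rule test_functionI[of _ "K"])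
      (use K assms(2) in \<open>auto intro!: smooth_upto_mult test_function_smooth[OF assms(1)]\<close>)
  then show "test_function_on UNIV (\<lambda>x. \<psi> x * \<phi> x)" by (simp add: mult.commute)
qed

lemma test_function_cmult:
  assumes "test_function_on UNIV \<phi>"
  shows "test_function_on UNIV (\<lambda>x. c * \<phi> x)"
  using assms by (intro test_function_mult) auto

lemma test_function_0 [simp]: "test_function_on UNIV (\<lambda>x. 0)"
  by (rule test_functionI[of _ "{}"]) auto

lemma test_function_sum:
  "(\<And>i. i \<in> I \<Longrightarrow> test_function_on UNIV (f i)) \<Longrightarrow> test_function_on UNIV (\<lambda>x. \<Sum>i\<in>I. f i x)"
  by (induction I rule: infinite_finite_induct) (auto intro: test_function_add)

lemma test_function_diff:
  assumes "test_function_on UNIV \<phi>" "test_function_on UNIV \<psi>"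
  shows "test_function_on UNIV (\<lambda>x. \<phi> x - \<psi> x)"
  using test_function_add[OF assms(1) test_function_cmult[OF assms(2), of "-1"]] by simp

lemma test_function_bounded:
  assumes "test_function_on U \<phi>"
  obtains B where "B \<ge> 0" "\<And>x. norm (\<phi> x) \<le> B"
proof -
  obtain K where K: "compact K" "\<And>x. x \<notin> K \<Longrightarrow> \<phi> x = 0" using test_function_support[OF assms] by blast
  have "bounded (\<phi> ` K)"
    by (intro compact_imp_bounded compact_continuous_image K(1) continuous_on_subset[OF test_function_continuous[OF assms]]) auto
  then obtain B where B: "\<And>x. x \<in> K \<Longrightarrow> norm (\<phi> x) \<le> B"
    by (auto simp: bounded_iff)
  have "norm (\<phi> x) \<le> max 0 B" for x
    using B[of x] K(2)[of x] by (cases "x \<in> K") auto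
  then show ?thesis using that[of "max 0 B"] by auto
qed

section \<open>Lipschitz and second-order bounds for test functions\<close>

lemma norm_linear_le_sum_Basis:
  fixes A :: "'a::euclidean_space \<Rightarrow> 'b::real_normed_vector"
  assumes "linear A" "\<And>b. b \<in> Basis \<Longrightarrow> norm (A b) \<le> C b"
  shows "norm (A v) \<le> (\<Sum>b\<in>Basis. C b) * norm v"
proof -
  have "A v = A (\<Sum>b\<in>Basis. (v \<bullet> b) *\<^sub>R b)" by (simp add: euclidean_representation)
  also have "\<dots> = (\<Sum>b\<in>Basis. (v \<bullet> b) *\<^sub>R A b)"
    using assms(1) by (simp add: linear_sum linear_scale)
  also have "norm \<dots> \<le> (\<Sum>b\<in>Basis. norm v * C b)"
    by (intro sum_norm_le) (use assms(2) Basis_le_norm in \<open>auto intro!: mult_mono\<close>)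
  finally show ?thesis by (simp add: sum_distrib_left mult.commute)
qed

lemma test_function_lipschitz:
  assumes "test_function_on U \<phi>"
  obtains L where "L \<ge> 0" "\<And>x y. norm (\<phi> x - \<phi> y) \<le> L * norm (x - y)"
    "\<And>x v. norm (frechet_derivative \<phi> (at x) v) \<le> L * norm v"
proof -
  have "\<exists>B\<ge>0. \<forall>x. norm (frechet_derivative \<phi> (at x) b) \<le> B" for b
    using test_function_bounded[OF test_function_frechet[OF assms, of b]] by metis
  then obtain B where B: "\<And>b. B b \<ge> 0" "\<And>b x. norm (frechet_derivative \<phi> (at x) b) \<le> B b"
    by metis
  let ?L = "\<Sum>b\<in>Basis. B b"
  have D: "norm (frechet_derivative \<phi> (at x) v) \<le> ?L * norm v" for x v
    using B(2) has_derivative_linear[OF test_function_has_derivative[OF assms]]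
    by (intro norm_linear_le_sum_Basis) auto
  have "norm (\<phi> x - \<phi> y) \<le> ?L * norm (x - y)" for x y
    by (rule differentiable_bound[of UNIV \<phi> "\<lambda>x. frechet_derivative \<phi> (at x)"])
      (use D test_function_has_derivative[OF assms] in \<open>auto intro!: onorm_le\<close>)
  moreover have "?L \<ge> 0" using B(1) by (auto intro: sum_nonneg)
  ultimately show ?thesis using that D by blast
qed

text \<open>Along the segment, \<open>u\<close> has as derivative a difference of first derivatives
  of \<open>\<phi>\<close> at two points at distance \<open>2 * s * norm h\<close>. Their Lipschitz
  bound and the mean value inequality give the quadratic estimate.\<close>

lemma test_function_second_difference:
  assumes "test_function_on U \<phi>"
  obtains C where "C \<ge> 0" "\<And>x h. norm (\<phi> (x + h) + \<phi> (x - h) - 2 * \<phi> x) \<le> C * (norm h)\<^sup>2"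
proof -
  let ?D = "\<lambda>x. frechet_derivative \<phi> (at x)"
  have "\<exists>L\<ge>0. \<forall>x y. norm (?D x b - ?D y b) \<le> L * norm (x - y)" for b
    using test_function_lipschitz[OF test_function_frechet[OF assms, of b]] by metis
  then obtain L where L: "\<And>b. L b \<ge> 0" "\<And>b x y. norm (?D x b - ?D y b) \<le> L b * norm (x - y)"
    by metis
  define M where "M = (\<Sum>b\<in>Basis. L b)"
  have M0: "M \<ge> 0" unfolding M_def using L(1) by (auto intro: sum_nonneg)
  have lin: "linear (?D x)" for x by (rule has_derivative_linear[OF test_function_has_derivative[OF assms]])
  have M: "norm (?D x v - ?D y v) \<le> M * norm (x - y) * norm v" for x y v
    using norm_linear_le_sum_Basis[of "\<lambda>v. ?D x v - ?D y v" "\<lambda>b. L b * norm (x - y)"] L(2)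
      linear_compose_sub[OF lin lin]
    by (auto simp: M_def sum_distrib_right)
  have "norm (\<phi> (x + h) + \<phi> (x - h) - 2 * \<phi> x) \<le> 2 * M * (norm h)\<^sup>2" for x h
  proof -
    define u where "u = (\<lambda>s::real. \<phi> (x + s *\<^sub>R h) + \<phi> (x - s *\<^sub>R h))"
    have der: "(u has_derivative (\<lambda>r. ?D (x + s *\<^sub>R h) (r *\<^sub>R h) + ?D (x - s *\<^sub>R h) (- (r *\<^sub>R h)))) (at s)" for s
      unfolding u_def
      by (intro has_derivative_add has_derivative_compose[OF _ test_function_has_derivative[OF assms]])
        (auto intro!: derivative_eq_intros)
    have bd: "onorm (\<lambda>r. ?D (x + s *\<^sub>R h) (r *\<^sub>R h) + ?D (x - s *\<^sub>R h) (- (r *\<^sub>R h))) \<le> 2 * M * (norm h)\<^sup>2"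
      if "s \<in> {0..1}" for s :: real
    proof (rule onorm_le)
      fix r :: real
      have "norm (?D (x + s *\<^sub>R h) (r *\<^sub>R h) + ?D (x - s *\<^sub>R h) (- (r *\<^sub>R h)))
          = norm (?D (x + s *\<^sub>R h) (r *\<^sub>R h) - ?D (x - s *\<^sub>R h) (r *\<^sub>R h))"
        by (simp add: linear_neg[OF lin])
      also have "\<dots> \<le> M * norm ((2 * s) *\<^sub>R h) * norm (r *\<^sub>R h)"
        using M[of "x + s *\<^sub>R h" "r *\<^sub>R h" "x - s *\<^sub>R h"] by (simp add: algebra_simps scaleR_2[symmetric])
      also have "\<dots> \<le> M * (2 * norm h) * (norm r * norm h)"
        using that M0 by (intro mult_mono) (auto intro!: mult_left_le_one_le simp: mult_ac)
      finally show "norm (?D (x + s *\<^sub>R h) (r *\<^sub>R h) + ?D (x - s *\<^sub>R h) (- (r *\<^sub>R h))) \<le> 2 * M * (norm h)\<^sup>2 * norm r"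
        by (simp add: power2_eq_square mult_ac)
    qed
    have "norm (u 1 - u 0) \<le> 2 * M * (norm h)\<^sup>2 * norm (1 - 0 :: real)"
      by (rule differentiable_bound[of "{0..1}" u])
        (use der bd in \<open>auto intro: has_derivative_at_withinI\<close>)
    then show ?thesis by (simp add: u_def)
  qed
  then show ?thesis using that[of "2 * M"] M0 by auto
qed

lemma continuous_compact_support_integrable:
  fixes g :: "'a::euclidean_space \<Rightarrow> 'b::{banach, second_countable_topology}"
  assumes "continuous_on UNIV g" "compact K" "\<And>x. x \<notin> K \<Longrightarrow> g x = 0"
  shows "integrable lborel g"
proof -
  have "integrable lborel (\<lambda>x. indicator K x *\<^sub>R g x)"
    by (intro borel_integrable_compact assms continuous_on_subset[OF assms(1)]) auto
  moreover have "indicator K x *\<^sub>R g x = g x" for x using assms(3) by (auto simp: indicator_def)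
  ultimately show ?thesis by simp
qed

lemma test_function_integrable: "test_function_on U \<phi> \<Longrightarrow> integrable lborel \<phi>"
  by (metis test_function_support continuous_compact_support_integrable test_function_continuous)

section \<open>Invariance of Lebesgue measure and integrals of derivatives\<close>

lemma lborel_distr_translate_reflect:
  "distr lborel borel (\<lambda>x. a - x) = (lborel :: 'a::euclidean_space measure)"
  using lborel_affine[of "-1" a] by (simp add: density_1)

lemma integral_lborel_translate:
  fixes f :: "'a::euclidean_space \<Rightarrow> 'b::{banach, second_countable_topology}"
  assumes [measurable]: "f \<in> borel_measurable borel"
  shows "(LINT x|lborel. f (a + x)) = (LINT x|lborel. f x)"
proof -
  have "(LINT x|lborel. f x) = (LINT x|distr lborel borel ((+) a). f x)" by (simp add: lborel_distr_plus)
  also have "\<dots> = (LINT x|lborel. f (a + x))" by (subst integral_distr) auto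
  finally show ?thesis by simp
qed

lemma integral_lborel_reflect:
  fixes f :: "'a::euclidean_space \<Rightarrow> 'b::{banach, second_countable_topology}"
  assumes [measurable]: "f \<in> borel_measurable borel"
  shows "(LINT x|lborel. f (a - x)) = (LINT x|lborel. f x)"
proof -
  have "(LINT x|lborel. f x) = (LINT x|distr lborel borel (\<lambda>x. a - x). f x)" by (simp add: lborel_distr_translate_reflect)
  also have "\<dots> = (LINT x|lborel. f (a - x))" by (subst integral_distr) auto
  finally show ?thesis by simp
qed

lemma nn_integral_lborel_translate:
  assumes [measurable]: "f \<in> borel_measurable borel"
  shows "(\<integral>\<^sup>+x. f (a + x) \<partial>lborel) = (\<integral>\<^sup>+x. f (x::'a::euclidean_space) \<partial>lborel)"
proof -
  have "(\<integral>\<^sup>+x. f x \<partial>lborel) = (\<integral>\<^sup>+x. f x \<partial>distr lborel borel ((+) a))" by (simp add: lborel_distr_plus)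
  also have "\<dots> = (\<integral>\<^sup>+x. f (a + x) \<partial>lborel)" by (subst nn_integral_distr) auto
  finally show ?thesis by simp
qed

lemma has_vector_derivative_difference_quotient:
  assumes "(f has_vector_derivative D) (at (0::real))"
  shows "((\<lambda>h. (1 / h) *\<^sub>R (f h - f 0)) \<longlongrightarrow> D) (at 0)"
proof -
  have "((\<lambda>h. norm (f h - f 0 - h *\<^sub>R D) / norm h) \<longlongrightarrow> 0) (at 0)"
    using assms by (simp add: has_vector_derivative_def has_derivative_at)
  then have "((\<lambda>h. norm ((1 / h) *\<^sub>R (f h - f 0) - D)) \<longlongrightarrow> 0) (at 0)"
  proof (rule Lim_transform_eventually)
    have "norm (f h - f 0 - h *\<^sub>R D) / norm h = norm ((1 / h) *\<^sub>R (f h - f 0) - D)" if "h \<noteq> 0" for h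
    proof -
      have "(1 / h) *\<^sub>R (f h - f 0) - D = (1 / h) *\<^sub>R (f h - f 0 - h *\<^sub>R D)"
        using that by (simp add: scaleR_diff_right)
      then show ?thesis by simp
    qed
    then show "\<forall>\<^sub>F h in at 0. norm (f h - f 0 - h *\<^sub>R D) / norm h = norm ((1 / h) *\<^sub>R (f h - f 0) - D)"
      by (auto simp: eventually_at_filter)
  qed
  then show ?thesis
    using Lim_null tendsto_norm_zero_iff by blast
qed

text \<open>Difference quotients in direction \<open>v\<close> have integral 0 by translation
  invariance, and they converge boundedly to the derivative inside a fixed ball.\<close>

lemma integral_frechet_test_function:
  fixes \<phi> :: "'a::euclidean_space \<Rightarrow> complex"
  assumes "test_function_on U \<phi>"
  shows "(LINT x|lborel. frechet_derivative \<phi> (at x) v) = 0"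
proof -
  obtain K where K: "compact K" "\<And>x. x \<notin> K \<Longrightarrow> \<phi> x = 0" using test_function_support[OF assms] by blast
  obtain L where L: "L \<ge> 0" "\<And>x y. norm (\<phi> x - \<phi> y) \<le> L * norm (x - y)"
    using test_function_lipschitz[OF assms] by metis
  have [measurable]: "\<phi> \<in> borel_measurable borel" by (rule test_function_measurable[OF assms])
  have [measurable]: "(\<lambda>x. frechet_derivative \<phi> (at x) v) \<in> borel_measurable borel"
    by (rule test_function_measurable[OF test_function_frechet[OF assms]])
  let ?q = "\<lambda>n x. real (Suc n) *\<^sub>R (\<phi> ((1 / real (Suc n)) *\<^sub>R v + x) - \<phi> x)"
  obtain R where R: "R > 0" "K \<subseteq> cball 0 R"
    using compact_imp_bounded[OF K(1)] unfolding bounded_pos by (auto simp: subset_iff)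
  \<comment> \<open>Enlarging the radius by \<open>norm v\<close> makes the ball contain the support
    of every translate that occurs.\<close>
  define M where "M = cball (0::'a) (R + norm v)"
  have bnd: "norm (?q n x) \<le> L * norm v * indicator M x" for n x
  proof (cases "x \<in> M")
    case True
    have "norm (?q n x) \<le> real (Suc n) * (L * norm ((1 / real (Suc n)) *\<^sub>R v))"
      unfolding norm_scaleR[of "real (Suc n)"] abs_of_nat
      using L(2)[of "(1 / real (Suc n)) *\<^sub>R v + x" x] by (intro mult_left_mono) auto
    then show ?thesis using True by (simp del: of_nat_Suc)
  next
    case False
    have "norm ((1 / real (Suc n)) *\<^sub>R v) \<le> norm v"
      by (simp add: divide_le_eq mult_le_cancel_left1)
    then have "norm ((1 / real (Suc n)) *\<^sub>R v + x) > R"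
      using False norm_triangle_ineq[of "(1 / real (Suc n)) *\<^sub>R v + x" "- ((1 / real (Suc n)) *\<^sub>R v)"] R(1)
      by (auto simp: M_def)
    moreover have "norm x > R" using False R(1) norm_ge_zero[of v] unfolding M_def mem_cball_0 by linarith
    ultimately have "\<phi> ((1 / real (Suc n)) *\<^sub>R v + x) = 0" "\<phi> x = 0"
      using R(2) K(2) by (metis subsetD mem_cball_0 not_less)+
    then show ?thesis using L(1) by (simp only: diff_self scaleR_zero_right norm_zero) simp
  qed
  have "(\<lambda>n. LINT x|lborel. ?q n x) \<longlonglongrightarrow> (LINT x|lborel. frechet_derivative \<phi> (at x) v)"
  proof (rule integral_dominated_convergence[where w="\<lambda>x. L * norm v * indicator M x"])
    show "integrable lborel (\<lambda>x. L * norm v * indicator M x)"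
    proof -
      have "emeasure lborel M < \<infinity>" unfolding M_def by (intro emeasure_bounded_finite) auto
      then show ?thesis by (intro integrable_mult_right integrable_real_indicator) (auto simp: M_def)
    qed
    show "AE x in lborel. (\<lambda>n. ?q n x) \<longlonglongrightarrow> frechet_derivative \<phi> (at x) v"
    proof (rule AE_I2)
      fix x
      have "((\<lambda>h. \<phi> (x + h *\<^sub>R v)) has_vector_derivative frechet_derivative \<phi> (at x) v) (at 0)"
      proof -
        have "((\<lambda>h. \<phi> (x + h *\<^sub>R v)) has_derivative (\<lambda>r. frechet_derivative \<phi> (at x) (r *\<^sub>R v))) (at 0)"
          by (rule has_derivative_compose[of "\<lambda>h. x + h *\<^sub>R v" "\<lambda>r. r *\<^sub>R v" 0 UNIV])
            (auto intro!: derivative_eq_intros test_function_has_derivative[OF assms])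
        then show ?thesis
          using has_derivative_linear[OF test_function_has_derivative[OF assms, of x]]
          by (simp add: has_vector_derivative_def linear_scale)
      qed
      then have "((\<lambda>h. (1 / h) *\<^sub>R (\<phi> (x + h *\<^sub>R v) - \<phi> (x + 0 *\<^sub>R v))) \<longlongrightarrow> frechet_derivative \<phi> (at x) v) (at 0)"
        by (rule has_vector_derivative_difference_quotient)
      moreover have "filterlim (\<lambda>n. 1 / real (Suc n)) (at 0) sequentially"
        using LIMSEQ_Suc[OF lim_1_over_n[where 'a=real]] by (auto simp: filterlim_at)
      ultimately have "((\<lambda>n. (1 / (1 / real (Suc n))) *\<^sub>R (\<phi> (x + (1 / real (Suc n)) *\<^sub>R v) - \<phi> (x + 0 *\<^sub>R v))) \<longlongrightarrow> frechet_derivative \<phi> (at x) v) sequentially"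
        by (rule filterlim_compose)
      then show "(\<lambda>n. ?q n x) \<longlonglongrightarrow> frechet_derivative \<phi> (at x) v"
        by (simp add: add.commute)
    qed
  qed (use bnd in \<open>auto intro!: AE_I2\<close>)
  moreover have "(LINT x|lborel. ?q n x) = 0" for n
  proof -
    have i: "integrable lborel \<phi>" by (rule test_function_integrable[OF assms])
    have "integrable (distr lborel borel ((+) ((1 / real (Suc n)) *\<^sub>R v))) \<phi>"
      using i by (simp add: lborel_distr_plus)
    then have "integrable lborel (\<lambda>x. \<phi> ((1 / real (Suc n)) *\<^sub>R v + x))"
      by (subst (asm) integrable_distr_eq) auto
    then show ?thesis using i by (simp add: integral_lborel_translate)
  qed
  ultimately show ?thesis by (simp add: LIMSEQ_const_iff)
qed

section \<open>The half-Laplacian of test functions\<close>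

subsection \<open>Decay of the Fourier transform\<close>

lemma has_derivative_cis_inner:
  "((\<lambda>x::'a::euclidean_space. cis (- (x \<bullet> \<xi>))) has_derivative (\<lambda>v. - \<i> * of_real (v \<bullet> \<xi>) * cis (- (x \<bullet> \<xi>)))) (at x)"
proof -
  have "((\<lambda>x::'a. exp (\<i> * of_real (- (x \<bullet> \<xi>)))) has_derivative
      (\<lambda>v. exp (\<i> * of_real (- (x \<bullet> \<xi>))) * (\<i> * of_real (- (v \<bullet> \<xi>))))) (at x)"
    by (rule has_derivative_compose[of "\<lambda>x. \<i> * of_real (- (x \<bullet> \<xi>))" _ x UNIV exp, OF _ DERIV_exp[unfolded has_field_derivative_def]])
      (auto intro!: derivative_eq_intros)
  then show ?thesis by (simp add: cis_conv_exp mult_ac)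
qed

lemma smooth_upto_cis_inner: "smooth_upto k UNIV (\<lambda>x::'a::euclidean_space. c * cis (- (x \<bullet> \<xi>)))"
proof (induction k arbitrary: c)
  case 0
  show ?case by (auto intro!: continuous_intros)
next
  case (Suc k)
  show ?case
  proof (rule smooth_upto_SucI)
    show "((\<lambda>x. c * cis (- (x \<bullet> \<xi>))) has_derivative (\<lambda>v. (- \<i> * of_real (v \<bullet> \<xi>) * c) * cis (- (x \<bullet> \<xi>)))) (at x)" for x
      using has_derivative_mult_right[OF has_derivative_cis_inner[of \<xi> x], of c] by (simp add: mult_ac)
    show "smooth_upto k UNIV (\<lambda>x. (- \<i> * of_real (v \<bullet> \<xi>) * c) * cis (- (x \<bullet> \<xi>)))" for v
      by (rule Suc)
  qed auto
qed

text \<open>Integration by parts: the character times \<open>\<phi>\<close> is again a test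
  function, so the integral of its derivative vanishes, and the product rule splits that integral
  into the two sides.\<close>

lemma fourier_frechet_derivative:
  fixes \<phi> :: "'a::euclidean_space \<Rightarrow> complex"
  assumes "test_function_on UNIV \<phi>"
  shows "fourier (\<lambda>x. frechet_derivative \<phi> (at x) v) \<xi> = \<i> * of_real (v \<bullet> \<xi>) * fourier \<phi> \<xi>"
proof -
  let ?e = "\<lambda>x::'a. cis (- (x \<bullet> \<xi>))"
  have e: "smooth_upto k UNIV ?e" for k using smooth_upto_cis_inner[of k 1 \<xi>] by simp
  have t: "test_function_on UNIV (\<lambda>x. ?e x * \<phi> x)"
    by (rule test_function_mult(2)[OF assms e])
  have H: "((\<lambda>x. ?e x * \<phi> x) has_derivative
     (\<lambda>v. ?e x * frechet_derivative \<phi> (at x) v - \<i> * of_real (v \<bullet> \<xi>) * ?e x * \<phi> x)) (at x)" for x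
  proof -
    from has_derivative_mult[OF has_derivative_cis_inner[of \<xi> x] test_function_has_derivative[OF assms, of x]]
    show ?thesis by (simp add: algebra_simps)
  qed
  have D: "frechet_derivative (\<lambda>x. ?e x * \<phi> x) (at x) v
      = ?e x * frechet_derivative \<phi> (at x) v - \<i> * of_real (v \<bullet> \<xi>) * (?e x * \<phi> x)" for x
    using fun_cong[OF frechet_derivative_at[OF H], of x v] by (simp add: mult.assoc)
  have i1: "integrable lborel (\<lambda>x. ?e x * frechet_derivative \<phi> (at x) v)"
    by (rule test_function_integrable[OF test_function_mult(2)[OF test_function_frechet[OF assms] e]])
  have i2: "integrable lborel (\<lambda>x. ?e x * \<phi> x)"
    by (rule test_function_integrable[OF t])
  have "0 = (LINT x|lborel. ?e x * frechet_derivative \<phi> (at x) v - \<i> * of_real (v \<bullet> \<xi>) * (?e x * \<phi> x))"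
    using integral_frechet_test_function[OF t, of v] by (simp only: D)
  also have "\<dots> = fourier (\<lambda>x. frechet_derivative \<phi> (at x) v) \<xi> - \<i> * of_real (v \<bullet> \<xi>) * fourier \<phi> \<xi>"
    unfolding fourier_def using i1 i2
    by (subst Bochner_Integration.integral_diff) (auto intro: integrable_mult_right)
  finally show ?thesis by simp
qed

lemma fourier_decay_coordinate:
  fixes \<phi> :: "'a::euclidean_space \<Rightarrow> complex"
  assumes "test_function_on UNIV \<phi>"
  shows "\<exists>C\<ge>0. \<forall>\<xi>. \<bar>b \<bullet> \<xi>\<bar> ^ k * norm (fourier \<phi> \<xi>) \<le> C"
  using assms
proof (induction k arbitrary: \<phi>)
  case 0
  have "norm (fourier \<phi> \<xi>) \<le> (LINT x|lborel. norm (\<phi> x))" for \<xi>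
  proof -
    have "norm (fourier \<phi> \<xi>) \<le> (LINT x|lborel. norm (cis (- (x \<bullet> \<xi>)) * \<phi> x))"
      unfolding fourier_def by (rule integral_norm_bound)
    then show ?thesis by (simp add: norm_mult)
  qed
  then show ?case by (intro exI[of _ "LINT x|lborel. norm (\<phi> x)"]) auto
next
  case (Suc k)
  from Suc.IH[OF test_function_frechet[OF Suc.prems, of b]]
  show ?case
    unfolding fourier_frechet_derivative[OF Suc.prems]
    by (simp add: norm_mult mult_ac)
qed

text \<open>By comparison with the l1 norm some coordinate carries at least the fraction
  \<open>1 / DIM('a)\<close> of \<open>norm \<xi>\<close>, and the coordinatewise decay applies to
  it.\<close>

lemma fourier_decay:
  fixes \<phi> :: "'a::euclidean_space \<Rightarrow> complex"
  assumes "test_function_on UNIV \<phi>"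
  obtains C where "C \<ge> 0" "\<And>\<xi>. norm \<xi> ^ k * norm (fourier \<phi> \<xi>) \<le> C"
proof -
  have "\<forall>b. \<exists>C. C \<ge> 0 \<and> (\<forall>\<xi>. \<bar>b \<bullet> \<xi>\<bar> ^ k * norm (fourier \<phi> \<xi>) \<le> C)"
    using fourier_decay_coordinate[OF assms, of _ k] by blast
  from choice[OF this] obtain C
    where C: "\<And>b::'a. C b \<ge> 0" "\<And>b \<xi>. \<bar>b \<bullet> \<xi>\<bar> ^ k * norm (fourier \<phi> \<xi>) \<le> C b"
    by blast
  let ?N = "real DIM('a)"
  have "norm \<xi> ^ k * norm (fourier \<phi> \<xi>) \<le> ?N ^ k * (\<Sum>b\<in>Basis. C b)" for \<xi> :: 'a
  proof -
    have "\<exists>b\<in>Basis. norm \<xi> \<le> ?N * \<bar>b \<bullet> \<xi>\<bar>"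
    proof (rule ccontr)
      assume "\<not> ?thesis"
      then have "\<bar>\<xi> \<bullet> b\<bar> < norm \<xi> / ?N" if "b \<in> Basis" for b
        using that DIM_positive[where 'a='a] by (auto simp: field_simps inner_commute)
      then have "(\<Sum>b\<in>Basis. \<bar>\<xi> \<bullet> b\<bar>) < (\<Sum>b\<in>(Basis::'a set). norm \<xi> / ?N)"
        by (intro sum_strict_mono) auto
      then show False using norm_le_l1[of \<xi>] by simp
    qed
    then obtain b where b: "b \<in> Basis" "norm \<xi> \<le> ?N * \<bar>b \<bullet> \<xi>\<bar>" by blast
    have "norm \<xi> ^ k * norm (fourier \<phi> \<xi>) \<le> (?N * \<bar>b \<bullet> \<xi>\<bar>) ^ k * norm (fourier \<phi> \<xi>)"
      using b by (intro mult_right_mono power_mono) auto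
    also have "\<dots> = ?N ^ k * (\<bar>b \<bullet> \<xi>\<bar> ^ k * norm (fourier \<phi> \<xi>))"
      by (simp add: power_mult_distrib)
    also have "\<dots> \<le> ?N ^ k * C b"
      using C by (intro mult_left_mono) auto
    also have "\<dots> \<le> ?N ^ k * (\<Sum>b\<in>Basis. C b)"
      using C b by (intro mult_left_mono member_le_sum) auto
    finally show ?thesis .
  qed
  moreover have "?N ^ k * (\<Sum>b\<in>(Basis::'a set). C b) \<ge> 0" using C(1) by (auto intro!: mult_nonneg_nonneg sum_nonneg)
  ultimately show ?thesis using that by blast
qed

lemma fourier_measurable [measurable]:
  assumes [measurable]: "g \<in> borel_measurable borel"
  shows "fourier g \<in> borel_measurable borel"
  unfolding fourier_def by measurable

text \<open>Rapid decay puts the function below a multiple of \<open>poisson 1\<close>, whose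
  integrability is known; this replaces an integration of powers of the norm.\<close>

lemma integrable_fourier_test_function:
  fixes \<phi> :: "'a::euclidean_space \<Rightarrow> complex"
  assumes "test_function_on UNIV \<phi>"
  shows "integrable lborel (\<lambda>\<xi>. norm \<xi> ^ j * norm (fourier \<phi> \<xi>))"
proof -
  let ?n = "DIM('a) + 1"
  obtain C where C: "C \<ge> 0" "\<And>\<xi>. norm \<xi> ^ j * norm (fourier \<phi> \<xi>) \<le> C"
    using fourier_decay[OF assms] by metis
  obtain D where D: "D \<ge> 0" "\<And>\<xi>. norm \<xi> ^ (j + ?n) * norm (fourier \<phi> \<xi>) \<le> D"
    using fourier_decay[OF assms] by metis
  define M where "M = 2 ^ ?n * (C + D) / poisson_const TYPE('a)"
  have [measurable]: "\<phi> \<in> borel_measurable borel" by (rule test_function_measurable[OF assms])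
  have b: "norm \<xi> ^ j * norm (fourier \<phi> \<xi>) \<le> M * poisson 1 \<xi>" for \<xi> :: 'a
  proof -
    define r where "r = norm \<xi>"
    have n0: "norm (\<xi>, 1::real) > 0" by (rule norm_Pair_pos) simp
    have "norm (\<xi>, 1::real) \<le> 2 * max 1 r"
      using norm_Pair_le[of \<xi> "1::real"] by (auto simp: r_def max_def)
    then have "norm (\<xi>, 1::real) ^ ?n \<le> (2 * max 1 r) ^ ?n"
      by (intro power_mono) auto
    also have "\<dots> \<le> 2 ^ ?n * (1 + r ^ ?n)"
      unfolding power_mult_distrib
      by (intro mult_left_mono) (auto simp: max_def r_def simp del: power_Suc power_add)
    finally have "norm \<xi> ^ j * norm (fourier \<phi> \<xi>) * norm (\<xi>, 1::real) ^ ?n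
       \<le> norm \<xi> ^ j * norm (fourier \<phi> \<xi>) * (2 ^ ?n * (1 + r ^ ?n))"
      by (intro mult_left_mono) auto
    also have "\<dots> = 2 ^ ?n * (norm \<xi> ^ j * norm (fourier \<phi> \<xi>) + norm \<xi> ^ (j + ?n) * norm (fourier \<phi> \<xi>))"
      unfolding r_def power_add[of _ j] by (simp add: algebra_simps)
    also have "\<dots> \<le> 2 ^ ?n * (C + D)"
      by (intro mult_left_mono add_mono C D) auto
    finally show ?thesis
      using n0 poisson_const_pos[where 'a='a] by (simp add: M_def poisson_def pos_le_divide_eq del: power_Suc)
  qed
  show ?thesis
  proof (rule Bochner_Integration.integrable_bound)
    show "integrable lborel (\<lambda>\<xi>. M * poisson 1 (\<xi>::'a))"
      by (intro integrable_mult_right integrable_poisson) auto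
    show "AE \<xi> in lborel. norm (norm \<xi> ^ j * norm (fourier \<phi> \<xi>)) \<le> norm (M * poisson 1 \<xi>)"
    proof (rule AE_I2)
      fix \<xi> :: 'a
      have "0 \<le> norm \<xi> ^ j * norm (fourier \<phi> \<xi>)" by simp
      then show "norm (norm \<xi> ^ j * norm (fourier \<phi> \<xi>)) \<le> norm (M * poisson 1 \<xi>)"
        using b[of \<xi>] unfolding real_norm_def by linarith
    qed
  qed measurable
qed

subsection \<open>The jump kernel\<close>

text \<open>The limit of \<open>poisson s y / s\<close> as \<open>s \<rightarrow> 0\<close>, times a factor that compensates the singularity;
  its value at \<open>y = 0\<close> is \<open>0\<close> by \<open>x / 0 = 0\<close>.\<close>
definition jump_kernel :: "real \<Rightarrow> 'a::euclidean_space \<Rightarrow> real" where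
  "jump_kernel l y = poisson_const TYPE('a) * min 1 ((norm y / l)\<^sup>2) / norm y ^ (DIM('a) + 1)"

lemma jump_kernel_nonneg: "jump_kernel l y \<ge> 0"
  unfolding jump_kernel_def
  by (intro divide_nonneg_nonneg mult_nonneg_nonneg less_imp_le[OF poisson_const_pos]) auto

lemma jump_kernel_measurable [measurable]: "jump_kernel l \<in> borel_measurable borel"
  unfolding jump_kernel_def by measurable

text \<open>Dropping \<open>s\<close> from the norm in the denominator gives a bound uniform in
  \<open>s\<close>. The factor with \<open>min\<close> is the one that second differences supply
  near the origin.\<close>

lemma poisson_le_jump_kernel:
  fixes y :: "'a::euclidean_space"
  assumes "s > 0"
  shows "poisson s y / s * min 1 ((norm y / l)\<^sup>2) \<le> jump_kernel l y"
proof (cases "y = 0")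
  case False
  have "norm y \<le> norm (y, s)" by (metis norm_fst_le fst_conv)
  then have "1 / norm (y, s) ^ (DIM('a) + 1) \<le> 1 / norm y ^ (DIM('a) + 1)"
    using False by (intro divide_left_mono power_mono mult_pos_pos zero_less_power norm_Pair_pos assms) auto
  then have "(poisson_const TYPE('a) * min 1 ((norm y / l)\<^sup>2)) * (1 / norm (y, s) ^ (DIM('a) + 1))
      \<le> (poisson_const TYPE('a) * min 1 ((norm y / l)\<^sup>2)) * (1 / norm y ^ (DIM('a) + 1))"
    by (intro mult_left_mono mult_nonneg_nonneg less_imp_le[OF poisson_const_pos]) auto
  then show ?thesis using assms by (simp add: jump_kernel_def poisson_def mult_ac)
qed (simp add: jump_kernel_nonneg)

text \<open>The Poisson kernel itself controls the jump kernel: near the origin through an average over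
  the time variable, which replaces an integration in polar coordinates.\<close>
lemma nn_integral_jump_kernel:
  assumes l: "l > 0"
  shows "(\<integral>\<^sup>+y. ennreal (jump_kernel l (y::'a::euclidean_space)) \<partial>lborel) \<le> ennreal (2 ^ (DIM('a) + 4) / l)"
proof -
  let ?n = "DIM('a) + 1"
  let ?c = "poisson_const TYPE('a)"
  let ?K = "2 ^ (DIM('a) + 3) :: real"
  let ?P = "\<lambda>y::'a. \<integral>\<^sup>+u. ennreal (poisson u y) * indicator {0..l} u \<partial>lborel"
  have pt: "ennreal (jump_kernel l y) \<le> ennreal (?K / l) * ennreal (poisson l y) + ennreal (?K / l\<^sup>2) * ?P y" for y :: 'a
  proof (cases "norm y \<ge> l")
    case True
    have "norm (y, l) \<le> 2 * norm y" using norm_Pair_le[of y l] True l by simp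
    then have "norm (y, l) ^ ?n \<le> (2 * norm y) ^ ?n" by (intro power_mono) auto
    then have "1 / (2 * norm y) ^ ?n \<le> 1 / norm (y, l) ^ ?n"
      using True l by (intro divide_left_mono mult_pos_pos zero_less_power norm_Pair_pos) auto
    then have "(2 ^ ?n * ?c) * (1 / (2 * norm y) ^ ?n) \<le> (2 ^ ?n * ?c) * (1 / norm (y, l) ^ ?n)"
      by (intro mult_left_mono mult_nonneg_nonneg less_imp_le[OF poisson_const_pos]) auto
    also have "\<dots> \<le> (?K * ?c) * (1 / norm (y, l) ^ ?n)"
      by (intro mult_right_mono less_imp_le[OF poisson_const_pos]) (auto simp: power_add)
    also have "\<dots> = ?K / l * poisson l y" using l by (simp add: poisson_def)
    also have "(2 ^ ?n * ?c) * (1 / (2 * norm y) ^ ?n) = ?c / norm y ^ ?n"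
      by (simp add: power_mult_distrib)
    finally have *: "?c / norm y ^ ?n \<le> ?K / l * poisson l y" .
    have "jump_kernel l y \<le> ?c / norm y ^ ?n"
      unfolding jump_kernel_def
      by (intro divide_right_mono mult_left_le less_imp_le[OF poisson_const_pos]) auto
    then have "ennreal (jump_kernel l y) \<le> ennreal (?K / l * poisson l y)"
      using * by (intro ennreal_leI) linarith
    also have "\<dots> = ennreal (?K / l) * ennreal (poisson l y)"
      using l by (intro ennreal_mult) (auto intro: poisson_nonneg)
    finally show ?thesis by (simp add: add_increasing2)
  next
    case False
    show ?thesis
    proof (cases "y = 0")
      case True
      then show ?thesis by (simp add: jump_kernel_def)
    next
      case y: False
      let ?r = "norm y"
      \<comment> \<open>For times between \<open>?r / 2\<close> and \<open>?r\<close> the kernel is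
        at least \<open>?a\<close>: its numerator is smallest at \<open>?r / 2\<close>, and its norm
        is at most \<open>2 * ?r\<close>. The constant \<open>?K\<close> compensates exactly the
        powers of 2 lost here.\<close>
      let ?a = "?c * (?r / 2) / (2 * ?r) ^ ?n"
      have a0: "?a \<ge> 0" by (intro divide_nonneg_nonneg mult_nonneg_nonneg less_imp_le[OF poisson_const_pos]) auto
      have "ennreal (?a * (?r / 2)) = (\<integral>\<^sup>+u. ennreal ?a * indicator {?r/2..?r} u \<partial>lborel)"
      proof -
        have "ennreal (a * (r / 2)) = (\<integral>\<^sup>+u. ennreal a * indicator {r/2..r} u \<partial>lborel)" if "a \<ge> 0" "r \<ge> 0" for a r :: real
          using that ennreal_mult[of a "r/2"] by (simp add: nn_integral_cmult_indicator)
        then show ?thesis using a0 by simp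
      qed
      also have "\<dots> \<le> ?P y"
      proof (intro nn_integral_mono)
        fix u :: real
        show "ennreal ?a * indicator {?r/2..?r} u \<le> ennreal (poisson u y) * indicator {0..l} u"
        proof (cases "u \<in> {?r/2..?r}")
          case True
          have "norm (y, u) \<le> 2 * ?r" using norm_Pair_le[of y u] True by simp
          then have "norm (y, u) ^ ?n \<le> (2 * ?r) ^ ?n" by (intro power_mono) auto
          moreover have "u > 0"
          proof -
            have "norm y > 0" using y by simp
            moreover have "norm y / 2 \<le> u" using True by simp
            ultimately show ?thesis by linarith
          qed
          ultimately have "?a \<le> poisson u y"
            unfolding poisson_def using True y
            by (intro frac_le mult_left_mono mult_nonneg_nonneg less_imp_le[OF poisson_const_pos] zero_less_power norm_Pair_pos) auto
          moreover have "u \<in> {0..l}" using True False by auto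
          ultimately show ?thesis using True by (simp add: ennreal_leI)
        qed simp
      qed
      finally have "ennreal (?K / l\<^sup>2) * ennreal (?a * (?r / 2)) \<le> ennreal (?K / l\<^sup>2) * ?P y"
        by (rule mult_left_mono) simp
      moreover have "jump_kernel l y = ?K / l\<^sup>2 * (?a * (?r / 2))"
      proof -
        have "min 1 ((?r / l)\<^sup>2) = (?r / l)\<^sup>2"
          using False l by (intro min_absorb2) (simp add: power_le_one)
        then show ?thesis using y l
          by (simp add: jump_kernel_def power_mult_distrib power_divide power2_eq_square power_add field_simps)
      qed
      moreover have "ennreal (?K / l\<^sup>2 * (?a * (?r / 2))) = ennreal (?K / l\<^sup>2) * ennreal (?a * (?r / 2))"
        using a0 by (intro ennreal_mult mult_nonneg_nonneg) auto
      ultimately show ?thesis by (simp add: add_increasing)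
    qed
  qed
  have P: "(\<integral>\<^sup>+y. ?P y \<partial>lborel) = ennreal l"
  proof -
    have "(\<integral>\<^sup>+y. ?P y \<partial>lborel) = (\<integral>\<^sup>+u. \<integral>\<^sup>+y. ennreal (poisson u (y::'a)) * indicator {0..l} u \<partial>lborel \<partial>lborel)"
      by (rule lborel_pair.Fubini') measurable
    also have "\<dots> = (\<integral>\<^sup>+u. indicator {0<..l} u \<partial>lborel)"
    proof (rule nn_integral_cong)
      fix u :: real
      show "(\<integral>\<^sup>+y. ennreal (poisson u (y::'a)) * indicator {0..l} u \<partial>lborel) = indicator {0<..l} u"
      proof (cases "u > 0")
        case True
        then show ?thesis by (simp add: nn_integral_multc nn_integral_poisson indicator_def)
      next
        case False
        then show ?thesis by (cases "u = 0") (auto simp: poisson_def)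
      qed
    qed
    also have "\<dots> = ennreal l" using l by simp
    finally show ?thesis .
  qed
  have "(\<integral>\<^sup>+y. ennreal (jump_kernel l (y::'a)) \<partial>lborel)
     \<le> (\<integral>\<^sup>+y. ennreal (?K / l) * ennreal (poisson l y) + ennreal (?K / l\<^sup>2) * ?P y \<partial>lborel)"
    by (intro nn_integral_mono pt)
  also have "\<dots> = ennreal (?K / l) * (\<integral>\<^sup>+y. ennreal (poisson l (y::'a)) \<partial>lborel) + ennreal (?K / l\<^sup>2) * (\<integral>\<^sup>+y. ?P y \<partial>lborel)"
    by (subst nn_integral_add; (subst nn_integral_cmult)?; (subst nn_integral_cmult)?; measurable?)
  also have "\<dots> = ennreal (?K / l) + ennreal (?K / l\<^sup>2 * l)"
    unfolding P nn_integral_poisson[OF l] using l by (subst ennreal_mult) auto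
  also have "\<dots> = ennreal (?K / l + ?K / l\<^sup>2 * l)"
    using l by (intro ennreal_plus[symmetric]) auto
  also have "?K / l + ?K / l\<^sup>2 * l = 2 ^ (DIM('a) + 4) / l"
    using l by (simp add: field_simps power2_eq_square power_add)
  finally show ?thesis .
qed

lemma integrable_jump_kernel: "l > 0 \<Longrightarrow> integrable lborel (jump_kernel l :: 'a::euclidean_space \<Rightarrow> real)"
  using nn_integral_jump_kernel[of l, where 'a='a]
  by (intro integrableI_bounded) (auto simp: jump_kernel_nonneg intro: le_less_trans)

subsection \<open>Second differences\<close>

abbreviation second_diff :: "('a::real_normed_vector \<Rightarrow> complex) \<Rightarrow> 'a \<Rightarrow> 'a \<Rightarrow> complex" where
  "second_diff g y x \<equiv> g (x + y) + g (x - y) - 2 * g x"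

lemma integrable_poisson_times_bounded:
  fixes g :: "'a::euclidean_space \<Rightarrow> complex"
  assumes [measurable]: "g \<in> borel_measurable borel" and B: "\<And>x. norm (g x) \<le> B" and s: "s > 0"
  shows "integrable lborel (\<lambda>y. of_real (poisson s y) * g y)"
proof (rule Bochner_Integration.integrable_bound)
  show "integrable lborel (\<lambda>y::'a. B * poisson s y)"
    by (intro integrable_mult_right integrable_poisson s)
  have "0 \<le> B" using B[of 0] norm_ge_zero[of "g 0"] by linarith
  then show "AE y in lborel. norm (of_real (poisson s y) * g y) \<le> norm (B * poisson s y)"
    using B poisson_nonneg[of s] s by (auto simp: norm_mult abs_mult mult.commute intro!: AE_I2 mult_right_mono)
qed measurable

lemma poisson_convolution_commute:
  fixes g :: "'a::euclidean_space \<Rightarrow> complex"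
  assumes [measurable]: "g \<in> borel_measurable borel"
  shows "(LINT y|lborel. g y * of_real (poisson s (x - y))) = (LINT y|lborel. of_real (poisson s y) * g (x - y))"
  using integral_lborel_reflect[of "\<lambda>y. g y * of_real (poisson s (x - y))" x]
  by (simp add: mult.commute)

text \<open>The kernel is even and has mass 1, so the average of \<open>g\<close> may be
  symmetrised; the first-order part cancels and only second differences remain.\<close>

lemma poisson_second_difference:
  fixes g :: "'a::euclidean_space \<Rightarrow> complex"
  assumes [measurable]: "g \<in> borel_measurable borel" and B: "\<And>x. norm (g x) \<le> B" and s: "s > 0"
  shows "g x - (LINT y|lborel. g y * of_real (poisson s (x - y)))
    = - (LINT y|lborel. of_real (poisson s y) * second_diff g y x) / 2"
    and "integrable lborel (\<lambda>y. of_real (poisson s y) * second_diff g y x)"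
proof -
  let ?P = "\<lambda>y. complex_of_real (poisson s y)"
  have i: "integrable lborel (\<lambda>y. ?P y * g (x + y))" "integrable lborel (\<lambda>y. ?P y * g (x - y))"
    using B by (auto intro!: integrable_poisson_times_bounded[OF _ _ s])
  have i0: "integrable lborel (\<lambda>y::'a. ?P y * (2 * g x))"
    using integrable_poisson[OF s, where 'a='a] by (intro integrable_mult_left) (simp add: complex_of_real_integrable_eq)
  have eq: "?P y * second_diff g y x = ?P y * g (x + y) + ?P y * g (x - y) - ?P y * (2 * g x)" for y
    by (simp add: algebra_simps)
  show "integrable lborel (\<lambda>y. ?P y * second_diff g y x)"
    unfolding eq using i i0 by (intro Bochner_Integration.integrable_diff Bochner_Integration.integrable_add)
  have "(LINT y|lborel. ?P y * second_diff g y x)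
    = (LINT y|lborel. ?P y * g (x + y)) + (LINT y|lborel. ?P y * g (x - y)) - (LINT (y::'a)|lborel. ?P y * (2 * g x))"
    unfolding eq using i i0 by (simp add: Bochner_Integration.integral_diff Bochner_Integration.integral_add)
  also have "(LINT y|lborel. ?P y * g (x + y)) = (LINT y|lborel. ?P y * g (x - y))"
    using integral_lborel_reflect[of "\<lambda>y. ?P y * g (x - y)" 0] by simp
  also have "(LINT (y::'a)|lborel. ?P y * (2 * g x)) = 2 * g x"
    using has_bochner_integral_poisson_1[OF s, where 'a='a]
    by (simp add: has_bochner_integral_iff)
  finally show "g x - (LINT y|lborel. g y * of_real (poisson s (x - y)))
    = - (LINT y|lborel. ?P y * second_diff g y x) / 2"
    by (simp add: poisson_convolution_commute)
qed

lemma poisson_integral_bound: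
  fixes F :: "'a::euclidean_space \<Rightarrow> complex"
  assumes [measurable]: "F \<in> borel_measurable borel"
    and F: "\<And>y. norm (F y) \<le> min 1 ((norm y / l)\<^sup>2) * G y" and G: "\<And>y. G y \<ge> 0" and s: "s > 0"
    and int: "integrable lborel (\<lambda>y. of_real (poisson s y) * F y)"
  shows "ennreal (norm ((LINT y|lborel. of_real (poisson s y) * F y) / of_real s))
     \<le> (\<integral>\<^sup>+y. ennreal (jump_kernel l y * G y) \<partial>lborel)"
proof -
  have "ennreal (norm ((LINT y|lborel. of_real (poisson s y) * F y) / of_real s))
     = ennreal (norm (LINT y|lborel. of_real (poisson s y) * F y / of_real s))"
    by simp
  also have "\<dots> \<le> (\<integral>\<^sup>+y. ennreal (norm (of_real (poisson s y) * F y / of_real s)) \<partial>lborel)"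
    using int by (intro integral_norm_bound_ennreal) auto
  also have "\<dots> \<le> (\<integral>\<^sup>+y. ennreal (jump_kernel l y * G y) \<partial>lborel)"
  proof (intro nn_integral_mono ennreal_leI)
    fix y :: 'a
    have "norm (of_real (poisson s y) * F y / of_real s) = poisson s y / s * norm (F y)"
      using s poisson_nonneg[of s y] by (simp add: norm_mult norm_divide)
    also have "\<dots> \<le> poisson s y / s * (min 1 ((norm y / l)\<^sup>2) * G y)"
      using F s poisson_nonneg[of s y] by (intro mult_left_mono) auto
    also have "\<dots> \<le> jump_kernel l y * G y"
      using mult_right_mono[OF poisson_le_jump_kernel[OF s] G] by (simp add: mult.assoc)
    finally show "norm (of_real (poisson s y) * F y / of_real s) \<le> jump_kernel l y * G y" .
  qed
  finally show ?thesis .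
qed

lemma difference_quotient_bound:
  fixes g :: "'a::euclidean_space \<Rightarrow> complex"
  assumes [measurable]: "g \<in> borel_measurable borel" and B: "\<And>x. norm (g x) \<le> B" and s: "s > 0"
    and F: "\<And>y. norm (second_diff g y x) \<le> min 1 ((norm y / l)\<^sup>2) * G y" and G: "\<And>y. G y \<ge> 0"
  shows "ennreal (norm ((g x - (LINT y|lborel. g y * of_real (poisson s (x - y)))) / of_real s))
     \<le> (\<integral>\<^sup>+y. ennreal (jump_kernel l y * G y) \<partial>lborel)"
proof -
  let ?I = "LINT y|lborel. of_real (poisson s y) * second_diff g y x"
  have "norm ((g x - (LINT y|lborel. g y * of_real (poisson s (x - y)))) / of_real s) = norm (?I / of_real s) / 2"
    unfolding poisson_second_difference(1)[OF assms(1) B s] by (simp add: norm_divide)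
  also have "\<dots> \<le> norm (?I / of_real s)" by simp
  finally show ?thesis
    using poisson_integral_bound[of "\<lambda>y. second_diff g y x" l G s, OF _ F G s poisson_second_difference(2)[OF assms(1) B s]]
    by (auto intro: order_trans ennreal_leI)
qed

lemma test_function_second_diff_min:
  assumes "test_function_on UNIV \<phi>"
  obtains C where "C \<ge> 0" "\<And>x y. norm (second_diff \<phi> y x) \<le> min 1 ((norm y / 1)\<^sup>2) * C"
proof -
  obtain B where B: "B \<ge> 0" "\<And>x. norm (\<phi> x) \<le> B" using test_function_bounded[OF assms] by metis
  obtain C where C: "C \<ge> 0" "\<And>x h. norm (\<phi> (x + h) + \<phi> (x - h) - 2 * \<phi> x) \<le> C * (norm h)\<^sup>2"
    using test_function_second_difference[OF assms] by metis
  have "norm (second_diff \<phi> y x) \<le> min 1 ((norm y / 1)\<^sup>2) * (4 * B + C)" for x y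
  proof -
    have "norm (second_diff \<phi> y x) \<le> norm (\<phi> (x + y)) + norm (\<phi> (x - y)) + norm (2 * \<phi> x)"
      by (rule norm_triangle_le_diff) (auto intro: norm_triangle_ineq add_mono)
    also have "\<dots> \<le> 4 * B" using B(2)[of "x + y"] B(2)[of "x - y"] B(2)[of x] by (simp add: norm_mult)
    finally have "norm (second_diff \<phi> y x) \<le> 1 * (4 * B + C)" using C(1) by simp
    moreover have "norm (second_diff \<phi> y x) \<le> (norm y / 1)\<^sup>2 * (4 * B + C)"
    proof -
      have "C * (norm y)\<^sup>2 \<le> (norm y)\<^sup>2 * (4 * B + C)" using B(1) by (simp add: algebra_simps)
      then show ?thesis using C(2)[of x y] by simp
    qed
    ultimately show ?thesis
      unfolding min_def by (cases "1 \<le> (norm y / 1)\<^sup>2") (simp_all only: if_True if_False)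
  qed
  then show ?thesis using that[of "4 * B + C"] B(1) C(1) by auto
qed

text \<open>The generator of the Poisson semigroup is \<open>-(-\<Delta>)\<^sup>1\<^sup>/\<^sup>2\<close>.\<close>
lemma half_laplacian_limit:
  fixes \<phi> :: "'a::euclidean_space \<Rightarrow> complex"
  assumes t: "test_function_on UNIV \<phi>"
  shows "(\<lambda>n. (\<phi> x - (LINT y|lborel. \<phi> y * of_real (poisson (1 / real (Suc n)) (x - y)))) / of_real (1 / real (Suc n)))
     \<longlonglongrightarrow> half_laplacian \<phi> x"
proof -
  let ?s = "\<lambda>n. 1 / real (Suc n)"
  let ?U = "\<lambda>n. LINT y|lborel. \<phi> y * of_real (poisson (?s n) (x - y))"
  let ?c = "complex_of_real ((2 * pi) ^ DIM('a))"
  have spos: "?s n > 0" for n by simp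
  have [measurable]: "\<phi> \<in> borel_measurable borel" by (rule test_function_measurable[OF t])
  obtain B where B: "B \<ge> 0" "\<And>x. norm (\<phi> x) \<le> B" using test_function_bounded[OF t] by metis
  obtain C where C: "C \<ge> 0" "\<And>x y. norm (second_diff \<phi> y x) \<le> min 1 ((norm y / 1)\<^sup>2) * C"
    using test_function_second_diff_min[OF t] by metis
  have U: "?U n = (LINT \<xi>|lborel. cis (x \<bullet> \<xi>) * (of_real (exp (- ?s n * norm \<xi>)) * fourier \<phi> \<xi>)) / ?c" for n
    by (rule poisson_convolution_fourier[OF test_function_integrable[OF t] spos])
  have s0: "?s \<longlonglongrightarrow> 0" by (rule LIMSEQ_Suc[OF lim_1_over_n])
  have i0: "integrable lborel (\<lambda>\<xi>. norm (fourier \<phi> \<xi>))" using integrable_fourier_test_function[OF t, of 0] by simp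
  have i1: "integrable lborel (\<lambda>\<xi>. norm \<xi> * norm (fourier \<phi> \<xi>))" using integrable_fourier_test_function[OF t, of 1] by simp
  have "?U \<longlonglongrightarrow> (LINT \<xi>|lborel. cis (x \<bullet> \<xi>) * (of_real (exp (- 0 * norm \<xi>)) * fourier \<phi> \<xi>)) / ?c"
    unfolding U
  proof (intro tendsto_divide integral_dominated_convergence[where w="\<lambda>\<xi>. norm (fourier \<phi> \<xi>)"] i0)
    show "AE \<xi> in lborel. (\<lambda>n. cis (x \<bullet> \<xi>) * (of_real (exp (- ?s n * norm \<xi>)) * fourier \<phi> \<xi>))
        \<longlonglongrightarrow> cis (x \<bullet> \<xi>) * (of_real (exp (- 0 * norm \<xi>)) * fourier \<phi> \<xi>)"
      by (intro AE_I2 tendsto_intros s0)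
    show "AE \<xi> in lborel. norm (cis (x \<bullet> \<xi>) * (of_real (exp (- ?s n * norm \<xi>)) * fourier \<phi> \<xi>)) \<le> norm (fourier \<phi> \<xi>)" for n
      by (auto intro!: AE_I2 mult_left_le_one_le simp: norm_mult)
  qed auto
  \<comment> \<open>The same averages, now seen in physical space: the bound on difference quotients
    makes them converge to \<open>\<phi> x\<close> at the rate of \<open>?s n\<close>.\<close>
  moreover have "?U \<longlonglongrightarrow> \<phi> x"
  proof -
    define K where "K = enn2real (\<integral>\<^sup>+y. ennreal (jump_kernel 1 (y::'a) * C) \<partial>lborel)"
    have fin: "(\<integral>\<^sup>+y. ennreal (jump_kernel 1 (y::'a) * C) \<partial>lborel) < \<infinity>"
    proof -
      have "integrable lborel (\<lambda>y::'a. jump_kernel 1 y * C)"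
        by (intro integrable_mult_left integrable_jump_kernel) simp
      then have "(\<integral>\<^sup>+y. ennreal (norm (jump_kernel 1 (y::'a) * C)) \<partial>lborel) < \<infinity>"
        unfolding integrable_iff_bounded by simp
      then show ?thesis using C(1) jump_kernel_nonneg[where 'a='a] by (simp add: abs_mult)
    qed
    have bd: "norm (\<phi> x - ?U n) \<le> K * ?s n" for n
    proof -
      have "ennreal (norm ((\<phi> x - ?U n) / of_real (?s n))) \<le> (\<integral>\<^sup>+y. ennreal (jump_kernel 1 (y::'a) * C) \<partial>lborel)"
        using difference_quotient_bound[of \<phi> B "?s n" x 1 "\<lambda>_. C"] B C spos by simp
      also have "\<dots> = ennreal K" unfolding K_def using fin by simp
      finally have "norm ((\<phi> x - ?U n) / of_real (?s n)) \<le> K"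
        by (subst (asm) ennreal_le_iff) (auto simp: K_def)
      then show ?thesis
        by (simp only: norm_divide norm_of_real abs_of_pos[OF spos] pos_divide_le_eq[OF spos])
    qed
    have "(\<lambda>n. \<phi> x - ?U n) \<longlonglongrightarrow> 0"
    proof (rule Lim_null_comparison)
      show "\<forall>\<^sub>F n in sequentially. norm (\<phi> x - ?U n) \<le> K * ?s n"
        by (intro always_eventually allI bd)
      show "(\<lambda>n. K * ?s n) \<longlonglongrightarrow> 0" by (rule tendsto_mult_right_zero[OF s0])
    qed
    from tendsto_diff[OF tendsto_const[of "\<phi> x"] this] show ?thesis by simp
  qed
  \<comment> \<open>Equating the two limits yields Fourier inversion for \<open>\<phi>\<close> at
    \<open>x\<close>.\<close>
  ultimately have "\<phi> x = (LINT \<xi>|lborel. cis (x \<bullet> \<xi>) * (of_real (exp (- 0 * norm \<xi>)) * fourier \<phi> \<xi>)) / ?c"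
    using LIMSEQ_unique by blast
  then have \<phi>: "\<phi> x = (LINT \<xi>|lborel. cis (x \<bullet> \<xi>) * fourier \<phi> \<xi>) / ?c" by simp
  have j0: "integrable lborel (\<lambda>\<xi>. cis (x \<bullet> \<xi>) * fourier \<phi> \<xi>)"
    by (rule Bochner_Integration.integrable_bound[OF i0]) (auto simp: norm_mult)
  have j1: "integrable lborel (\<lambda>\<xi>. cis (x \<bullet> \<xi>) * (of_real (exp (- ?s n * norm \<xi>)) * fourier \<phi> \<xi>))" for n
    by (rule Bochner_Integration.integrable_bound[OF i0]) (auto simp: norm_mult intro!: AE_I2 mult_left_le_one_le)
  \<comment> \<open>With inversion at hand the difference quotient is a single frequency integral.
    Its multiplier \<open>(1 - exp (- s * norm \<xi>)) / s\<close> tends to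
    \<open>norm \<xi>\<close> and stays below it, which gives the dominating function.\<close>
  have Q: "(\<phi> x - ?U n) / of_real (?s n)
      = (LINT \<xi>|lborel. cis (x \<bullet> \<xi>) * (of_real ((1 - exp (- ?s n * norm \<xi>)) / ?s n) * fourier \<phi> \<xi>)) / ?c" for n
  proof -
    have "\<phi> x - ?U n = (LINT \<xi>|lborel. cis (x \<bullet> \<xi>) * fourier \<phi> \<xi> - cis (x \<bullet> \<xi>) * (of_real (exp (- ?s n * norm \<xi>)) * fourier \<phi> \<xi>)) / ?c"
      unfolding \<phi> U using j0 j1[of n] by (simp add: Bochner_Integration.integral_diff diff_divide_distrib)
    then have "(\<phi> x - ?U n) / of_real (?s n) = (LINT \<xi>|lborel. (cis (x \<bullet> \<xi>) * fourier \<phi> \<xi> - cis (x \<bullet> \<xi>) * (of_real (exp (- ?s n * norm \<xi>)) * fourier \<phi> \<xi>)) / of_real (?s n)) / ?c"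
      by (simp only: integral_divide_zero divide_divide_eq_left mult.commute)
    also have "(\<lambda>\<xi>. (cis (x \<bullet> \<xi>) * fourier \<phi> \<xi> - cis (x \<bullet> \<xi>) * (of_real (exp (- ?s n * norm \<xi>)) * fourier \<phi> \<xi>)) / of_real (?s n))
       = (\<lambda>\<xi>. cis (x \<bullet> \<xi>) * (of_real ((1 - exp (- ?s n * norm \<xi>)) / ?s n) * fourier \<phi> \<xi>))"
      by (intro ext) (simp add: algebra_simps diff_divide_distrib del: of_nat_Suc)
    finally show ?thesis .
  qed
  show ?thesis
    unfolding Q half_laplacian_def inverse_fourier_def
  proof (intro tendsto_divide integral_dominated_convergence[where w="\<lambda>\<xi>. norm \<xi> * norm (fourier \<phi> \<xi>)"] i1)
    show "AE \<xi> in lborel. (\<lambda>n. cis (x \<bullet> \<xi>) * (of_real ((1 - exp (- ?s n * norm \<xi>)) / ?s n) * fourier \<phi> \<xi>))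
        \<longlonglongrightarrow> cis (x \<bullet> \<xi>) * (of_real (norm \<xi>) * fourier \<phi> \<xi>)"
    proof (intro AE_I2 tendsto_intros)
      fix \<xi> :: 'a
      have "((\<lambda>s. (1 - exp (- s * norm \<xi>)) / s) \<longlongrightarrow> norm \<xi>) (at 0)"
      proof -
        have "((\<lambda>s. - exp (- s * norm \<xi>)) has_real_derivative norm \<xi>) (at 0)"
          by (auto intro!: derivative_eq_intros)
        then show ?thesis by (simp add: DERIV_def)
      qed
      moreover have "filterlim ?s (at 0) sequentially"
        using s0 by (auto simp: filterlim_at)
      ultimately show "(\<lambda>n. (1 - exp (- ?s n * norm \<xi>)) / ?s n) \<longlonglongrightarrow> norm \<xi>"
        by (rule filterlim_compose)
    qed
    show "AE \<xi> in lborel. norm (cis (x \<bullet> \<xi>) * (of_real ((1 - exp (- ?s n * norm \<xi>)) / ?s n) * fourier \<phi> \<xi>)) \<le> norm \<xi> * norm (fourier \<phi> \<xi>)" for n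
    proof (rule AE_I2)
      fix \<xi> :: 'a
      have "1 - exp (- ?s n * norm \<xi>) \<le> ?s n * norm \<xi>"
        using exp_ge_add_one_self[of "- ?s n * norm \<xi>"] by linarith
      then have "(1 - exp (- ?s n * norm \<xi>)) / ?s n \<le> norm \<xi>"
        by (simp only: pos_divide_le_eq[OF spos] mult.commute[of "norm \<xi>"])
      moreover have "0 \<le> (1 - exp (- ?s n * norm \<xi>)) / ?s n"
        by (intro divide_nonneg_nonneg) auto
      ultimately have "\<bar>(1 - exp (- ?s n * norm \<xi>)) / ?s n\<bar> \<le> norm \<xi>"
        by (simp only: abs_of_nonneg)
      then have "\<bar>(1 - exp (- ?s n * norm \<xi>)) / ?s n\<bar> * norm (fourier \<phi> \<xi>) \<le> norm \<xi> * norm (fourier \<phi> \<xi>)"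
        by (rule mult_right_mono) simp
      then show "norm (cis (x \<bullet> \<xi>) * (of_real ((1 - exp (- ?s n * norm \<xi>)) / ?s n) * fourier \<phi> \<xi>)) \<le> norm \<xi> * norm (fourier \<phi> \<xi>)"
        by (simp only: norm_mult norm_cis norm_of_real mult_1)
    qed
  qed auto
qed

lemma LIMSEQ_ennreal_norm_le:
  fixes X :: "nat \<Rightarrow> 'a::real_normed_vector"
  assumes "X \<longlonglongrightarrow> L" "\<And>n. ennreal (norm (X n)) \<le> C"
  shows "ennreal (norm L) \<le> C"
  using assms by (intro LIMSEQ_le_const2[OF tendsto_ennrealI[OF tendsto_norm[OF assms(1)]]]) auto

lemma half_laplacian_bound:
  fixes \<phi> :: "'a::euclidean_space \<Rightarrow> complex"
  assumes t: "test_function_on UNIV \<phi>"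
    and F: "\<And>y. norm (second_diff \<phi> y x) \<le> min 1 ((norm y / l)\<^sup>2) * G y" and G: "\<And>y. G y \<ge> 0"
  shows "ennreal (norm (half_laplacian \<phi> x)) \<le> (\<integral>\<^sup>+y. ennreal (jump_kernel l y * G y) \<partial>lborel)"
proof -
  obtain B where B: "B \<ge> 0" "\<And>x. norm (\<phi> x) \<le> B" using test_function_bounded[OF t] by metis
  show ?thesis
    by (rule LIMSEQ_ennreal_norm_le[OF half_laplacian_limit[OF t]], rule difference_quotient_bound)
      (use B F G test_function_measurable[OF t] in auto)
qed

lemma half_laplacian_add:
  assumes "test_function_on UNIV \<phi>" "test_function_on UNIV \<psi>"
  shows "half_laplacian (\<lambda>x. \<phi> x + \<psi> x) x = half_laplacian \<phi> x + half_laplacian \<psi> x"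
proof (rule LIMSEQ_unique[OF half_laplacian_limit[OF test_function_add[OF assms]]])
  let ?U = "\<lambda>\<phi> n. LINT y|lborel. \<phi> y * of_real (poisson (1 / real (Suc n)) (x - y))"
  have i: "integrable lborel (\<lambda>y. g y * of_real (poisson (1 / real (Suc n)) (x - y)))" if g: "test_function_on UNIV g" for n and g :: "'a \<Rightarrow> complex"
  proof -
    have [measurable]: "g \<in> borel_measurable borel" by (rule test_function_measurable[OF g])
    obtain B where B: "\<And>x. norm (g x) \<le> B" using test_function_bounded[OF g] by metis
    have "integrable lborel (\<lambda>y. of_real (poisson (1 / real (Suc n)) y) * g (x - y))"
      using B by (intro integrable_poisson_times_bounded) auto
    then have "integrable (distr lborel borel (\<lambda>y. x - y)) (\<lambda>y. of_real (poisson (1 / real (Suc n)) y) * g (x - y))"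
      by (simp add: lborel_distr_translate_reflect)
    then show ?thesis by (subst (asm) integrable_distr_eq) (auto simp: mult.commute)
  qed
  have "?U (\<lambda>x. \<phi> x + \<psi> x) n = ?U \<phi> n + ?U \<psi> n" for n
    using i[OF assms(1), of n] i[OF assms(2), of n] by (simp add: distrib_right Bochner_Integration.integral_add)
  then show "(\<lambda>n. (\<phi> x + \<psi> x - ?U (\<lambda>x. \<phi> x + \<psi> x) n) / of_real (1 / real (Suc n))) \<longlonglongrightarrow> half_laplacian \<phi> x + half_laplacian \<psi> x"
    using tendsto_add[OF half_laplacian_limit[OF assms(1), of x] half_laplacian_limit[OF assms(2), of x]]
    by (simp add: add_divide_distrib[symmetric] algebra_simps del: of_nat_Suc of_real_divide divide_divide_eq_right)
qed

lemma half_laplacian_cmult: "half_laplacian (\<lambda>x. c * \<phi> x) x = c * half_laplacian \<phi> x"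
proof -
  have f: "fourier (\<lambda>x. c * \<phi> x) \<xi> = c * fourier \<phi> \<xi>" for \<xi>
    unfolding fourier_def by (simp only: mult.left_commute[of _ c] integral_mult_right_zero)
  show ?thesis
    unfolding half_laplacian_def inverse_fourier_def f
    by (simp only: mult.left_commute[of _ c] integral_mult_right_zero times_divide_eq_right)
qed

section \<open>The operator \<open>\<Theta>\<^sup>1\<^sup>/\<^sup>2\<close>\<close>

lemma test_function_slice:
  fixes \<phi> :: "'a::euclidean_space \<times> real \<Rightarrow> complex"
  assumes "test_function_on UNIV \<phi>"
  shows "test_function_on UNIV (\<lambda>y. \<phi> (y, t))"
proof -
  obtain K where K: "compact K" "\<And>x. x \<notin> K \<Longrightarrow> \<phi> x = 0" using test_function_support[OF assms] by blast
  show ?thesis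
  proof (rule test_functionI[of _ "fst ` K"])
    have "bounded_linear (\<lambda>y::'a. (y, 0::real))" by (intro bounded_linear_Pair bounded_linear_ident bounded_linear_zero)
    then have "smooth_upto k UNIV (\<lambda>y. \<phi> ((0, t) + (y, 0)))" for k
      by (rule smooth_upto_compose_affine[OF open_UNIV _ test_function_smooth[OF assms]]) auto
    then show "smooth_upto k UNIV (\<lambda>y. \<phi> (y, t))" for k by simp
    show "compact (fst ` K)" by (intro compact_continuous_image K continuous_intros)
  qed (use K(2) in force)
qed

lemma time_derivative:
  fixes \<phi> :: "'a::euclidean_space \<times> real \<Rightarrow> complex"
  assumes "test_function_on UNIV \<phi>"
  shows "vector_derivative (\<lambda>s. \<phi> (x, s)) (at t) = frechet_derivative \<phi> (at (x, t)) (0, 1)"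
proof (rule vector_derivative_at)
  have "((\<lambda>s. \<phi> (x, s)) has_derivative (\<lambda>r. frechet_derivative \<phi> (at (x, t)) (0, r))) (at t)"
    by (rule has_derivative_compose[of "\<lambda>s. (x, s)", OF _ test_function_has_derivative[OF assms]])
      (auto intro!: derivative_eq_intros)
  moreover have "(\<lambda>r. frechet_derivative \<phi> (at (x, t)) (0, r)) = (\<lambda>r. r *\<^sub>R frechet_derivative \<phi> (at (x, t)) (0, 1))"
  proof
    fix r :: real
    show "frechet_derivative \<phi> (at (x, t)) (0, r) = r *\<^sub>R frechet_derivative \<phi> (at (x, t)) (0, 1)"
    using linear_scale[OF has_derivative_linear[OF test_function_has_derivative[OF assms, of "(x, t)"]], of r "(0, 1)"] by simp
  qed
  ultimately show "((\<lambda>s. \<phi> (x, s)) has_vector_derivative frechet_derivative \<phi> (at (x, t)) (0, 1)) (at t)"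
    by (simp only: has_vector_derivative_def)
qed

lemma theta_transpose_eq:
  assumes "test_function_on UNIV \<phi>"
  shows "theta_transpose \<phi> p = half_laplacian (\<lambda>y. \<phi> (y, snd p)) (fst p) - frechet_derivative \<phi> (at p) (0, 1)"
  by (cases p) (simp add: theta_transpose_def time_derivative[OF assms])

lemma theta_transpose_add:
  assumes "test_function_on UNIV \<phi>" "test_function_on UNIV \<psi>"
  shows "theta_transpose (\<lambda>p. \<phi> p + \<psi> p) p = theta_transpose \<phi> p + theta_transpose \<psi> p"
proof -
  have "frechet_derivative (\<lambda>p. \<phi> p + \<psi> p) (at p) = (\<lambda>v. frechet_derivative \<phi> (at p) v + frechet_derivative \<psi> (at p) v)"
    by (rule frechet_derivative_at[symmetric],
        rule has_derivative_add[OF test_function_has_derivative[OF assms(1)] test_function_has_derivative[OF assms(2)]])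
  then show ?thesis
    by (simp add: theta_transpose_eq assms test_function_add[OF assms]
        half_laplacian_add[OF test_function_slice[OF assms(1)] test_function_slice[OF assms(2)]])
qed

lemma theta_transpose_cmult:
  assumes "test_function_on UNIV \<phi>"
  shows "theta_transpose (\<lambda>p. c * \<phi> p) p = c * theta_transpose \<phi> p"
proof -
  have "frechet_derivative (\<lambda>p. c * \<phi> p) (at p) = (\<lambda>v. c * frechet_derivative \<phi> (at p) v)"
    by (rule frechet_derivative_at[symmetric], rule has_derivative_mult_right) (rule test_function_has_derivative[OF assms])
  then show ?thesis
    by (simp add: theta_transpose_eq assms test_function_cmult[OF assms] half_laplacian_cmult right_diff_distrib)
qed

text \<open>The half-Laplacian of the slices is a pointwise limit of parameter integrals, each
  jointly measurable in space and time.\<close>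

lemma theta_transpose_measurable:
  assumes t: "test_function_on UNIV \<phi>"
  shows "theta_transpose \<phi> \<in> borel_measurable borel"
proof -
  have [measurable]: "\<phi> \<in> borel_measurable borel" by (rule test_function_measurable[OF t])
  have "(\<lambda>p. half_laplacian (\<lambda>y. \<phi> (y, snd p)) (fst p)) \<in> borel_measurable borel"
  proof (rule borel_measurable_LIMSEQ_metric)
    fix n
    have 1: "(\<lambda>p. LINT y|lborel. \<phi> (y, snd p) * of_real (poisson (1 / real (Suc n)) (fst p - y))) \<in> borel_measurable borel"
      unfolding borel_prod[symmetric] by (rule lborel.borel_measurable_lebesgue_integral) measurable
    have "(\<lambda>p. \<phi> (fst p, snd p)) \<in> borel_measurable borel" by simp
    with 1 show "(\<lambda>p. (\<phi> (fst p, snd p) - (LINT y|lborel. \<phi> (y, snd p) * of_real (poisson (1 / real (Suc n)) (fst p - y)))) / of_real (1 / real (Suc n))) \<in> borel_measurable borel"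
      by (intro borel_measurable_divide borel_measurable_diff borel_measurable_const)
  qed (rule half_laplacian_limit[OF test_function_slice[OF t]])
  moreover have "(\<lambda>p. frechet_derivative \<phi> (at p) (0, 1)) \<in> borel_measurable borel"
    by (rule test_function_measurable[OF test_function_frechet[OF t]])
  ultimately show ?thesis
    unfolding theta_transpose_eq[OF t, abs_def] by measurable
qed

text \<open>Tonelli and translation invariance: each of the three points of a second difference
  contributes the same integral, whence the factor 3.\<close>

lemma nn_integral_kernel_translates:
  fixes g :: "'a::euclidean_space \<times> real \<Rightarrow> ennreal"
  assumes [measurable]: "g \<in> borel_measurable borel" "k \<in> borel_measurable borel"
  shows "(\<integral>\<^sup>+p. (\<integral>\<^sup>+y. k y * (g (p + (y, 0)) + g (p - (y, 0)) + g p) \<partial>lborel) \<partial>lborel)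
     = 3 * (\<integral>\<^sup>+y. k y \<partial>lborel) * (\<integral>\<^sup>+p. g p \<partial>lborel)"
proof -
  let ?I = "\<integral>\<^sup>+p. g p \<partial>lborel"
  have "(\<integral>\<^sup>+p. (\<integral>\<^sup>+y. k y * (g (p + (y, 0)) + g (p - (y, 0)) + g p) \<partial>lborel) \<partial>lborel)
     = (\<integral>\<^sup>+y. (\<integral>\<^sup>+p. k y * (g (p + (y, 0)) + g (p - (y, 0)) + g p) \<partial>lborel) \<partial>lborel)"
    by (rule lborel_pair.Fubini') measurable
  also have "\<dots> = (\<integral>\<^sup>+y. k y * (3 * ?I) \<partial>lborel)"
  proof (rule nn_integral_cong)
    fix y :: 'a
    have 1: "(\<integral>\<^sup>+p. g (p + (y, 0)) \<partial>lborel) = ?I"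
      using nn_integral_lborel_translate[of g "(y, 0)"] by (simp add: add.commute)
    have 2: "(\<integral>\<^sup>+p. g (p - (y, 0)) \<partial>lborel) = ?I"
    proof -
      have "p - (y, 0) = - (y, 0) + p" for p :: "'a \<times> real" by simp
      then show ?thesis using nn_integral_lborel_translate[of g "- (y, 0)"] by (simp only: assms(1))
    qed
    have "(\<integral>\<^sup>+p. g (p + (y, 0)) + g (p - (y, 0)) + g p \<partial>lborel) = ?I + ?I + ?I"
      by (subst nn_integral_add; (subst nn_integral_add)?; measurable?) (simp add: 1 2)
    also have "\<dots> = 3 * ?I"
    proof -
      have "(3::ennreal) = 1 + 1 + 1" by simp
      then show ?thesis by (simp only: distrib_right mult_1)
    qed
    finally show "(\<integral>\<^sup>+p. k y * (g (p + (y, 0)) + g (p - (y, 0)) + g p) \<partial>lborel) = k y * (3 * ?I)"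
      by (subst nn_integral_cmult) auto
  qed
  also have "\<dots> = 3 * (\<integral>\<^sup>+y. k y \<partial>lborel) * ?I"
    by (subst nn_integral_multc) (auto simp: mult_ac)
  finally show ?thesis .
qed

text \<open>The 1 accounts for the time derivative. The 12 is 3, from the three points of a second
  difference, times 4, from its triangle inequality, and \<open>2 ^ (N + 4)\<close> is the constant
  of \<open>nn_integral_jump_kernel\<close>.\<close>

definition theta_const :: "nat \<Rightarrow> real" where
  "theta_const N = 1 + 12 * 2 ^ (N + 4)"

text \<open>The scale-invariant estimate: for \<open>\<psi>\<close> adapted to a cube of side \<open>l\<close> the right-hand side is
  of the order of \<open>l\<^sup>N\<close>.\<close>
lemma theta_transpose_bound:
  fixes \<psi> :: "(real ^ 'n::finite) \<times> real \<Rightarrow> complex"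
  assumes t: "test_function_on UNIV \<psi>" and l: "l > 0"
    and B: "closed B" "\<And>p. p \<notin> B \<Longrightarrow> \<psi> p = 0"
    and A: "\<And>p. norm (\<psi> p) \<le> A"
      "\<And>p h. norm (second_diff \<psi> h p) \<le> A * (norm h / l)\<^sup>2"
      "\<And>p v. norm (frechet_derivative \<psi> (at p) v) \<le> A / l * norm v"
  shows "(\<integral>\<^sup>+p. ennreal (norm (theta_transpose \<psi> p)) \<partial>lborel)
     \<le> ennreal (theta_const CARD('n) * A / l) * emeasure lborel B"
proof -
  let ?k = "\<lambda>y::real^'n. ennreal (jump_kernel l y * (4 * A))"
  let ?g = "\<lambda>p. indicator B p :: ennreal"
  have A0: "A \<ge> 0" using A(1)[of 0] norm_ge_zero[of "\<psi> 0"] by linarith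
  have Bm [measurable]: "B \<in> sets borel" using B(1) by simp
  have D0: "frechet_derivative \<psi> (at p) v = 0" if "p \<notin> B" for p v
  proof -
    have "(\<psi> has_derivative (\<lambda>_. 0)) (at p)"
      by (rule has_derivative_transform_within_open[OF has_derivative_const, of "- B" p 0])
        (use that B in \<open>auto simp: open_Compl\<close>)
    from frechet_derivative_at[OF this] show ?thesis by metis
  qed
  have pt: "ennreal (norm (theta_transpose \<psi> p))
     \<le> (\<integral>\<^sup>+y. ?k y * (?g (p + (y, 0)) + ?g (p - (y, 0)) + ?g p) \<partial>lborel) + ennreal (A / l) * ?g p" for p
  proof -
    obtain x s where p: "p = (x, s)" by (cases p)
    \<comment> \<open>A second difference vanishes unless one of its three points lies in
      \<open>B\<close>. The indicators record this, so that integration over \<open>p\<close> later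
      produces the measure of \<open>B\<close>.\<close>
    let ?G = "\<lambda>y. 4 * A * (indicator B (p + (y, 0)) + indicator B (p - (y, 0)) + indicator B p)"
    have "ennreal (norm (half_laplacian (\<lambda>y. \<psi> (y, s)) x)) \<le> (\<integral>\<^sup>+y. ennreal (jump_kernel l y * ?G y) \<partial>lborel)"
    proof (rule half_laplacian_bound[OF test_function_slice[OF t]])
      fix y :: "real^'n"
      have eq: "second_diff (\<lambda>y. \<psi> (y, s)) y x = second_diff \<psi> (y, 0) p" by (simp add: p)
      show "norm (second_diff (\<lambda>y. \<psi> (y, s)) y x) \<le> min 1 ((norm y / l)\<^sup>2) * ?G y"
      proof (cases "p + (y, 0) \<in> B \<or> p - (y, 0) \<in> B \<or> p \<in> B")
        case False
        then show ?thesis unfolding eq using B(2) by simp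
      next
        case True
        then have G: "?G y \<ge> 4 * A" using A0 by (auto simp: indicator_def)
        have "norm (second_diff \<psi> (y, 0) p) \<le> norm (\<psi> (p + (y, 0))) + norm (\<psi> (p - (y, 0))) + norm (2 * \<psi> p)"
          by (rule norm_triangle_le_diff) (auto intro: norm_triangle_ineq add_mono)
        also have "\<dots> \<le> 4 * A" using A(1)[of "p + (y, 0)"] A(1)[of "p - (y, 0)"] A(1)[of p] by (simp add: norm_mult)
        finally have "norm (second_diff \<psi> (y, 0) p) \<le> 1 * ?G y" using G by linarith
        moreover have "norm (second_diff \<psi> (y, 0) p) \<le> (norm y / l)\<^sup>2 * ?G y"
        proof -
          have "norm (second_diff \<psi> (y, 0) p) \<le> A * (norm y / l)\<^sup>2" using A(2)[where h="(y, 0)" and p=p] by (simp add: norm_Pair)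
          also have "\<dots> \<le> ?G y * (norm y / l)\<^sup>2" using G A0 by (intro mult_right_mono) auto
          finally show ?thesis by (simp only: mult.commute)
        qed
        ultimately show ?thesis
          unfolding eq min_def by (cases "1 \<le> (norm y / l)\<^sup>2") (simp_all only: if_True if_False)
      qed
    qed (use A0 in \<open>auto intro!: mult_nonneg_nonneg\<close>)
    also have "\<dots> = (\<integral>\<^sup>+y. ?k y * (?g (p + (y, 0)) + ?g (p - (y, 0)) + ?g p) \<partial>lborel)"
    proof (rule nn_integral_cong)
      fix y :: "real^'n"
      have e: "?g (p + (y, 0)) + ?g (p - (y, 0)) + ?g p = ennreal (indicator B (p + (y, 0)) + indicator B (p - (y, 0)) + indicator B p)"
        by (simp add: ennreal_indicator[symmetric])
      show "ennreal (jump_kernel l y * ?G y) = ?k y * (?g (p + (y, 0)) + ?g (p - (y, 0)) + ?g p)"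
        unfolding e using A0 jump_kernel_nonneg[of l y] by (subst ennreal_mult[symmetric]) (auto simp: mult_ac)
    qed
    finally have 1: "ennreal (norm (half_laplacian (\<lambda>y. \<psi> (y, s)) x)) \<le> (\<integral>\<^sup>+y. ?k y * (?g (p + (y, 0)) + ?g (p - (y, 0)) + ?g p) \<partial>lborel)" .
    have 2: "ennreal (norm (frechet_derivative \<psi> (at p) (0, 1))) \<le> ennreal (A / l) * ?g p"
    proof (cases "p \<in> B")
      case True
      then show ?thesis using A(3)[of p "(0, 1)"] by (simp add: norm_Pair ennreal_leI)
    qed (simp add: D0)
    have "ennreal (norm (theta_transpose \<psi> p)) \<le> ennreal (norm (half_laplacian (\<lambda>y. \<psi> (y, s)) x) + norm (frechet_derivative \<psi> (at p) (0, 1)))"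
      unfolding theta_transpose_eq[OF t] by (intro ennreal_leI) (simp add: p norm_triangle_ineq4)
    also have "\<dots> = ennreal (norm (half_laplacian (\<lambda>y. \<psi> (y, s)) x)) + ennreal (norm (frechet_derivative \<psi> (at p) (0, 1)))"
      by (rule ennreal_plus) auto
    finally show ?thesis using add_mono[OF 1 2] by (rule order_trans)
  qed
  have "(\<integral>\<^sup>+p. ennreal (norm (theta_transpose \<psi> p)) \<partial>lborel)
     \<le> (\<integral>\<^sup>+p. (\<integral>\<^sup>+y. ?k y * (?g (p + (y, 0)) + ?g (p - (y, 0)) + ?g p) \<partial>lborel) + ennreal (A / l) * ?g p \<partial>lborel)"
    by (intro nn_integral_mono pt)
  also have "\<dots> = (\<integral>\<^sup>+p. (\<integral>\<^sup>+y. ?k y * (?g (p + (y, 0)) + ?g (p - (y, 0)) + ?g p) \<partial>lborel) \<partial>lborel) + (\<integral>\<^sup>+p. ennreal (A / l) * ?g p \<partial>lborel)"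
    by (rule nn_integral_add) measurable
  also have "\<dots> = 3 * (\<integral>\<^sup>+y. ?k y \<partial>lborel) * emeasure lborel B + ennreal (A / l) * emeasure lborel B"
    by (subst nn_integral_kernel_translates) (auto simp: nn_integral_cmult)
  also have "(\<integral>\<^sup>+y. ?k y \<partial>lborel) = ennreal (4 * A) * (\<integral>\<^sup>+y. ennreal (jump_kernel l (y::real^'n)) \<partial>lborel)"
    using A0 by (subst nn_integral_cmult[symmetric]) (auto simp: ennreal_mult jump_kernel_nonneg mult.commute intro!: nn_integral_cong)
  also have "3 * (ennreal (4 * A) * (\<integral>\<^sup>+y. ennreal (jump_kernel l (y::real^'n)) \<partial>lborel)) * emeasure lborel B + ennreal (A / l) * emeasure lborel B
     \<le> 3 * (ennreal (4 * A) * ennreal (2 ^ (CARD('n) + 4) / l)) * emeasure lborel B + ennreal (A / l) * emeasure lborel B"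
    using nn_integral_jump_kernel[OF l, where 'a="real^'n"]
    by (intro add_mono mult_right_mono mult_left_mono) auto
  also have "\<dots> = ennreal (theta_const CARD('n) * A / l) * emeasure lborel B"
  proof -
    have "3 * (ennreal (4 * A) * ennreal (2 ^ (CARD('n) + 4) / l)) = ennreal (3 * (4 * A * (2 ^ (CARD('n) + 4) / l)))"
      using A0 l by (subst ennreal_mult[symmetric]; (subst ennreal_mult)?) auto
    moreover have "ennreal (theta_const CARD('n) * A / l) = ennreal (3 * (4 * A * (2 ^ (CARD('n) + 4) / l))) + ennreal (A / l)"
      using A0 l by (subst ennreal_plus[symmetric]) (auto simp: theta_const_def field_simps)
    ultimately show ?thesis by (simp only: distrib_right)
  qed
  finally show ?thesis .
qed

lemma theta_transpose_integrable:
  fixes \<psi> :: "(real ^ 'n::finite) \<times> real \<Rightarrow> complex"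
  assumes t: "test_function_on UNIV \<psi>"
  shows "integrable lborel (theta_transpose \<psi>)"
proof -
  obtain K where K: "compact K" "\<And>x. x \<notin> K \<Longrightarrow> \<psi> x = 0" using test_function_support[OF t] by blast
  obtain B where B: "B \<ge> 0" "\<And>x. norm (\<psi> x) \<le> B" using test_function_bounded[OF t] by metis
  obtain C where C: "C \<ge> 0" "\<And>x h. norm (second_diff \<psi> h x) \<le> C * (norm h)\<^sup>2"
    using test_function_second_difference[OF t] by metis
  obtain L where L: "L \<ge> 0" "\<And>x v. norm (frechet_derivative \<psi> (at x) v) \<le> L * norm v"
    using test_function_lipschitz[OF t] by metis
  define A where "A = B + C + L"
  have "(\<integral>\<^sup>+p. ennreal (norm (theta_transpose \<psi> p)) \<partial>lborel) \<le> ennreal (theta_const CARD('n) * A / 1) * emeasure lborel K"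
  proof (rule theta_transpose_bound[OF t _ compact_imp_closed[OF K(1)] K(2)])
    show "norm (\<psi> p) \<le> A" for p using B(2)[of p] C(1) L(1) by (simp add: A_def)
    show "norm (second_diff \<psi> h p) \<le> A * (norm h / 1)\<^sup>2" for p h
      using C(2)[where x=p and h=h] B(1) L(1) mult_right_mono[of C A "(norm h)\<^sup>2"] by (simp add: A_def)
    show "norm (frechet_derivative \<psi> (at p) v) \<le> A / 1 * norm v" for p v
      using L(2)[of p v] B(1) C(1) mult_right_mono[of L A "norm v"] by (simp add: A_def)
  qed auto
  also have "\<dots> < \<infinity>"
    using emeasure_bounded_finite[OF compact_imp_bounded[OF K(1)]] by (simp add: ennreal_mult_less_top)
  finally show ?thesis
    using theta_transpose_measurable[OF t] by (intro integrableI_bounded) auto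
qed

subsection \<open>The distribution \<open>\<Theta>\<^sup>1\<^sup>/\<^sup>2 f\<close>\<close>

text \<open>The integral is taken over \<open>lebesgue\<close> because \<open>f\<close> is only
  Lebesgue measurable; estimates for \<open>theta_transpose\<close> are made on
  \<open>lborel\<close> and carried over by completion.\<close>

definition theta_distr :: "((real ^ 'n::finite) \<times> real \<Rightarrow> real) \<Rightarrow> ((real ^ 'n) \<times> real \<Rightarrow> complex) \<Rightarrow> complex" where
  "theta_distr f \<phi> = (\<integral>p. of_real (f p) * theta_transpose \<phi> p \<partial>lebesgue)"

context
  fixes f :: "(real ^ 'n::finite) \<times> real \<Rightarrow> real" and M :: real
  assumes f [measurable]: "f \<in> borel_measurable lebesgue" and M: "\<And>p. \<bar>f p\<bar> \<le> M"
begin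

lemma theta_distr_integrable:
  assumes t: "test_function_on UNIV \<phi>"
  shows "integrable lebesgue (\<lambda>p. of_real (f p) * theta_transpose \<phi> p)"
proof (rule Bochner_Integration.integrable_bound)
  have [measurable]: "theta_transpose \<phi> \<in> borel_measurable lborel"
    using theta_transpose_measurable[OF t] by simp
  have i: "integrable lebesgue (theta_transpose \<phi>)"
    using theta_transpose_integrable[OF t] by (subst integrable_completion) auto
  then show "integrable lebesgue (\<lambda>p. of_real M * theta_transpose \<phi> p)"
    by (rule integrable_mult_right)
  show "(\<lambda>p. of_real (f p) * theta_transpose \<phi> p) \<in> borel_measurable lebesgue"
    using borel_measurable_integrable[OF i] by measurable
  show "AE p in lebesgue. norm (of_real (f p) * theta_transpose \<phi> p) \<le> norm (of_real M * theta_transpose \<phi> p)"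
    using M by (intro AE_I2) (auto simp: norm_mult intro!: mult_right_mono order_trans[OF M abs_ge_self])
qed

lemma theta_distr_add:
  assumes "test_function_on UNIV \<phi>" "test_function_on UNIV \<psi>"
  shows "theta_distr f (\<lambda>p. \<phi> p + \<psi> p) = theta_distr f \<phi> + theta_distr f \<psi>"
  unfolding theta_distr_def theta_transpose_add[OF assms]
  using theta_distr_integrable[OF assms(1)] theta_distr_integrable[OF assms(2)]
  by (simp add: distrib_left Bochner_Integration.integral_add)

lemma theta_distr_cmult:
  assumes "test_function_on UNIV \<phi>"
  shows "theta_distr f (\<lambda>p. c * \<phi> p) = c * theta_distr f \<phi>"
  unfolding theta_distr_def theta_transpose_cmult[OF assms]
  by (simp only: mult.left_commute[of _ c] integral_mult_right_zero)

lemma theta_distr_bound: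
  assumes t: "test_function_on UNIV \<phi>"
  shows "ennreal (norm (theta_distr f \<phi>)) \<le> ennreal M * (\<integral>\<^sup>+p. ennreal (norm (theta_transpose \<phi> p)) \<partial>lborel)"
proof -
  have [measurable]: "theta_transpose \<phi> \<in> borel_measurable lborel"
    using theta_transpose_measurable[OF t] by simp
  have "ennreal (norm (theta_distr f \<phi>)) \<le> (\<integral>\<^sup>+p. ennreal (norm (of_real (f p) * theta_transpose \<phi> p)) \<partial>lebesgue)"
    unfolding theta_distr_def by (rule integral_norm_bound_ennreal[OF theta_distr_integrable[OF t]])
  also have "\<dots> \<le> (\<integral>\<^sup>+p. ennreal (M * norm (theta_transpose \<phi> p)) \<partial>lebesgue)"
    using M by (intro nn_integral_mono ennreal_leI) (auto simp: norm_mult intro!: mult_right_mono)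
  also have "\<dots> = (\<integral>\<^sup>+p. ennreal (M * norm (theta_transpose \<phi> p)) \<partial>lborel)"
    by (rule nn_integral_completion)
  also have "\<dots> = ennreal M * (\<integral>\<^sup>+p. ennreal (norm (theta_transpose \<phi> p)) \<partial>lborel)"
    using M[of 0] abs_ge_zero[of "f 0"] by (subst nn_integral_cmult[symmetric]) (auto simp: ennreal_mult)
  finally show ?thesis .
qed

end

section \<open>Truncated Poisson kernels as test functions\<close>

text \<open>The difference is measured against the values of the kernel themselves, so that
  integrating it over space costs only the total mass 1. In \<open>key\<close> the larger value is
  factored out and Bernoulli's inequality bounds \<open>1 - (a / b) ^ ?n\<close>. The constant
  degenerates as \<open>s0\<close> tends to 0, hence the lower bound on \<open>s\<close>.\<close>

lemma poisson_lipschitz: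
  fixes u v :: "'a::euclidean_space"
  assumes s: "s0 > 0" "s0 \<le> s"
  shows "\<bar>poisson s u - poisson s v\<bar> \<le> (1 + real (DIM('a) + 1) / s0) * min 1 (norm (u - v)) * (poisson s u + poisson s v)"
proof -
  let ?n = "DIM('a) + 1"
  have key: "poisson s u - poisson s v \<le> real ?n / s0 * norm (u - v) * poisson s u" for u v :: 'a
  proof (cases "norm (u, s) \<le> norm (v, s)")
    case True
    define a b where "a = norm (u, s)" and "b = norm (v, s)"
    have ab: "0 < a" "a \<le> b" using True s by (auto simp: a_def b_def zero_prod_def)
    have "b - a \<le> norm ((v, s) - (u, s))" unfolding a_def b_def by (rule norm_triangle_ineq2)
    then have d: "b - a \<le> norm (u - v)" by (simp add: norm_Pair norm_minus_commute)
    have "s \<le> b" unfolding b_def using s by (metis abs_of_pos less_le_trans norm_snd_le real_norm_def snd_conv)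
    have "1 + real ?n * (a / b - 1) \<le> (1 + (a / b - 1)) ^ ?n"
      by (rule Bernoulli_inequality) (use ab in auto)
    then have "1 - (a / b) ^ ?n \<le> real ?n * ((b - a) / b)"
      using ab by (simp add: field_simps del: power_Suc)
    also have "\<dots> \<le> real ?n * (norm (u - v) / s0)"
      using d ab s \<open>s \<le> b\<close> by (intro mult_left_mono frac_le) auto
    finally have 1: "1 - (a / b) ^ ?n \<le> real ?n / s0 * norm (u - v)" by simp
    have "poisson s v = (a / b) ^ ?n * poisson s u"
      using ab by (simp add: poisson_def a_def[symmetric] b_def[symmetric] power_divide del: power_Suc)
    then have "poisson s u - poisson s v = (1 - (a / b) ^ ?n) * poisson s u" by (simp only: left_diff_distrib mult_1)
    also have "\<dots> \<le> (real ?n / s0 * norm (u - v)) * poisson s u"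
      using 1 s by (intro mult_right_mono poisson_nonneg) auto
    finally show ?thesis .
  next
    case False
    then have "norm (v, s) ^ ?n \<le> norm (u, s) ^ ?n" by (intro power_mono) auto
    then have "poisson s u \<le> poisson s v"
      unfolding poisson_def using s
      by (intro divide_left_mono mult_nonneg_nonneg less_imp_le[OF poisson_const_pos] mult_pos_pos zero_less_power norm_Pair_pos) auto
    moreover have "0 \<le> real ?n / s0 * norm (u - v) * poisson s u"
      using s by (intro mult_nonneg_nonneg poisson_nonneg) auto
    ultimately show ?thesis by linarith
  qed
  have nn: "poisson s u \<ge> 0" "poisson s v \<ge> 0" using s by (auto intro!: poisson_nonneg)
  have c: "real ?n / s0 \<ge> 0" using s by simp
  have 1: "\<bar>poisson s u - poisson s v\<bar> \<le> real ?n / s0 * norm (u - v) * (poisson s u + poisson s v)"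
  proof -
    let ?c = "real ?n / s0 * norm (u - v)"
    have "?c * poisson s u \<ge> 0" "?c * poisson s v \<ge> 0"
      by (intro mult_nonneg_nonneg norm_ge_zero nn c)+
    moreover have "poisson s u - poisson s v \<le> ?c * poisson s u" "poisson s v - poisson s u \<le> ?c * poisson s v"
      using key[of u v] key[of v u] by (simp_all only: norm_minus_commute)
    ultimately show ?thesis unfolding distrib_left by linarith
  qed
  show ?thesis
  proof (cases "norm (u - v) \<le> 1")
    case True
    have "real ?n / s0 * norm (u - v) \<le> (1 + real ?n / s0) * min 1 (norm (u - v))"
      using True by (simp add: min_def algebra_simps)
    then show ?thesis using 1 nn by (meson add_nonneg_nonneg mult_right_mono order_trans)
  next
    case False
    have "\<bar>poisson s u - poisson s v\<bar> \<le> 1 * (poisson s u + poisson s v)" using nn by (simp add: abs_if)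
    also have "\<dots> \<le> ((1 + real ?n / s0) * min 1 (norm (u - v))) * (poisson s u + poisson s v)"
      using False c nn by (intro mult_right_mono) (auto simp: min_def)
    finally show ?thesis .
  qed
qed

lemma poisson_eq_powr:
  assumes "s > 0"
  shows "poisson s (u::'a::euclidean_space) = poisson_const TYPE('a) * (s * (u \<bullet> u + s * s) powr (- (real (DIM('a) + 1) / 2)))"
proof -
  have "norm (u, s) = (u \<bullet> u + s * s) powr (1/2)"
    by (simp add: norm_Pair powr_half_sqrt power2_eq_square power2_norm_eq_inner[unfolded power2_eq_square])
  moreover have "u \<bullet> u + s * s > 0" using assms by (simp add: add_nonneg_pos)
  ultimately have "norm (u, s) ^ (DIM('a) + 1) = (u \<bullet> u + s * s) powr (real (DIM('a) + 1) / 2)"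
    by (simp add: powr_realpow[symmetric] powr_powr powr_gt_zero del: power_Suc)
  then show ?thesis by (simp only: poisson_def powr_minus divide_inverse mult.assoc)
qed

lemma poisson_time_derivative:
  assumes "s > 0"
  obtains D where "((\<lambda>s. poisson s (u::'a::euclidean_space)) has_real_derivative D) (at s)"
proof -
  have p: "u \<bullet> u + s * s > 0" using assms by (simp add: add_nonneg_pos)
  have "\<exists>D. ((\<lambda>s. poisson_const TYPE('a) * (s * (u \<bullet> u + s * s) powr (- (real (DIM('a) + 1) / 2)))) has_real_derivative D) (at s)"
    by (rule exI) (rule derivative_eq_intros refl p)+
  then obtain D where "((\<lambda>s. poisson_const TYPE('a) * (s * (u \<bullet> u + s * s) powr (- (real (DIM('a) + 1) / 2)))) has_real_derivative D) (at s)"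
    by blast
  then have "((\<lambda>s. poisson s u) has_real_derivative D) (at s)"
    by (rule has_field_derivative_transform_within_open[of _ _ _ "{0<..}"])
      (use assms in \<open>auto simp: poisson_eq_powr\<close>)
  then show ?thesis by (rule that)
qed

lemma smooth_upto_poisson:
  fixes x0 :: "'a::euclidean_space"
  shows "smooth_upto k {p. snd p < t1} (\<lambda>p. poisson (t1 - snd p) (fst p - x0))"
proof -
  let ?S = "{p::'a \<times> real. snd p < t1}"
  have op: "open ?S" by (intro open_Collect_less continuous_intros)
  have s: "smooth_upto k ?S (\<lambda>p. t1 - snd p)" "smooth_upto k ?S (\<lambda>p. fst p - x0)"
    using smooth_upto_diff[OF op smooth_upto_const[OF op] smooth_upto_bounded_linear[OF bounded_linear_snd op]]
      smooth_upto_diff[OF op smooth_upto_bounded_linear[OF bounded_linear_fst op] smooth_upto_const[OF op]]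
    by auto
  have "smooth_upto k ?S (\<lambda>p. ((fst p - x0) \<bullet> (fst p - x0) + (t1 - snd p) * (t1 - snd p)) powr (- (real (DIM('a) + 1) / 2)))"
    by (rule smooth_upto_compose_real[OF op _ smooth_upto_powr])
      (auto intro!: smooth_upto_add smooth_upto_inner smooth_upto_mult op s add_nonneg_pos)
  then have "smooth_upto k ?S (\<lambda>p. poisson_const TYPE('a) * ((t1 - snd p) *
      ((fst p - x0) \<bullet> (fst p - x0) + (t1 - snd p) * (t1 - snd p)) powr (- (real (DIM('a) + 1) / 2))))"
    by (intro smooth_upto_mult smooth_upto_const op s)
  then show ?thesis
    by (rule smooth_upto_cong[OF op, rotated]) (auto simp: poisson_eq_powr)
qed

text \<open>At each time before \<open>t1\<close> the kernel has mass 1 in space, so a weight that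
  depends on time alone keeps its integral; from \<open>t1\<close> on the weight vanishes.\<close>

lemma nn_integral_time_poisson:
  fixes x0 :: "'a::euclidean_space"
  assumes [measurable]: "h \<in> borel_measurable borel" and h: "\<And>t. t \<ge> t1 \<Longrightarrow> h t = 0"
  shows "(\<integral>\<^sup>+p. h (snd p) * ennreal (poisson (t1 - snd p) (fst p - x0)) \<partial>lborel) = (\<integral>\<^sup>+t. h t \<partial>lborel)"
proof -
  have "(\<integral>\<^sup>+p. h (snd p) * ennreal (poisson (t1 - snd p) (fst p - x0)) \<partial>lborel)
    = (\<integral>\<^sup>+p. (\<lambda>(x, t). h t * ennreal (poisson (t1 - t) (x - x0))) p \<partial>(lborel \<Otimes>\<^sub>M lborel))"
    by (simp add: lborel_prod split_beta)
  also have "\<dots> = (\<integral>\<^sup>+t. \<integral>\<^sup>+x. h t * ennreal (poisson (t1 - t) (x - x0)) \<partial>lborel \<partial>lborel)"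
    by (subst lborel_pair.nn_integral_snd[symmetric]) (auto simp: split_beta)
  also have "\<dots> = (\<integral>\<^sup>+t. h t \<partial>lborel)"
  proof (rule nn_integral_cong)
    fix t :: real
    show "(\<integral>\<^sup>+x. h t * ennreal (poisson (t1 - t) (x - x0)) \<partial>lborel) = h t"
    proof (cases "t \<ge> t1")
      case False
      have "(\<integral>\<^sup>+x. ennreal (poisson (t1 - t) (x - x0)) \<partial>lborel) = 1"
        using nn_integral_lborel_translate[of "\<lambda>x. ennreal (poisson (t1 - t) x)" "- x0"] nn_integral_poisson[of "t1 - t", where 'a='a] False
        by simp
      then show ?thesis by (simp add: nn_integral_cmult)
    qed (simp add: h)
  qed
  finally show ?thesis .
qed

section \<open>The commutator with a wide spatial cut-off\<close>

lemma min_1_power2: "r \<ge> 0 \<Longrightarrow> min 1 (r\<^sup>2) = min 1 r * min 1 (r::real)"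
proof (cases "r \<le> 1")
  case True
  moreover assume "r \<ge> 0"
  ultimately have "r\<^sup>2 \<le> 1" by (intro power_le_one)
  then show ?thesis using True by (simp only: min_absorb2 power2_eq_square)
next
  case False
  then have "1 \<le> r\<^sup>2" by (intro one_le_power) auto
  then show ?thesis using False by simp
qed

lemma min_1_mult_le: "R \<ge> 1 \<Longrightarrow> r \<ge> 0 \<Longrightarrow> min 1 ((r / R)\<^sup>2) \<le> min 1 (r / R) * min 1 (r::real)"
proof -
  assume R: "R \<ge> 1" and r: "r \<ge> 0"
  have "min 1 ((r / R)\<^sup>2) = min 1 (r / R) * min 1 (r / R)"
    using r R by (intro min_1_power2) auto
  also have "\<dots> \<le> min 1 (r / R) * min 1 r"
    using r R by (intro mult_left_mono min.mono) (auto simp: divide_le_eq mult_le_cancel_left1)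
  finally show ?thesis .
qed

text \<open>The gain of a cut-off at scale \<open>R\<close> over the weight
  \<open>min 1 ((norm y)\<^sup>2)\<close> that already makes the jump kernel integrable. It is at
  most 1 for \<open>R \<ge> 1\<close>, and \<open>x / 0 = 0\<close> gives it the value 0 at the
  origin.\<close>

definition cutoff_ratio :: "real \<Rightarrow> 'a::real_normed_vector \<Rightarrow> real" where
  "cutoff_ratio R y = min 1 (norm y / R) / min 1 (norm y)"

lemma cutoff_ratio_nonneg: "R > 0 \<Longrightarrow> cutoff_ratio R y \<ge> 0"
  by (auto simp: cutoff_ratio_def)

lemma cutoff_ratio_le_1: "R \<ge> 1 \<Longrightarrow> cutoff_ratio R y \<le> 1"
  by (auto simp: cutoff_ratio_def divide_le_eq min_def mult_le_cancel_left1 split: if_splits)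

lemma cutoff_ratio_eq: "min 1 (norm y / R) * min 1 (norm y) = min 1 ((norm y / 1)\<^sup>2) * cutoff_ratio R y"
  by (cases "y = 0") (auto simp: cutoff_ratio_def min_1_power2)

lemma cutoff_ratio_measurable [measurable]: "cutoff_ratio R \<in> borel_measurable borel"
  unfolding cutoff_ratio_def by measurable

text \<open>For fixed \<open>y\<close> the ratio tends to 0 as the scale grows, and
  \<open>jump_kernel 1\<close> dominates; this is why the spatial cut-off costs arbitrarily
  little.\<close>

lemma cutoff_ratio_integral_tendsto_0:
  "(\<lambda>n. \<integral>\<^sup>+y. ennreal (jump_kernel 1 (y::'a::euclidean_space) * cutoff_ratio (real (Suc n)) y) \<partial>lborel) \<longlonglongrightarrow> 0"
proof -
  have "(\<lambda>n. \<integral>\<^sup>+y. ennreal (jump_kernel 1 (y::'a) * cutoff_ratio (real (Suc n)) y) \<partial>lborel)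
    \<longlonglongrightarrow> (\<integral>\<^sup>+y. 0 \<partial>(lborel :: 'a measure))"
  proof (rule nn_integral_dominated_convergence[where w="\<lambda>y. ennreal (jump_kernel 1 y)"])
    show "(\<integral>\<^sup>+y. ennreal (jump_kernel 1 (y::'a)) \<partial>lborel) < \<infinity>"
      using nn_integral_jump_kernel[of 1, where 'a='a] by (simp add: le_less_trans)
    show "AE y in lborel. ennreal (jump_kernel 1 (y::'a) * cutoff_ratio (real (Suc n)) y) \<le> ennreal (jump_kernel 1 y)" for n
      by (intro AE_I2 ennreal_leI mult_right_le_one_le jump_kernel_nonneg cutoff_ratio_nonneg cutoff_ratio_le_1) auto
    show "AE y in lborel. (\<lambda>n. ennreal (jump_kernel 1 (y::'a) * cutoff_ratio (real (Suc n)) y)) \<longlonglongrightarrow> 0"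
    proof (rule AE_I2)
      fix y :: 'a
      have "(\<lambda>n. norm y / real (Suc n)) \<longlonglongrightarrow> 0"
        using tendsto_mult_right_zero[OF LIMSEQ_Suc[OF lim_1_over_n[where 'a=real]], of "norm y"] by simp
      then have "(\<lambda>n. min 1 (norm y / real (Suc n))) \<longlonglongrightarrow> min 1 0"
        by (intro tendsto_min tendsto_const)
      from tendsto_mult[OF tendsto_const[of "jump_kernel 1 y"] tendsto_mult[OF this tendsto_const[of "inverse (min 1 (norm y))"]]]
      have "(\<lambda>n. jump_kernel 1 y * cutoff_ratio (real (Suc n)) y) \<longlonglongrightarrow> 0"
        by (simp add: cutoff_ratio_def divide_inverse)
      from tendsto_ennrealI[OF this]
      show "(\<lambda>n. ennreal (jump_kernel 1 (y::'a) * cutoff_ratio (real (Suc n)) y)) \<longlonglongrightarrow> 0" by simp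
    qed
  qed auto
  then show ?thesis by simp
qed

text \<open>Cutting the Poisson kernel off in space perturbs the equation by a commutator.  Symmetrising the
  latter in \<open>y\<close> gains the factor that makes it absolutely convergent.\<close>
lemma commutator_bound:
  fixes \<chi>' :: "'a::euclidean_space \<Rightarrow> real" and x x0 y :: 'a
  assumes s: "s0 > 0" "s0 \<le> s" and R: "R \<ge> 1"
    and C: "C \<ge> 0" "\<And>x y. \<bar>\<chi>' (x + y) + \<chi>' (x - y) - 2 * \<chi>' x\<bar> \<le> C * min 1 ((norm y / R)\<^sup>2)"
    and L: "L \<ge> 0" "\<And>x y. \<bar>\<chi>' x - \<chi>' y\<bar> \<le> L * min 1 (norm (x - y) / R)"
  defines "F \<equiv> \<lambda>y. (\<chi>' x - \<chi>' (x - y)) * poisson s (x - y - x0)"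
  shows "\<bar>F y + F (- y)\<bar> \<le> min 1 ((norm y / 1)\<^sup>2) * ((C + 2 * L * (1 + real (DIM('a) + 1) / s0)) * cutoff_ratio R y *
      (poisson s (x + y - x0) + poisson s (x - y - x0) + poisson s (x - x0)))"
proof -
  let ?c = "1 + real (DIM('a) + 1) / s0"
  let ?m = "min 1 (norm y / R) * min 1 (norm y)"
  define P Pp Pm where "P = poisson s (x - x0)" and "Pp = poisson s (x + y - x0)" and "Pm = poisson s (x - y - x0)"
  have nn: "P \<ge> 0" "Pp \<ge> 0" "Pm \<ge> 0" using s by (auto simp: P_def Pp_def Pm_def intro!: poisson_nonneg)
  have m0: "?m \<ge> 0" using R by simp
  have c0: "?c \<ge> 0" using s by simp
  \<comment> \<open>A discrete product rule: the second difference of the cut-off times the central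
    value of the kernel, plus two products of first differences. In each product the cut-off
    contributes \<open>norm y / R\<close> and the kernel contributes \<open>norm y\<close>, both
    capped at 1.\<close>
  have e: "F y + F (- y) = - (\<chi>' (x + y) + \<chi>' (x - y) - 2 * \<chi>' x) * P
      + (\<chi>' x - \<chi>' (x - y)) * (Pm - P) + (\<chi>' x - \<chi>' (x + y)) * (Pp - P)"
    by (simp add: F_def P_def Pp_def Pm_def algebra_simps)
  have 1: "\<bar>- (\<chi>' (x + y) + \<chi>' (x - y) - 2 * \<chi>' x) * P\<bar> \<le> (C * ?m) * P"
  proof -
    have "C * min 1 ((norm y / R)\<^sup>2) \<le> C * ?m" using min_1_mult_le[OF R, of "norm y"] C(1) by (intro mult_left_mono) auto
    then have "\<bar>\<chi>' (x + y) + \<chi>' (x - y) - 2 * \<chi>' x\<bar> \<le> C * ?m" using C(2)[of x y] by linarith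
    then show ?thesis using nn(1) by (simp only: abs_mult abs_minus_cancel abs_of_nonneg mult_right_mono)
  qed
  have prod: "\<bar>(\<chi>' x - \<chi>' z) * (Q - P)\<bar> \<le> (L * ?c * ?m) * (Q + P)"
    if "\<bar>Q - P\<bar> \<le> ?c * min 1 (norm y) * (Q + P)" "norm (x - z) = norm y" for z Q
  proof -
    have "\<bar>(\<chi>' x - \<chi>' z) * (Q - P)\<bar> \<le> (L * min 1 (norm y / R)) * (?c * min 1 (norm y) * (Q + P))"
      unfolding abs_mult using that L(2)[of x z] L(1) R by (intro mult_mono) auto
    then show ?thesis by (simp only: mult_ac)
  qed
  have 2: "\<bar>(\<chi>' x - \<chi>' (x - y)) * (Pm - P)\<bar> \<le> (L * ?c * ?m) * (Pm + P)"
    using poisson_lipschitz[OF s, of "x - y - x0" "x - x0"] by (intro prod) (auto simp: P_def Pm_def)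
  have 3: "\<bar>(\<chi>' x - \<chi>' (x + y)) * (Pp - P)\<bar> \<le> (L * ?c * ?m) * (Pp + P)"
    using poisson_lipschitz[OF s, of "x + y - x0" "x - x0"] by (intro prod) (auto simp: P_def Pp_def)
  have "\<bar>F y + F (- y)\<bar> \<le> (C * ?m) * P + (L * ?c * ?m) * (Pm + P) + (L * ?c * ?m) * (Pp + P)"
    unfolding e using 1 2 3 by linarith
  also have "\<dots> \<le> ((C + 2 * L * ?c) * ?m) * (Pp + Pm + P)"
  proof -
    have "0 \<le> (C * ?m) * (Pp + Pm)" "0 \<le> (L * ?c * ?m) * (Pp + Pm)"
      by (intro mult_nonneg_nonneg add_nonneg_nonneg nn m0 c0 C(1) L(1))+
    moreover have "r * P + q * (Pm + P) + q * (Pp + P) \<le> (r + 2 * q) * (Pp + Pm + P)"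
      if "0 \<le> r * (Pp + Pm)" "0 \<le> q * (Pp + Pm)" for r q
      using that by (simp add: algebra_simps)
    moreover have "(C + 2 * L * c) * m = C * m + 2 * (L * c * m)" for c m :: real
      by (simp add: algebra_simps)
    ultimately show ?thesis by (simp only:)
  qed
  also have "\<dots> = ((C + 2 * L * ?c) * (min 1 ((norm y / 1)\<^sup>2) * cutoff_ratio R y)) * (Pp + Pm + P)"
    by (subst cutoff_ratio_eq) (rule refl)
  also have "\<dots> = min 1 ((norm y / 1)\<^sup>2) * ((C + 2 * L * ?c) * cutoff_ratio R y * (Pp + Pm + P))"
    by (simp only: mult_ac)
  finally show ?thesis by (simp only: P_def Pp_def Pm_def)
qed

lemma poisson_le_poisson_0:
  assumes "s > 0"
  shows "poisson s (u::'a::euclidean_space) \<le> poisson s (0::'a)"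
proof -
  have "norm (0::'a, s) \<le> norm (u, s)" by (simp add: norm_Pair)
  then have "norm (0::'a, s) ^ (DIM('a) + 1) \<le> norm (u, s) ^ (DIM('a) + 1)" by (intro power_mono) auto
  then show ?thesis
    unfolding poisson_def using assms
    by (intro divide_left_mono mult_nonneg_nonneg less_imp_le[OF poisson_const_pos] mult_pos_pos zero_less_power norm_Pair_pos) auto
qed

text \<open>The kernel without cut-off satisfies the equation exactly: its half-Laplacian is minus
  its derivative in \<open>s\<close>. By the semigroup law the increment of the kernel in
  \<open>s\<close> is an average against \<open>poisson (?s n)\<close>, just like the difference
  quotient of the half-Laplacian; adding the two at the same step leaves only the average of the
  commutator increment \<open>F\<close>.\<close>

lemma truncated_half_laplacian_bound:
  fixes \<chi>' :: "'a::euclidean_space \<Rightarrow> real" and x0 :: 'a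
  assumes s: "s0 > 0" "s0 \<le> s" and R: "R \<ge> 1" and c: "\<bar>c\<bar> \<le> 1"
    and C: "C \<ge> 0" "\<And>x y. \<bar>\<chi>' (x + y) + \<chi>' (x - y) - 2 * \<chi>' x\<bar> \<le> C * min 1 ((norm y / R)\<^sup>2)"
    and L: "L \<ge> 0" "\<And>x y. \<bar>\<chi>' x - \<chi>' y\<bar> \<le> L * min 1 (norm (x - y) / R)"
    and [measurable]: "\<chi>' \<in> borel_measurable borel"
    and t: "test_function_on UNIV \<phi>" and \<phi>: "\<And>y. \<phi> y = of_real (c * (\<chi>' y * poisson s (y - x0)))"
    and D: "((\<lambda>s. poisson s (x - x0)) has_real_derivative D) (at s)"
  shows "ennreal (norm (half_laplacian \<phi> x + of_real (c * (\<chi>' x * D))))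
    \<le> (\<integral>\<^sup>+y. ennreal (jump_kernel 1 y * ((C + 2 * L * (1 + real (DIM('a) + 1) / s0)) * cutoff_ratio R y *
      (poisson s (x + y - x0) + poisson s (x - y - x0) + poisson s (x - x0)))) \<partial>lborel)"
proof -
  let ?s = "\<lambda>n. 1 / real (Suc n)"
  let ?K = "C + 2 * L * (1 + real (DIM('a) + 1) / s0)"
  let ?G = "\<lambda>y. ?K * cutoff_ratio R y * (poisson s (x + y - x0) + poisson s (x - y - x0) + poisson s (x - x0))"
  define F where "F = (\<lambda>y. (\<chi>' x - \<chi>' (x - y)) * poisson s (x - y - x0))"
  have sp: "s > 0" using s by simp
  have spos: "?s n > 0" for n by simp
  have [measurable]: "F \<in> borel_measurable borel" unfolding F_def by measurable
  have Fb: "norm (complex_of_real (F y)) \<le> L * poisson s (0::'a)" for y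
  proof -
    have "\<bar>\<chi>' x - \<chi>' (x - y)\<bar> \<le> L * 1" using L(2)[of x "x - y"] L(1) mult_left_mono[of "min 1 (norm y / R)" 1 L] by simp
    then have "\<bar>F y\<bar> \<le> (L * 1) * poisson s (0::'a)"
      unfolding F_def abs_mult using poisson_le_poisson_0[OF sp, of "x - y - x0"] poisson_nonneg[of s "x - y - x0"] sp L(1)
      by (intro mult_mono) (auto simp: abs_of_nonneg)
    then show ?thesis by simp
  qed
  have int: "integrable lborel (\<lambda>y. of_real (poisson (?s n) y) * complex_of_real (F y))" for n
    by (rule integrable_poisson_times_bounded[OF _ Fb spos]) measurable
  have int': "integrable lborel (\<lambda>y. of_real (poisson (?s n) y) * complex_of_real (F (- y)))" for n
    by (rule integrable_poisson_times_bounded[OF _ Fb spos]) measurable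
  define X where "X = (\<lambda>n. (\<phi> x - (LINT y|lborel. \<phi> y * of_real (poisson (?s n) (x - y)))) / of_real (?s n)
      + of_real (c * (\<chi>' x * ((poisson (s + ?s n) (x - x0) - poisson s (x - x0)) / ?s n))))"
  have "X \<longlonglongrightarrow> half_laplacian \<phi> x + of_real (c * (\<chi>' x * D))"
    unfolding X_def
  proof (intro tendsto_add half_laplacian_limit[OF t] tendsto_of_real tendsto_mult tendsto_const)
    have "((\<lambda>h. (poisson (s + h) (x - x0) - poisson s (x - x0)) / h) \<longlongrightarrow> D) (at 0)"
      using D by (simp add: DERIV_def)
    moreover have "filterlim ?s (at 0) sequentially"
      using LIMSEQ_Suc[OF lim_1_over_n[where 'a=real]] by (auto simp: filterlim_at)
    ultimately show "(\<lambda>n. (poisson (s + ?s n) (x - x0) - poisson s (x - x0)) / ?s n) \<longlonglongrightarrow> D"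
      by (rule filterlim_compose)
  qed
  moreover have "ennreal (norm (X n)) \<le> (\<integral>\<^sup>+y. ennreal (jump_kernel 1 y * ?G y) \<partial>lborel)" for n
  proof -
    let ?P = "\<lambda>y. complex_of_real (poisson (?s n) y)"
    have [measurable]: "\<phi> \<in> borel_measurable borel" by (rule test_function_measurable[OF t])
    obtain B where B: "\<And>x. norm (\<phi> x) \<le> B" using test_function_bounded[OF t] by metis
    have i1: "integrable lborel (\<lambda>y. ?P y * \<phi> (x - y))"
      by (rule integrable_poisson_times_bounded[OF _ B spos]) measurable
    have i2: "integrable lborel (\<lambda>y. ?P y * of_real (c * (\<chi>' x * poisson s (x - y - x0))))"
    proof (rule integrable_poisson_times_bounded[OF _ _ spos])
      show "norm (complex_of_real (c * (\<chi>' x * poisson s (x - y - x0)))) \<le> \<bar>c\<bar> * (\<bar>\<chi>' x\<bar> * poisson s (0::'a))" for y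
        using poisson_le_poisson_0[OF sp, of "x - y - x0"] poisson_nonneg[of s "x - y - x0"] sp
        by (auto simp: norm_mult abs_mult intro!: mult_left_mono)
    qed measurable
    have "(LINT y|lborel. poisson (?s n) y * poisson s (x - x0 - y)) = poisson (?s n + s) (x - x0)"
      by (rule poisson_semigroup[OF spos sp])
    then have "of_real (c * (\<chi>' x * poisson (s + ?s n) (x - x0)))
       = of_real (c * \<chi>' x) * complex_of_real (LINT y|lborel. poisson (?s n) y * poisson s (x - x0 - y))"
      by (simp add: add.commute)
    also have "\<dots> = (LINT y|lborel. of_real (c * \<chi>' x) * complex_of_real (poisson (?s n) y * poisson s (x - x0 - y)))"
      by (simp only: integral_mult_right_zero integral_complex_of_real)
    also have "\<dots> = (LINT y|lborel. ?P y * of_real (c * (\<chi>' x * poisson s (x - y - x0))))"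
      by (intro Bochner_Integration.integral_cong) (auto simp: algebra_simps)
    finally have sg: "complex_of_real (c * (\<chi>' x * poisson (s + ?s n) (x - x0))) = (LINT y|lborel. ?P y * of_real (c * (\<chi>' x * poisson s (x - y - x0))))" .
    have "X n = (complex_of_real (c * (\<chi>' x * poisson (s + ?s n) (x - x0))) - (LINT y|lborel. ?P y * \<phi> (x - y))) / of_real (?s n)"
      unfolding X_def poisson_convolution_commute[OF \<open>\<phi> \<in> borel_measurable borel\<close>] \<phi>[of x]
      by (simp add: diff_divide_distrib[symmetric] add_divide_distrib[symmetric] right_diff_distrib del: of_nat_Suc divide_divide_eq_right)
    also have "\<dots> = (LINT y|lborel. ?P y * of_real (c * (\<chi>' x * poisson s (x - y - x0))) - ?P y * \<phi> (x - y)) / of_real (?s n)"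
      unfolding sg using i1 i2 by (simp only: Bochner_Integration.integral_diff)
    also have "(LINT y|lborel. ?P y * of_real (c * (\<chi>' x * poisson s (x - y - x0))) - ?P y * \<phi> (x - y))
       = (LINT y|lborel. of_real c * (?P y * of_real (F y)))"
      by (intro Bochner_Integration.integral_cong) (auto simp: \<phi> F_def algebra_simps)
    also have "\<dots> = of_real c * (LINT y|lborel. ?P y * of_real (F y))"
      by (rule integral_mult_right_zero)
    \<comment> \<open>Averaging with the reflection of \<open>y\<close>: by itself \<open>F\<close>
      is only of first order at the origin, which the jump kernel does not make integrable uniformly
      in \<open>n\<close>.\<close>
    also have "(LINT y|lborel. ?P y * of_real (F y)) = (LINT y|lborel. ?P y * of_real (F y + F (- y))) / 2"
    proof -
      have "(LINT y|lborel. ?P y * of_real (F (- y))) = (LINT y|lborel. ?P y * of_real (F y))"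
        using integral_lborel_reflect[of "\<lambda>y. ?P y * of_real (F y)" 0] by simp
      moreover have "(LINT y|lborel. ?P y * of_real (F y + F (- y))) = (LINT y|lborel. ?P y * of_real (F y)) + (LINT y|lborel. ?P y * of_real (F (- y)))"
        using int[of n] int'[of n] by (simp only: of_real_add distrib_left Bochner_Integration.integral_add)
      ultimately show ?thesis by simp
    qed
    finally have "norm (X n) = \<bar>c\<bar> * (norm (LINT y|lborel. ?P y * of_real (F y + F (- y))) / 2) / \<bar>?s n\<bar>"
      by (simp only: norm_mult norm_divide norm_of_real norm_numeral)
    also have "\<dots> = \<bar>c\<bar> / 2 * norm ((LINT y|lborel. ?P y * of_real (F y + F (- y))) / of_real (?s n))"
    proof -
      have "a * (b / 2) / d = a / 2 * (b / d)" for a b d :: real by simp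
      then show ?thesis by (simp only: norm_divide norm_of_real)
    qed
    also have "\<dots> \<le> 1 * norm ((LINT y|lborel. ?P y * of_real (F y + F (- y))) / of_real (?s n))"
      using c by (intro mult_right_mono) auto
    finally have "ennreal (norm (X n)) \<le> ennreal (norm ((LINT y|lborel. ?P y * of_real (F y + F (- y))) / of_real (?s n)))"
      by (intro ennreal_leI) simp
    also have "\<dots> \<le> (\<integral>\<^sup>+y. ennreal (jump_kernel 1 y * ?G y) \<partial>lborel)"
    proof (rule poisson_integral_bound[OF _ _ _ spos])
      show "norm (complex_of_real (F y + F (- y))) \<le> min 1 ((norm y / 1)\<^sup>2) * ?G y" for y
        using commutator_bound[OF s R C L, where x=x and y=y and x0=x0] by (simp only: norm_of_real F_def)
      show "0 \<le> ?G y" for y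
        using C(1) L(1) R s by (intro mult_nonneg_nonneg add_nonneg_nonneg cutoff_ratio_nonneg poisson_nonneg divide_nonneg_nonneg) auto
      show "integrable lborel (\<lambda>y. ?P y * complex_of_real (F y + F (- y)))"
        using Bochner_Integration.integrable_add[OF int[of n] int'[of n]] by (simp add: distrib_left)
    qed measurable
    finally show ?thesis .
  qed
  ultimately show ?thesis by (rule LIMSEQ_ennreal_norm_le)
qed

lemma half_laplacian_zero [simp]: "half_laplacian (\<lambda>x. 0) x = 0"
  using half_laplacian_cmult[of 0 "\<lambda>x. 0" x] by simp

text \<open>The kernel is smooth before time \<open>t1\<close>, and the product is 0 after
  \<open>t1 - s0\<close>. These two open half-spaces cover everything because \<open>s0 > 0\<close>,
  so the singularity at the apex is never seen.\<close>

lemma truncated_poisson_smooth: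
  fixes x0 :: "'a::euclidean_space"
  assumes "0 < s0" "\<And>k. smooth_upto k UNIV \<theta>" "\<And>t. t \<ge> t1 - s0 \<Longrightarrow> \<theta> t = 0" "\<And>k. smooth_upto k UNIV \<chi>'"
  shows "smooth_upto k UNIV (\<lambda>p. complex_of_real (\<theta> (snd p) * (\<chi>' (fst p) * poisson (t1 - snd p) (fst p - x0))))"
proof -
  let ?S = "{p::'a \<times> real. snd p < t1}" and ?T = "{p::'a \<times> real. snd p > t1 - s0}"
  have op: "open ?S" "open ?T" by (intro open_Collect_less continuous_intros)+
  have "smooth_upto k ?S (\<lambda>p. \<theta> (0 + snd p))"
    by (rule smooth_upto_compose_affine[OF op(1) bounded_linear_snd assms(2)]) auto
  moreover have "smooth_upto k ?S (\<lambda>p. \<chi>' (0 + fst p))"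
    by (rule smooth_upto_compose_affine[OF op(1) bounded_linear_fst assms(4)]) auto
  ultimately have S: "smooth_upto k ?S (\<lambda>p. complex_of_real (\<theta> (snd p) * (\<chi>' (fst p) * poisson (t1 - snd p) (fst p - x0))))"
    using smooth_upto_poisson[of k t1 x0] by (intro smooth_upto_of_real smooth_upto_mult op) auto
  have T: "smooth_upto k ?T (\<lambda>p. complex_of_real (\<theta> (snd p) * (\<chi>' (fst p) * poisson (t1 - snd p) (fst p - x0))))"
    by (rule smooth_upto_cong[OF op(2) _ smooth_upto_const[OF op(2), of k 0]]) (use assms(3) in auto)
  have "?S \<union> ?T = UNIV" using assms(1) by auto
  then show ?thesis using smooth_upto_Un[OF op S T] by simp
qed

text \<open>The part where the derivative falls on \<open>\<theta>\<close> contributes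
  \<open>V\<close>, since the kernel has mass 1 on each time slice. The additional 1 is room for the
  commutator with the spatial cut-off, whose scale \<open>R\<close> is chosen accordingly. Values
  are exact on the box of half-width 1 around \<open>x0\<close>, which contains the spatial
  projection of the unit cube as soon as it contains \<open>x0\<close>.\<close>

lemma truncated_poisson:
  fixes x0 :: "real ^ 'n::finite" and \<theta> \<theta>' :: "real \<Rightarrow> real"
  assumes s0: "0 < s0" and \<theta>: "\<And>k. smooth_upto k UNIV \<theta>" "\<And>t. (\<theta> has_real_derivative \<theta>' t) (at t)"
    and [measurable]: "\<theta>' \<in> borel_measurable borel"
    and range: "\<And>t. \<bar>\<theta> t\<bar> \<le> 1" and zero: "\<And>t. t \<ge> t1 - s0 \<Longrightarrow> \<theta> t = 0" "\<And>t. t \<le> t1 - S \<Longrightarrow> \<theta> t = 0"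
    and V: "(\<integral>\<^sup>+t. ennreal \<bar>\<theta>' t\<bar> \<partial>lborel) \<le> ennreal V" and V0: "V \<ge> 0"
  obtains \<Phi> where "test_function_on UNIV \<Phi>"
    "\<And>x t. (\<And>b. b \<in> Basis \<Longrightarrow> \<bar>(x - x0) \<bullet> b\<bar> \<le> 1) \<Longrightarrow> \<Phi> (x, t) = of_real (\<theta> t * poisson (t1 - t) (x - x0))"
    "(\<integral>\<^sup>+p. ennreal (norm (theta_transpose \<Phi> p)) \<partial>lborel) \<le> ennreal (V + 1)"
proof -
  let ?N = "CARD('n)"
  define \<chi>0 :: "real^'n \<Rightarrow> real" where "\<chi>0 = cube_bump 1"
  have \<chi>0_smooth: "smooth_upto k UNIV \<chi>0" for k unfolding \<chi>0_def by (rule smooth_upto_cube_bump)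
  have \<chi>0_zero: "\<chi>0 z = 0" if z: "z \<notin> cbox (- 2 *\<^sub>R One) (3 *\<^sub>R One)" for z
  proof -
    obtain b where b: "b \<in> Basis" "\<not> ((- 2 *\<^sub>R One) \<bullet> b \<le> z \<bullet> b \<and> z \<bullet> b \<le> (3 *\<^sub>R One) \<bullet> b)"
      using z unfolding mem_box by blast
    then have "z \<bullet> b \<le> - 2 * 1 \<or> z \<bullet> b \<ge> 1 + 2 * 1" by auto
    with b(1) show ?thesis unfolding \<chi>0_def by (intro cube_bump_eq_0) auto
  qed
  have tX: "test_function_on UNIV (\<lambda>z. complex_of_real (\<chi>0 z))"
    by (rule test_functionI[where K="cbox (- 2 *\<^sub>R One) (3 *\<^sub>R One)"])
      (auto intro!: smooth_upto_of_real \<chi>0_smooth \<chi>0_zero)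
  obtain C where C: "C \<ge> 0" "\<And>x y. norm (second_diff (\<lambda>z. complex_of_real (\<chi>0 z)) y x) \<le> min 1 ((norm y / 1)\<^sup>2) * C"
    using test_function_second_diff_min[OF tX] by metis
  obtain L0 where L0: "L0 \<ge> 0" "\<And>x y. norm (complex_of_real (\<chi>0 x) - complex_of_real (\<chi>0 y)) \<le> L0 * norm (x - y)"
    using test_function_lipschitz[OF tX] by metis
  define L where "L = L0 + 1"
  have \<chi>0r: "0 \<le> \<chi>0 z" "\<chi>0 z \<le> 1" for z unfolding \<chi>0_def by (rule cube_bump_range)+
  have L: "L \<ge> 0" "\<bar>\<chi>0 x - \<chi>0 y\<bar> \<le> L * min 1 (norm (x - y))" for x y
  proof -
    show "L \<ge> 0" using L0 by (simp add: L_def)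
    have "\<bar>\<chi>0 x - \<chi>0 y\<bar> \<le> L0 * norm (x - y)"
      using L0(2)[of x y] by (simp only: of_real_diff[symmetric] norm_of_real)
    also have "\<dots> \<le> L * norm (x - y)" by (simp add: L_def distrib_right)
    finally have "\<bar>\<chi>0 x - \<chi>0 y\<bar> \<le> L * norm (x - y)" .
    moreover have "\<bar>\<chi>0 x - \<chi>0 y\<bar> \<le> L * 1" using \<chi>0r[of x] \<chi>0r[of y] L0(1) by (simp add: L_def)
    ultimately show "\<bar>\<chi>0 x - \<chi>0 y\<bar> \<le> L * min 1 (norm (x - y))"
      unfolding min_def by (cases "1 \<le> norm (x - y)") (simp_all only: if_True if_False)
  qed
  define K where "K = C + 2 * L * (1 + real (?N + 1) / s0)"
  have K0: "K \<ge> 0" using C(1) L(1) s0 by (simp add: K_def)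
  define J where "J = (\<lambda>n. \<integral>\<^sup>+y. ennreal (jump_kernel 1 (y::real^'n) * cutoff_ratio (real (Suc n)) y) \<partial>lborel)"
  \<comment> \<open>The total commutator: 3 from the three translates, \<open>K\<close> from the
    commutator estimate, and \<open>\<bar>S\<bar>\<close> bounding the duration of
    \<open>\<theta>\<close>. A scale \<open>Suc n\<close> is chosen that makes it at most 1.\<close>
  have "(\<lambda>n. ennreal (3 * K * \<bar>S\<bar>) * J n) \<longlonglongrightarrow> ennreal (3 * K * \<bar>S\<bar>) * 0"
    unfolding J_def by (intro ennreal_tendsto_cmult cutoff_ratio_integral_tendsto_0) simp
  then have "\<forall>\<^sub>F n in sequentially. ennreal (3 * K * \<bar>S\<bar>) * J n < 1"
    by (intro order_tendstoD(2)[where y=0]) auto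
  from eventually_happens'[OF sequentially_bot this]
  obtain n where n: "ennreal (3 * K * \<bar>S\<bar>) * J n \<le> 1" by (auto dest: less_imp_le)
  define R where "R = real (Suc n)"
  have R: "R \<ge> 1" by (simp add: R_def)
  define \<chi>' where "\<chi>' = (\<lambda>x. \<chi>0 ((1 / R) *\<^sub>R (x - x0)))"
  have \<chi>'_smooth: "smooth_upto k UNIV \<chi>'" for k
  proof -
    have "smooth_upto k UNIV (\<lambda>x. \<chi>0 (- ((1 / R) *\<^sub>R x0) + (1 / R) *\<^sub>R x))"
      by (rule smooth_upto_compose_affine[OF open_UNIV bounded_linear_scaleR_right \<chi>0_smooth]) auto
    then show ?thesis by (simp add: \<chi>'_def scaleR_diff_right)
  qed
  have [measurable]: "\<chi>' \<in> borel_measurable borel"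
    using \<chi>'_smooth[of 0] by (intro borel_measurable_continuous_onI) simp
  have C': "\<bar>\<chi>' (x + y) + \<chi>' (x - y) - 2 * \<chi>' x\<bar> \<le> C * min 1 ((norm y / R)\<^sup>2)" for x y
  proof -
    have e: "(1 / R) *\<^sub>R (x + y - x0) = (1 / R) *\<^sub>R (x - x0) + (1 / R) *\<^sub>R y"
      "(1 / R) *\<^sub>R (x - y - x0) = (1 / R) *\<^sub>R (x - x0) - (1 / R) *\<^sub>R y"
      by (simp_all add: scaleR_diff_right scaleR_add_right)
    have "\<bar>\<chi>' (x + y) + \<chi>' (x - y) - 2 * \<chi>' x\<bar> = norm (second_diff (\<lambda>z. complex_of_real (\<chi>0 z)) ((1 / R) *\<^sub>R y) ((1 / R) *\<^sub>R (x - x0)))"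
      unfolding \<chi>'_def e
      by (simp only: norm_of_real[symmetric, where 'a=complex] of_real_add of_real_diff of_real_mult of_real_numeral)
    also have "\<dots> \<le> min 1 ((norm ((1 / R) *\<^sub>R y) / 1)\<^sup>2) * C" by (rule C(2))
    also have "norm ((1 / R) *\<^sub>R y) / 1 = norm y / R" using R by simp
    finally show ?thesis by (simp only: mult.commute)
  qed
  have L': "\<bar>\<chi>' x - \<chi>' y\<bar> \<le> L * min 1 (norm (x - y) / R)" for x y
  proof -
    have "norm ((1 / R) *\<^sub>R (x - x0) - (1 / R) *\<^sub>R (y - x0)) = norm (x - y) / R"
      using R by (simp add: scaleR_diff_right[symmetric])
    then show ?thesis using L(2)[of "(1 / R) *\<^sub>R (x - x0)" "(1 / R) *\<^sub>R (y - x0)"] by (simp only: \<chi>'_def)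
  qed
  have \<chi>'r: "\<bar>\<chi>' x\<bar> \<le> 1" for x using \<chi>0r[of "(1 / R) *\<^sub>R (x - x0)"] by (simp add: \<chi>'_def)
  define \<Phi> where "\<Phi> = (\<lambda>p. complex_of_real (\<theta> (snd p) * (\<chi>' (fst p) * poisson (t1 - snd p) (fst p - x0))))"
  have \<theta>'0: "\<theta>' t = 0" if "t \<ge> t1" for t
  proof -
    have "(\<theta> has_real_derivative 0) (at t)"
      by (rule has_field_derivative_transform_within_open[where S="{t1 - s0<..}" and f="\<lambda>_. 0"])
        (use that s0 zero(1) in auto)
    then show ?thesis using \<theta>(2) DERIV_unique by blast
  qed
  have t\<Phi>: "test_function_on UNIV \<Phi>"
  proof (rule test_functionI)
    show "smooth_upto k UNIV \<Phi>" for k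
      unfolding \<Phi>_def by (rule truncated_poisson_smooth[OF s0 \<theta>(1) zero(1) \<chi>'_smooth])
    let ?B = "(\<lambda>z. x0 + R *\<^sub>R z) ` cbox (- 2 *\<^sub>R One) (3 *\<^sub>R One)"
    show "compact (?B \<times> {t1 - S..t1})"
      by (intro compact_Times compact_continuous_image compact_cbox continuous_intros) auto
    show "\<Phi> p = 0" if "p \<notin> ?B \<times> {t1 - S..t1}" for p
    proof (cases "snd p \<in> {t1 - S..t1}")
      case False
      then have "\<theta> (snd p) = 0" using zero[of "snd p"] s0 by force
      then show ?thesis by (simp add: \<Phi>_def)
    next
      case True
      then have "fst p \<notin> ?B" using that by (cases p) auto
      moreover have "fst p = x0 + R *\<^sub>R ((1 / R) *\<^sub>R (fst p - x0))" using R by simp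
      ultimately have "(1 / R) *\<^sub>R (fst p - x0) \<notin> cbox (- 2 *\<^sub>R One) (3 *\<^sub>R One)" by blast
      then show ?thesis using \<chi>0_zero by (simp add: \<Phi>_def \<chi>'_def)
    qed
  qed
  let ?k = "\<lambda>y::real^'n. ennreal (K * (jump_kernel 1 y * cutoff_ratio R y))"
  let ?g = "\<lambda>p::(real^'n) \<times> real. indicator {t1 - S..t1 - s0} (snd p) * ennreal (poisson (t1 - snd p) (fst p - x0))"
  let ?h = "\<lambda>p::(real^'n) \<times> real. ennreal \<bar>\<theta>' (snd p)\<bar> * ennreal (poisson (t1 - snd p) (fst p - x0))"
  have pt: "ennreal (norm (theta_transpose \<Phi> p)) \<le> (\<integral>\<^sup>+y. ?k y * (?g (p + (y, 0)) + ?g (p - (y, 0)) + ?g p) \<partial>lborel) + ?h p" for p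
  proof -
    obtain x t where p: "p = (x, t)" by (cases p)
    show ?thesis
    proof (cases "t < t1")
      case False
      have "((\<lambda>s. \<Phi> (x, s)) has_vector_derivative 0) (at t)"
        by (rule has_vector_derivative_transform_within_open[where S="{t1 - s0<..}" and f="\<lambda>_. 0"])
          (use False s0 zero(1) in \<open>auto simp: \<Phi>_def\<close>)
      then have "vector_derivative (\<lambda>s. \<Phi> (x, s)) (at t) = 0" by (rule vector_derivative_at)
      moreover have "(\<lambda>y. \<Phi> (y, t)) = (\<lambda>y. 0)" using False s0 zero(1)[of t] by (auto simp: \<Phi>_def)
      ultimately have "theta_transpose \<Phi> p = 0" by (simp add: theta_transpose_def p)
      then show ?thesis by simp
    next
      case True
      define s where "s = t1 - t"
      have s: "s > 0" using True by (simp add: s_def)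
      obtain D where D: "((\<lambda>s. poisson s (x - x0)) has_real_derivative D) (at s)"
        using poisson_time_derivative[OF s] by blast
      have "((\<lambda>r. poisson (t1 - r) (x - x0)) has_real_derivative D * (- 1)) (at t)"
        by (rule DERIV_chain2[where f="\<lambda>s. poisson s (x - x0)"])
          (use D in \<open>auto intro!: derivative_eq_intros simp: s_def\<close>)
      then have "((\<lambda>r. \<theta> r * (\<chi>' x * poisson (t1 - r) (x - x0))) has_real_derivative
         \<theta>' t * (\<chi>' x * poisson s (x - x0)) + (\<chi>' x * (D * (- 1))) * \<theta> t) (at t)"
        unfolding s_def by (intro DERIV_mult \<theta>(2) DERIV_cmult)
      then have "((\<lambda>r. \<Phi> (x, r)) has_vector_derivative of_real
         (\<theta>' t * (\<chi>' x * poisson s (x - x0)) + (\<chi>' x * (D * (- 1))) * \<theta> t)) (at t)"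
        unfolding \<Phi>_def fst_conv snd_conv
        by (intro has_vector_derivative_of_real) (simp add: has_real_derivative_iff_has_vector_derivative)
      then have "theta_transpose \<Phi> p = half_laplacian (\<lambda>y. \<Phi> (y, t)) x
         - of_real (\<theta>' t * (\<chi>' x * poisson s (x - x0)) + (\<chi>' x * (D * (- 1))) * \<theta> t)"
        by (simp only: theta_transpose_def p case_prod_conv vector_derivative_at)
      \<comment> \<open>The derivative that falls on the kernel is grouped with the half-Laplacian,
        where it cancels up to the commutator; the derivative of \<open>\<theta>\<close> is what is
        left over.\<close>
      also have "\<dots> = (half_laplacian (\<lambda>y. \<Phi> (y, t)) x + of_real (\<theta> t * (\<chi>' x * D))) - of_real (\<theta>' t * (\<chi>' x * poisson s (x - x0)))"
        by (simp add: algebra_simps)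
      finally have th: "theta_transpose \<Phi> p = (half_laplacian (\<lambda>y. \<Phi> (y, t)) x + of_real (\<theta> t * (\<chi>' x * D))) - of_real (\<theta>' t * (\<chi>' x * poisson s (x - x0)))" .
      have 1: "ennreal (norm (half_laplacian (\<lambda>y. \<Phi> (y, t)) x + of_real (\<theta> t * (\<chi>' x * D))))
         \<le> (\<integral>\<^sup>+y. ?k y * (?g (p + (y, 0)) + ?g (p - (y, 0)) + ?g p) \<partial>lborel)"
      proof (cases "t \<in> {t1 - S..t1 - s0}")
        case False
        then have "\<theta> t = 0" using zero[of t] by force
        then have "(\<lambda>y. \<Phi> (y, t)) = (\<lambda>y. 0)" by (auto simp: \<Phi>_def)
        then show ?thesis using \<open>\<theta> t = 0\<close> by simp
      next
        case t: True
        have ss: "s0 \<le> s" using t by (simp add: s_def)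
        have "ennreal (norm (half_laplacian (\<lambda>y. \<Phi> (y, t)) x + of_real (\<theta> t * (\<chi>' x * D))))
          \<le> (\<integral>\<^sup>+y. ennreal (jump_kernel 1 y * ((C + 2 * L * (1 + real (DIM(real^'n) + 1) / s0)) * cutoff_ratio R y *
            (poisson s (x + y - x0) + poisson s (x - y - x0) + poisson s (x - x0)))) \<partial>lborel)"
          by (rule truncated_half_laplacian_bound[OF s0 ss R range C(1) C' L(1) L' _ test_function_slice[OF t\<Phi>] _ D])
            (auto simp: \<Phi>_def s_def)
        also have "\<dots> = (\<integral>\<^sup>+y. ?k y * (?g (p + (y, 0)) + ?g (p - (y, 0)) + ?g p) \<partial>lborel)"
        proof (rule nn_integral_cong)
          fix y :: "real^'n"
          have nn: "0 \<le> poisson s (x + y - x0)" "0 \<le> poisson s (x - y - x0)" "0 \<le> poisson s (x - x0)"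
            using s by (auto intro!: poisson_nonneg)
          have "?g (p + (y, 0)) + ?g (p - (y, 0)) + ?g p = ennreal (poisson s (x + y - x0) + poisson s (x - y - x0) + poisson s (x - x0))"
            using t nn by (simp add: p s_def)
          moreover have "ennreal (jump_kernel 1 y * ((C + 2 * L * (1 + real (DIM(real^'n) + 1) / s0)) * cutoff_ratio R y * Q)) = ?k y * ennreal Q" if "Q \<ge> 0" for Q
          proof -
            have "0 \<le> K * (jump_kernel 1 y * cutoff_ratio R y)"
              using R by (intro mult_nonneg_nonneg K0 jump_kernel_nonneg cutoff_ratio_nonneg) auto
            then have "?k y * ennreal Q = ennreal (K * (jump_kernel 1 y * cutoff_ratio R y) * Q)"
              using that by (simp only: ennreal_mult)
            then show ?thesis by (simp add: K_def mult_ac)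
          qed
          ultimately show "ennreal (jump_kernel 1 y * ((C + 2 * L * (1 + real (DIM(real^'n) + 1) / s0)) * cutoff_ratio R y *
              (poisson s (x + y - x0) + poisson s (x - y - x0) + poisson s (x - x0)))) = ?k y * (?g (p + (y, 0)) + ?g (p - (y, 0)) + ?g p)"
            using nn by (simp only: add_nonneg_nonneg)
        qed
        finally show ?thesis .
      qed
      have 2: "ennreal (norm (complex_of_real (\<theta>' t * (\<chi>' x * poisson s (x - x0))))) \<le> ?h p"
      proof -
        have "\<bar>\<chi>' x\<bar> * poisson s (x - x0) \<le> poisson s (x - x0)"
          using \<chi>'r[of x] poisson_nonneg[of s "x - x0"] s by (intro mult_left_le_one_le) auto
        then have "norm (complex_of_real (\<theta>' t * (\<chi>' x * poisson s (x - x0)))) \<le> \<bar>\<theta>' t\<bar> * poisson s (x - x0)"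
          using poisson_nonneg[of s "x - x0"] s by (auto simp: abs_mult norm_mult intro!: mult_left_mono)
        then have "ennreal (norm (complex_of_real (\<theta>' t * (\<chi>' x * poisson s (x - x0))))) \<le> ennreal (\<bar>\<theta>' t\<bar> * poisson s (x - x0))"
          by (rule ennreal_leI)
        then show ?thesis using s poisson_nonneg[of s "x - x0"] by (simp add: p s_def ennreal_mult)
      qed
      have "ennreal (norm (theta_transpose \<Phi> p)) \<le> ennreal (norm (half_laplacian (\<lambda>y. \<Phi> (y, t)) x + of_real (\<theta> t * (\<chi>' x * D))) + norm (complex_of_real (\<theta>' t * (\<chi>' x * poisson s (x - x0)))))"
        unfolding th by (intro ennreal_leI norm_triangle_ineq4)
      also have "\<dots> = ennreal (norm (half_laplacian (\<lambda>y. \<Phi> (y, t)) x + of_real (\<theta> t * (\<chi>' x * D)))) + ennreal (norm (complex_of_real (\<theta>' t * (\<chi>' x * poisson s (x - x0)))))"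
        by (rule ennreal_plus) auto
      finally show ?thesis using add_mono[OF 1 2] by (rule order_trans)
    qed
  qed
  have [measurable]: "(fst :: (real^'n) \<times> real \<Rightarrow> _) \<in> borel_measurable borel" "(snd :: (real^'n) \<times> real \<Rightarrow> _) \<in> borel_measurable borel"
    by (intro borel_measurable_continuous_onI continuous_intros)+
  have gm [measurable]: "?g \<in> borel_measurable borel" "?h \<in> borel_measurable borel" by measurable
  have "(\<integral>\<^sup>+p. ennreal (norm (theta_transpose \<Phi> p)) \<partial>lborel)
     \<le> (\<integral>\<^sup>+p. (\<integral>\<^sup>+y. ?k y * (?g (p + (y, 0)) + ?g (p - (y, 0)) + ?g p) \<partial>lborel) + ?h p \<partial>lborel)"
    by (intro nn_integral_mono pt)
  also have "\<dots> = (\<integral>\<^sup>+p. (\<integral>\<^sup>+y. ?k y * (?g (p + (y, 0)) + ?g (p - (y, 0)) + ?g p) \<partial>lborel) \<partial>lborel) + (\<integral>\<^sup>+p. ?h p \<partial>lborel)"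
    by (rule nn_integral_add) measurable
  also have "\<dots> = 3 * (\<integral>\<^sup>+y. ?k y \<partial>lborel) * (\<integral>\<^sup>+p. ?g p \<partial>lborel) + (\<integral>\<^sup>+p. ?h p \<partial>lborel)"
    by (subst nn_integral_kernel_translates) auto
  also have "(\<integral>\<^sup>+p. ?h p \<partial>lborel) = (\<integral>\<^sup>+t. ennreal \<bar>\<theta>' t\<bar> \<partial>lborel)"
    by (rule nn_integral_time_poisson) (auto simp: \<theta>'0)
  also have "(\<integral>\<^sup>+p. ?g p \<partial>lborel) = (\<integral>\<^sup>+t. indicator {t1 - S..t1 - s0} t \<partial>lborel)"
    by (rule nn_integral_time_poisson) (use s0 in auto)
  also have "(\<integral>\<^sup>+y. ?k y \<partial>lborel) = ennreal K * J n"
    unfolding J_def R_def[symmetric] using K0 R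
    by (subst nn_integral_cmult[symmetric]) (auto intro!: nn_integral_cong ennreal_mult mult_nonneg_nonneg jump_kernel_nonneg cutoff_ratio_nonneg)
  also have "3 * (ennreal K * J n) * (\<integral>\<^sup>+t. indicator {t1 - S..t1 - s0} t \<partial>lborel) + (\<integral>\<^sup>+t. ennreal \<bar>\<theta>' t\<bar> \<partial>lborel)
      \<le> 3 * (ennreal K * J n) * ennreal \<bar>S\<bar> + ennreal V"
  proof (intro add_mono V mult_left_mono)
    show "(\<integral>\<^sup>+t. indicator {t1 - S..t1 - s0} t \<partial>lborel) \<le> ennreal \<bar>S\<bar>"
      using s0 by (cases "t1 - S \<le> t1 - s0") (auto intro!: ennreal_leI)
  qed simp
  also have "3 * (ennreal K * J n) * ennreal \<bar>S\<bar> = ennreal (3 * K * \<bar>S\<bar>) * J n"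
  proof -
    have "ennreal (3 * K * \<bar>S\<bar>) = 3 * ennreal K * ennreal \<bar>S\<bar>" using K0 by (simp add: ennreal_mult)
    then show ?thesis by (simp only: mult_ac)
  qed
  also have "ennreal (3 * K * \<bar>S\<bar>) * J n + ennreal V \<le> 1 + ennreal V" using n by (intro add_mono) auto
  also have "1 + ennreal V = ennreal (V + 1)" using V0 by (simp add: add.commute)
  finally have bound: "(\<integral>\<^sup>+p. ennreal (norm (theta_transpose \<Phi> p)) \<partial>lborel) \<le> ennreal (V + 1)" .
  have val: "\<Phi> (x, t) = of_real (\<theta> t * poisson (t1 - t) (x - x0))" if "\<And>b. b \<in> Basis \<Longrightarrow> \<bar>(x - x0) \<bullet> b\<bar> \<le> 1" for x t
  proof -
    have "\<chi>' x = 1"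
      unfolding \<chi>'_def \<chi>0_def
    proof (rule cube_bump_eq_1)
      fix b :: "real^'n" assume "b \<in> Basis"
      then have "\<bar>((1 / R) *\<^sub>R (x - x0)) \<bullet> b\<bar> \<le> 1" using that R by (auto simp: divide_le_eq intro: order_trans)
      then show "- 1 \<le> (1 / R) *\<^sub>R (x - x0) \<bullet> b \<and> (1 / R) *\<^sub>R (x - x0) \<bullet> b \<le> 1 + 1" by linarith
    qed simp
    then show ?thesis by (simp add: \<Phi>_def)
  qed
  show ?thesis by (rule that[OF t\<Phi> val bound])
qed

section \<open>Geometry of the Cantor set\<close>

definition cantor_ratio :: "'n::finite itself \<Rightarrow> real" where
  "cantor_ratio T = cantor_side T 1"

lemma cantor_side_0 [simp]: "cantor_side T 0 = 1"
  by (simp add: cantor_side_def)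

lemma cantor_side_pos: "cantor_side T k > 0"
  by (simp add: cantor_side_def)

lemma cantor_side_Suc: "cantor_side T (Suc k) = cantor_ratio T * cantor_side T k"
  by (simp add: cantor_side_def cantor_ratio_def powr_add[symmetric] add_divide_distrib algebra_simps)

lemma cantor_ratio_bounds: "0 < cantor_ratio T" "cantor_ratio T < 1 / 2"
proof -
  show "0 < cantor_ratio T" by (simp add: cantor_ratio_def cantor_side_pos)
  have "cantor_ratio T = 2 powr (- ((real CARD('a) + 1) / real CARD('a)))"
    by (simp add: cantor_ratio_def cantor_side_def)
  also have "\<dots> < 2 powr (- 1)"
    by (intro powr_less_mono) (auto simp: field_simps)
  finally show "cantor_ratio T < 1 / 2" by (simp add: powr_minus)
qed

text \<open>The exponent \<open>(N + 1) / N\<close> of the side length is made for this: the N-th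
  power of the side is the reciprocal of the number of cubes of generation \<open>k\<close>, so its
  sum over a whole generation is always 1.\<close>

lemma cantor_side_power:
  "cantor_side TYPE('n::finite) k ^ CARD('n) = (1 / 2 ^ (CARD('n) + 1)) ^ k"
proof -
  have "cantor_side TYPE('n) k ^ CARD('n) = cantor_side TYPE('n) k powr real CARD('n)"
    by (simp add: powr_realpow cantor_side_pos)
  also have "\<dots> = 2 powr (- real (k * (CARD('n) + 1)))"
    by (simp add: cantor_side_def powr_powr) (simp add: algebra_simps)
  also have "\<dots> = 1 / 2 ^ (k * (CARD('n) + 1))"
    by (simp only: powr_minus powr_realpow[of 2] divide_inverse mult_1)
  finally show ?thesis by (simp only: power_divide power_one power_mult[symmetric] mult.commute)
qed

lemma cantor_side_Suc_le: "cantor_side T (Suc k) \<le> cantor_side T k"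
  using cantor_ratio_bounds[of T] cantor_side_pos[of T k] by (simp add: cantor_side_Suc mult_left_le_one_le)

lemma cantor_side_le_1: "cantor_side T k \<le> 1"
proof (induction k)
  case (Suc k)
  then show ?case using cantor_side_Suc_le[of T k] by linarith
qed simp

lemma cantor_side_eq_power: "cantor_side T k = cantor_ratio T ^ k"
  by (induction k) (auto simp: cantor_side_Suc)

lemma mem_axis_cube: "p \<in> axis_cube a s \<longleftrightarrow> (\<forall>b\<in>Basis. a \<bullet> b \<le> p \<bullet> b \<and> p \<bullet> b \<le> a \<bullet> b + s)"
  by (auto simp: axis_cube_def mem_box inner_add_left)

lemma vertex_inner: "v \<in> unit_cube_vertices \<Longrightarrow> b \<in> Basis \<Longrightarrow> v \<bullet> b = 0 \<or> v \<bullet> b = 1"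
  by (simp add: unit_cube_vertices_def)

abbreviation cantor_child :: "nat \<Rightarrow> (real ^ 'n::finite) \<times> real \<Rightarrow> (real ^ 'n) \<times> real \<Rightarrow> (real ^ 'n) \<times> real" where
  "cantor_child k a v \<equiv> a + (cantor_side TYPE('n) k - cantor_side TYPE('n) (Suc k)) *\<^sub>R v"

lemma cantor_child_corner:
  "a \<in> cantor_corners k \<Longrightarrow> v \<in> unit_cube_vertices \<Longrightarrow> cantor_child k a v \<in> cantor_corners (Suc k)"
  unfolding cantor_corners.simps by blast

lemma cantor_child_subset:
  fixes a :: "(real ^ 'n::finite) \<times> real"
  assumes "v \<in> unit_cube_vertices"
  shows "axis_cube (cantor_child k a v) (cantor_side TYPE('n) (Suc k)) \<subseteq> axis_cube a (cantor_side TYPE('n) k)"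
  using axis_cube_in_axis_cube_iff[OF _ _ assms, of "cantor_side TYPE('n) (Suc k)" "cantor_side TYPE('n) k" "cantor_child k a v" a]
    cantor_side_pos[of "TYPE('n)" "Suc k"] cantor_side_Suc_le[of "TYPE('n)" k] by simp

lemma corner_in_axis_cube: "s \<ge> 0 \<Longrightarrow> a \<in> axis_cube a s"
  by (simp add: mem_axis_cube)

text \<open>A vertex is the indicator vector of a set of coordinates; this supplies both finiteness
  and the count \<open>2 ^ DIM('a)\<close>.\<close>

lemma bij_betw_unit_cube_vertices:
  "bij_betw (\<lambda>B. \<Sum>B) (Pow Basis) (unit_cube_vertices :: 'a::euclidean_space set)"
proof -
  have S: "(\<Sum>B) \<bullet> b = (if b \<in> B then 1 else 0)" if "B \<subseteq> Basis" "b \<in> Basis" for B and b :: 'a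
  proof -
    have "(\<Sum>B) \<bullet> b = (\<Sum>c\<in>B. if c = b then 1 else 0)"
      unfolding inner_sum_left using that by (intro sum.cong) (auto simp: inner_Basis)
    then show ?thesis using that finite_subset[OF that(1) finite_Basis] by simp
  qed
  show ?thesis
    unfolding bij_betw_def
  proof
    show "inj_on (\<lambda>B. \<Sum>B) (Pow (Basis::'a set))"
    proof (rule inj_onI)
      fix B C :: "'a set" assume BC: "B \<in> Pow Basis" "C \<in> Pow Basis" "\<Sum>B = \<Sum>C"
      have "b \<in> B \<longleftrightarrow> b \<in> C" if "b \<in> Basis" for b
        using S[of B b] S[of C b] BC that by (auto split: if_splits)
      then show "B = C" using BC by blast
    qed
    show "(\<lambda>B. \<Sum>B) ` Pow Basis = (unit_cube_vertices :: 'a set)"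
    proof
      show "(\<lambda>B. \<Sum>B) ` Pow Basis \<subseteq> (unit_cube_vertices :: 'a set)"
        using S by (auto simp: unit_cube_vertices_def)
      show "(unit_cube_vertices :: 'a set) \<subseteq> (\<lambda>B. \<Sum>B) ` Pow Basis"
      proof
        fix v :: 'a assume v: "v \<in> unit_cube_vertices"
        have "v = \<Sum>{b \<in> Basis. v \<bullet> b = 1}"
          by (rule euclidean_eqI) (use S vertex_inner[OF v] in auto)
        then show "v \<in> (\<lambda>B. \<Sum>B) ` Pow Basis" by blast
      qed
    qed
  qed
qed

lemma finite_unit_cube_vertices: "finite (unit_cube_vertices :: 'a::euclidean_space set)"
  using bij_betw_finite[OF bij_betw_unit_cube_vertices[where 'a='a]] by simp

lemma card_unit_cube_vertices: "card (unit_cube_vertices :: 'a::euclidean_space set) = 2 ^ DIM('a)"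
  using bij_betw_same_card[OF bij_betw_unit_cube_vertices[where 'a='a]] by (simp add: card_Pow)

lemma finite_cantor_corners: "finite (cantor_corners k :: ((real ^ 'n::finite) \<times> real) set)"
proof (induction k)
  case (Suc k)
  then show ?case
    using finite_image_set2[of "\<lambda>a. a \<in> cantor_corners k" "\<lambda>v. v \<in> unit_cube_vertices" "cantor_child k"]
      finite_unit_cube_vertices by simp
qed simp

lemma compact_cantor_set: "compact (cantor_set :: ((real ^ 'n::finite) \<times> real) set)"
proof -
  have c: "compact (\<Union> (cantor_cubes k :: ((real ^ 'n) \<times> real) set set))" for k
    unfolding cantor_cubes_def using finite_cantor_corners
    by (intro compact_Union) (auto simp: axis_cube_def)
  show ?thesis
    unfolding cantor_set_def
    by (intro compact_Inter) (auto intro: c)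
qed

text \<open>Siblings differ by exactly \<open>d\<close> in some coordinate. Corners with different
  parents inherit the separation of the parents minus at most \<open>d\<close>, the range of
  positions inside a parent, and what remains is still at least \<open>d\<close>.\<close>

lemma cantor_corners_separated:
  assumes "a \<in> cantor_corners k" "a' \<in> cantor_corners k" "a \<noteq> (a' :: (real ^ 'n::finite) \<times> real)"
  shows "\<exists>b\<in>Basis. \<bar>(a - a') \<bullet> b\<bar> \<ge> (1 / cantor_ratio TYPE('n) - 1) * cantor_side TYPE('n) k"
  using assms
proof (induction k arbitrary: a a')
  case 0
  then show ?case by simp
next
  case (Suc k)
  let ?r = "cantor_ratio TYPE('n)" and ?l = "cantor_side TYPE('n) k"
  have r: "0 < ?r" "?r < 1 / 2" by (rule cantor_ratio_bounds)+
  have l: "?l > 0" by (rule cantor_side_pos)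
  obtain c v where a: "a = cantor_child k c v" "c \<in> cantor_corners k" "v \<in> unit_cube_vertices"
    using Suc.prems(1) by auto
  obtain c' v' where a': "a' = cantor_child k c' v'" "c' \<in> cantor_corners k" "v' \<in> unit_cube_vertices"
    using Suc.prems(2) by auto
  define d where "d = ?l - cantor_side TYPE('n) (Suc k)"
  have d: "d = (1 - ?r) * ?l" by (simp add: d_def cantor_side_Suc algebra_simps)
  have d0: "d > 0" using r l by (simp add: d)
  have target: "(1 / ?r - 1) * cantor_side TYPE('n) (Suc k) = d"
    using r by (simp add: cantor_side_Suc d field_simps)
  have diff: "(a - a') \<bullet> b = (c - c') \<bullet> b + d * ((v - v') \<bullet> b)" for b
    by (simp add: a(1) a'(1) d_def[symmetric] inner_diff_left inner_add_left algebra_simps)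
  show ?case
  proof (cases "c = c'")
    case False
    then obtain b where b: "b \<in> Basis" "\<bar>(c - c') \<bullet> b\<bar> \<ge> (1 / ?r - 1) * ?l"
      using Suc.IH[OF a(2) a'(2)] by blast
    have "\<bar>(v - v') \<bullet> b\<bar> \<le> 1"
      using vertex_inner[OF a(3) b(1)] vertex_inner[OF a'(3) b(1)] by (auto simp: inner_diff_left)
    then have "\<bar>d * ((v - v') \<bullet> b)\<bar> \<le> d"
      using d0 by (simp add: abs_mult mult_left_le)
    then have "\<bar>(a - a') \<bullet> b\<bar> \<ge> (1 / ?r - 1) * ?l - d"
      using b(2) unfolding diff by linarith
    moreover have "(1 / ?r - 1) * ?l - d \<ge> d"
    proof -
      \<comment> \<open>The remaining inequality factors into this product, which is nonnegative
        because the contraction ratio is below 1/2.\<close>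
      have "0 \<le> (1 - ?r) * (1 - 2 * ?r)" using r by (intro mult_nonneg_nonneg) auto
      also have "\<dots> = ((1 / ?r - 1) - 2 * (1 - ?r)) * ?r" using r by (simp add: field_simps power2_eq_square)
      finally have "0 \<le> (1 / ?r - 1) - 2 * (1 - ?r)" using r by (simp add: zero_le_mult_iff)
      then have "0 \<le> ((1 / ?r - 1) - 2 * (1 - ?r)) * ?l" using l by (intro mult_nonneg_nonneg) auto
      then show ?thesis by (simp add: d algebra_simps)
    qed
    ultimately show ?thesis using b(1) target by (intro bexI[of _ b]) auto
  next
    case True
    then have "v \<noteq> v'" using Suc.prems(3) a(1) a'(1) by auto
    then obtain b where b: "b \<in> Basis" "v \<bullet> b \<noteq> v' \<bullet> b" using euclidean_eqI by blast
    have "\<bar>(v - v') \<bullet> b\<bar> = 1"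
      using vertex_inner[OF a(3) b(1)] vertex_inner[OF a'(3) b(1)] b(2) by (auto simp: inner_diff_left)
    then have "\<bar>(a - a') \<bullet> b\<bar> = d" using True d0 unfolding diff by (simp add: abs_mult)
    then show ?thesis using b(1) target by (intro bexI[of _ b]) auto
  qed
qed

text \<open>In units of the side of a child the parent has side \<open>1 / cantor_ratio T\<close>;
  the two children along an edge leave this much between them.\<close>

definition cantor_gap :: "'n::finite itself \<Rightarrow> real" where
  "cantor_gap T = 1 / cantor_ratio T - 2"

lemma cantor_gap_pos: "cantor_gap T > 0"
  using cantor_ratio_bounds[of T] by (simp add: cantor_gap_def field_simps)

lemma cantor_cubes_separated:
  assumes "a \<in> cantor_corners k" "a' \<in> cantor_corners k" "a \<noteq> (a' :: (real ^ 'n::finite) \<times> real)"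
    and p: "p \<in> axis_cube a (cantor_side TYPE('n) k)"
  shows "\<exists>b\<in>Basis. (p - a') \<bullet> b \<le> - (cantor_gap TYPE('n) * cantor_side TYPE('n) k)
     \<or> (p - a') \<bullet> b \<ge> (1 + cantor_gap TYPE('n)) * cantor_side TYPE('n) k"
proof -
  let ?l = "cantor_side TYPE('n) k"
  obtain b where b: "b \<in> Basis" "\<bar>(a - a') \<bullet> b\<bar> \<ge> (1 / cantor_ratio TYPE('n) - 1) * ?l"
    using cantor_corners_separated[OF assms(1-3)] by blast
  have "(1 / cantor_ratio TYPE('n) - 1) * ?l = (1 + cantor_gap TYPE('n)) * ?l"
    by (simp add: cantor_gap_def)
  with b(2) have "(a - a') \<bullet> b \<le> - ((1 + cantor_gap TYPE('n)) * ?l) \<or> (a - a') \<bullet> b \<ge> (1 + cantor_gap TYPE('n)) * ?l"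
    by linarith
  moreover have "(p - a') \<bullet> b \<ge> (a - a') \<bullet> b" "(p - a') \<bullet> b \<le> (a - a') \<bullet> b + ?l"
    using p b(1) by (auto simp: mem_axis_cube inner_diff_left)
  ultimately show ?thesis using b(1) by (intro bexI[of _ b]) (auto simp: distrib_right)
qed

lemma cantor_cubes_distance:
  assumes "a \<in> cantor_corners k" "a' \<in> cantor_corners k" "a \<noteq> (a' :: (real ^ 'n::finite) \<times> real)"
    and "p \<in> axis_cube a (cantor_side TYPE('n) k)" "q \<in> axis_cube a' (cantor_side TYPE('n) k)"
  shows "norm (p - q) \<ge> cantor_gap TYPE('n) * cantor_side TYPE('n) k"
proof -
  obtain b where b: "b \<in> Basis" "(p - a') \<bullet> b \<le> - (cantor_gap TYPE('n) * cantor_side TYPE('n) k)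
     \<or> (p - a') \<bullet> b \<ge> (1 + cantor_gap TYPE('n)) * cantor_side TYPE('n) k"
    using cantor_cubes_separated[OF assms(1-4)] by blast
  moreover have "0 \<le> (q - a') \<bullet> b" "(q - a') \<bullet> b \<le> cantor_side TYPE('n) k"
    using assms(5) b(1) by (auto simp: mem_axis_cube inner_diff_left)
  moreover have "(p - q) \<bullet> b = (p - a') \<bullet> b - (q - a') \<bullet> b" by (simp add: inner_diff_left)
  ultimately have "\<bar>(p - q) \<bullet> b\<bar> \<ge> cantor_gap TYPE('n) * cantor_side TYPE('n) k"
    by (auto simp: distrib_right)
  then show ?thesis using Basis_le_norm[OF b(1), of "p - q"] by linarith
qed

lemma cantor_set_cube:
  assumes "p \<in> (cantor_set :: ((real ^ 'n::finite) \<times> real) set)"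
  obtains a where "a \<in> cantor_corners k" "p \<in> axis_cube a (cantor_side TYPE('n) k)"
  using assms unfolding cantor_set_def cantor_cubes_def by blast

subsection \<open>Cut-off functions of the cubes\<close>

text \<open>Relative to the side of the cube, the bump is 1 up to a quarter of the gap and 0 from
  half the gap on. It is thus already 0 well before the neighbouring cubes begin.\<close>

definition cantor_bump :: "nat \<Rightarrow> (real ^ 'n::finite) \<times> real \<Rightarrow> (real ^ 'n) \<times> real \<Rightarrow> complex" where
  "cantor_bump k a p = of_real (cube_bump (cantor_gap TYPE('n) / 4) ((1 / cantor_side TYPE('n) k) *\<^sub>R (p - a)))"

lemma cantor_bump_smooth: "smooth_upto j UNIV (cantor_bump k a :: (real ^ 'n::finite) \<times> real \<Rightarrow> complex)"
proof -
  let ?c = "1 / cantor_side TYPE('n) k"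
  have "smooth_upto j UNIV (\<lambda>p::(real ^ 'n) \<times> real. cube_bump (cantor_gap TYPE('n) / 4) (- (?c *\<^sub>R a) + ?c *\<^sub>R p))"
    by (rule smooth_upto_compose_affine[OF open_UNIV bounded_linear_scaleR_right smooth_upto_cube_bump]) auto
  then have "smooth_upto j UNIV (\<lambda>p::(real ^ 'n) \<times> real. complex_of_real (cube_bump (cantor_gap TYPE('n) / 4) (- (?c *\<^sub>R a) + ?c *\<^sub>R p)))"
    by (intro smooth_upto_of_real) auto
  moreover have "cantor_bump k a = (\<lambda>p::(real ^ 'n) \<times> real. complex_of_real (cube_bump (cantor_gap TYPE('n) / 4) (- (?c *\<^sub>R a) + ?c *\<^sub>R p)))"
    by (intro ext) (simp add: cantor_bump_def scaleR_diff_right)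
  ultimately show ?thesis by simp
qed

definition cantor_bump_box :: "nat \<Rightarrow> (real ^ 'n::finite) \<times> real \<Rightarrow> ((real ^ 'n) \<times> real) set" where
  "cantor_bump_box k a = cbox (a - (cantor_gap TYPE('n) / 2 * cantor_side TYPE('n) k) *\<^sub>R One)
     (a + ((1 + cantor_gap TYPE('n) / 2) * cantor_side TYPE('n) k) *\<^sub>R One)"

lemma cantor_bump_eq_0:
  assumes "b \<in> Basis" and "(p - a) \<bullet> b \<le> - (cantor_gap TYPE('n) / 2 * cantor_side TYPE('n) k)
     \<or> (p - a) \<bullet> b \<ge> (1 + cantor_gap TYPE('n) / 2) * cantor_side TYPE('n) k"
  shows "cantor_bump k a (p :: (real ^ 'n::finite) \<times> real) = 0"
proof -
  have l: "cantor_side TYPE('n) k > 0" by (rule cantor_side_pos)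
  have "cube_bump (cantor_gap TYPE('n) / 4) ((1 / cantor_side TYPE('n) k) *\<^sub>R (p - a)) = 0"
  proof (rule cube_bump_eq_0[OF _ assms(1)])
    have e: "((1 / cantor_side TYPE('n) k) *\<^sub>R (p - a)) \<bullet> b = ((p - a) \<bullet> b) / cantor_side TYPE('n) k" by simp
    show "((1 / cantor_side TYPE('n) k) *\<^sub>R (p - a)) \<bullet> b \<le> - 2 * (cantor_gap TYPE('n) / 4)
        \<or> ((1 / cantor_side TYPE('n) k) *\<^sub>R (p - a)) \<bullet> b \<ge> 1 + 2 * (cantor_gap TYPE('n) / 4)"
      using assms(2) l unfolding e by (auto simp: field_simps)
  qed (use cantor_gap_pos[of "TYPE('n)"] in simp)
  then show ?thesis by (simp add: cantor_bump_def)
qed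

lemma cantor_bump_outside:
  assumes "p \<notin> cantor_bump_box k a"
  shows "cantor_bump k a (p :: (real ^ 'n::finite) \<times> real) = 0"
proof -
  let ?g = "cantor_gap TYPE('n) / 2 * cantor_side TYPE('n) k" and ?h = "(1 + cantor_gap TYPE('n) / 2) * cantor_side TYPE('n) k"
  obtain b where b: "b \<in> Basis" "\<not> ((a - ?g *\<^sub>R One) \<bullet> b \<le> p \<bullet> b \<and> p \<bullet> b \<le> (a + ?h *\<^sub>R One) \<bullet> b)"
    using assms unfolding cantor_bump_box_def mem_box by blast
  moreover have "One \<bullet> b = 1" using b(1) by simp
  ultimately have "(p - a) \<bullet> b \<le> - ?g \<or> (p - a) \<bullet> b \<ge> ?h"
    unfolding inner_add_left inner_diff_left inner_scaleR_left by auto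
  then show ?thesis by (rule cantor_bump_eq_0[OF b(1)])
qed

lemma cantor_bump_test_function: "test_function_on UNIV (cantor_bump k a)"
proof (rule test_functionI[OF cantor_bump_smooth cantor_bump_outside])
  show "compact (cantor_bump_box k a)" unfolding cantor_bump_box_def by (rule compact_cbox)
qed

lemma eventually_nhds_open: "open S \<Longrightarrow> p \<in> S \<Longrightarrow> (\<And>q. q \<in> S \<Longrightarrow> P q) \<Longrightarrow> eventually P (nhds p)"
  by (auto simp: eventually_nhds)

text \<open>A point of the Cantor set lies either in the cube, around which the bump is 1, or in
  another cube of the generation, a full gap away while the bump ends at half the gap. Such local
  constancy turns inclusions between cubes into identities between bumps near the set.\<close>

lemma cantor_bump_near:
  fixes a p :: "(real ^ 'n::finite) \<times> real"
  assumes a: "a \<in> cantor_corners k" and p: "p \<in> cantor_set"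
  shows "eventually (\<lambda>q. cantor_bump k a q = (if p \<in> axis_cube a (cantor_side TYPE('n) k) then 1 else 0)) (nhds p)"
proof -
  let ?l = "cantor_side TYPE('n) k" and ?g = "cantor_gap TYPE('n)"
  have l: "?l > 0" by (rule cantor_side_pos)
  have g: "?g > 0" by (rule cantor_gap_pos)
  have gl: "?g * ?l > 0" using g l by simp
  show ?thesis
  proof (cases "p \<in> axis_cube a ?l")
    case True
    show ?thesis
    proof (rule eventually_nhds_open[of "ball p (?g / 4 * ?l)"])
      fix q assume q: "q \<in> ball p (?g / 4 * ?l)"
      have "cube_bump (?g / 4) ((1 / ?l) *\<^sub>R (q - a)) = 1"
      proof (rule cube_bump_eq_1)
        fix b :: "(real ^ 'n) \<times> real" assume b: "b \<in> Basis"
        have "\<bar>(q - p) \<bullet> b\<bar> \<le> ?g / 4 * ?l"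
          using Basis_le_norm[OF b, of "q - p"] q by (simp add: dist_norm norm_minus_commute)
        moreover have "0 \<le> (p - a) \<bullet> b" "(p - a) \<bullet> b \<le> ?l"
          using True b by (auto simp: mem_axis_cube inner_diff_left)
        moreover have "(q - a) \<bullet> b = (q - p) \<bullet> b + (p - a) \<bullet> b" by (simp add: inner_diff_left)
        ultimately have "- (?g / 4 * ?l) \<le> (q - a) \<bullet> b" "(q - a) \<bullet> b \<le> ?l + ?g / 4 * ?l" by linarith+
        then show "- (?g / 4) \<le> (1 / ?l) *\<^sub>R (q - a) \<bullet> b \<and> (1 / ?l) *\<^sub>R (q - a) \<bullet> b \<le> 1 + ?g / 4"
        proof -
          have e: "((1 / ?l) *\<^sub>R (q - a)) \<bullet> b = ((q - a) \<bullet> b) / ?l" by simp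
          show ?thesis
            unfolding e using l \<open>- (?g / 4 * ?l) \<le> (q - a) \<bullet> b\<close> \<open>(q - a) \<bullet> b \<le> ?l + ?g / 4 * ?l\<close>
            by (simp add: field_simps)
        qed
      qed (use g in simp)
      then show "cantor_bump k a q = (if p \<in> axis_cube a ?l then 1 else 0)"
        using True by (simp add: cantor_bump_def)
    qed (use gl in auto)
  next
    case False
    obtain a' where a': "a' \<in> cantor_corners k" "p \<in> axis_cube a' ?l" using cantor_set_cube[OF p] by blast
    then have "a' \<noteq> a" using False by blast
    then obtain b where b: "b \<in> Basis" "(p - a) \<bullet> b \<le> - (?g * ?l) \<or> (p - a) \<bullet> b \<ge> (1 + ?g) * ?l"
      using cantor_cubes_separated[OF a'(1) a _ a'(2)] by blast
    show ?thesis
    proof (rule eventually_nhds_open[of "ball p (?g / 2 * ?l)"])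
      fix q assume q: "q \<in> ball p (?g / 2 * ?l)"
      have "\<bar>(q - p) \<bullet> b\<bar> \<le> ?g / 2 * ?l"
        using Basis_le_norm[OF b(1), of "q - p"] q by (simp add: dist_norm norm_minus_commute)
      moreover have "(q - a) \<bullet> b = (q - p) \<bullet> b + (p - a) \<bullet> b" by (simp add: inner_diff_left)
      moreover have "(1 + ?g) * ?l = ?l + ?g * ?l" "(1 + ?g / 2) * ?l = ?l + ?g / 2 * ?l" "?g * ?l = ?g / 2 * ?l + ?g / 2 * ?l"
        by (simp_all add: algebra_simps)
      ultimately have "(q - a) \<bullet> b \<le> - (?g / 2 * ?l) \<or> (q - a) \<bullet> b \<ge> (1 + ?g / 2) * ?l"
        using b(2) by linarith
      then show "cantor_bump k a q = (if p \<in> axis_cube a ?l then 1 else 0)"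
        using False cantor_bump_eq_0[OF b(1)] by simp
    qed (use gl in auto)
  qed
qed

lemma cantor_bump_0_near: "p \<in> cantor_set \<Longrightarrow> eventually (\<lambda>q. cantor_bump 0 0 q = 1) (nhds p)"
proof -
  assume p: "p \<in> cantor_set"
  obtain a where "a \<in> cantor_corners 0" "p \<in> axis_cube a (cantor_side TYPE('a) 0)" using cantor_set_cube[OF p] by blast
  then show ?thesis using cantor_bump_near[of 0 0 p] p by simp
qed

text \<open>Near \<open>p\<close> all bumps involved are constants 0 or 1, so the identity reduces
  to counting: a point of the Cantor set that lies in a cube lies in exactly one of its
  children.\<close>

lemma cantor_bump_children_near:
  fixes a p :: "(real ^ 'n::finite) \<times> real"
  assumes a: "a \<in> cantor_corners k" and p: "p \<in> cantor_set"
  shows "eventually (\<lambda>q. cantor_bump k a q = (\<Sum>v\<in>unit_cube_vertices. cantor_bump (Suc k) (cantor_child k a v) q)) (nhds p)"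
proof -
  let ?V = "unit_cube_vertices :: ((real ^ 'n) \<times> real) set"
  let ?Q = "\<lambda>v. axis_cube (cantor_child k a v) (cantor_side TYPE('n) (Suc k))"
  have "eventually (\<lambda>q. \<forall>v\<in>?V. cantor_bump (Suc k) (cantor_child k a v) q = (if p \<in> ?Q v then 1 else 0)) (nhds p)"
    by (intro eventually_ball_finite finite_unit_cube_vertices ballI cantor_bump_near[OF cantor_child_corner[OF a] p])
  moreover have "(\<Sum>v\<in>?V. if p \<in> ?Q v then 1 else 0) = (if p \<in> axis_cube a (cantor_side TYPE('n) k) then 1 else (0::complex))"
  proof (cases "p \<in> axis_cube a (cantor_side TYPE('n) k)")
    case False
    then have "p \<notin> ?Q v" if "v \<in> ?V" for v using cantor_child_subset[OF that, where k=k and a=a] by blast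
    then show ?thesis using False by simp
  next
    case True
    obtain c where c: "c \<in> cantor_corners (Suc k)" "p \<in> axis_cube c (cantor_side TYPE('n) (Suc k))"
      using cantor_set_cube[OF p] by blast
    then obtain a' v where a': "a' \<in> cantor_corners k" "v \<in> ?V" "c = cantor_child k a' v" by auto
    have "p \<in> axis_cube a' (cantor_side TYPE('n) k)"
      using cantor_child_subset[OF a'(2), where k=k and a=a'] c(2) a'(3) by blast
    have disj: "a1 = a2" if "a1 \<in> cantor_corners j" "a2 \<in> cantor_corners j" "p \<in> axis_cube a1 (cantor_side TYPE('n) j)" "p \<in> axis_cube a2 (cantor_side TYPE('n) j)" for a1 a2 j
      using cantor_cubes_distance[OF that(1,2) _ that(3,4)] mult_pos_pos[OF cantor_gap_pos[of "TYPE('n)"] cantor_side_pos[of "TYPE('n)" j]] by force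
    have "a' = a" using disj[OF a'(1) a \<open>p \<in> axis_cube a' _\<close> True] .
    have "p \<in> ?Q w \<longleftrightarrow> w = v" if "w \<in> ?V" for w
    proof
      assume "p \<in> ?Q w"
      then have "cantor_child k a w = c"
        using disj[OF cantor_child_corner[OF a that] c(1) _ c(2)] by blast
      then have "(cantor_side TYPE('n) k - cantor_side TYPE('n) (Suc k)) *\<^sub>R w = (cantor_side TYPE('n) k - cantor_side TYPE('n) (Suc k)) *\<^sub>R v"
        using a'(3) \<open>a' = a\<close> by simp
      moreover have "cantor_side TYPE('n) k - cantor_side TYPE('n) (Suc k) \<noteq> 0"
      proof -
        show ?thesis
          using cantor_side_pos[of "TYPE('n)" k] cantor_ratio_bounds[of "TYPE('n)"] by (auto simp: cantor_side_Suc)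
      qed
      ultimately show "w = v" by simp
    next
      assume "w = v"
      then show "p \<in> ?Q w" using c(2) a'(3) \<open>a' = a\<close> by simp
    qed
    then have "(\<Sum>w\<in>?V. if p \<in> ?Q w then 1 else 0) = (\<Sum>w\<in>?V. if w = v then 1 else (0::complex))"
      by (intro sum.cong) auto
    then show ?thesis using True a'(2) finite_unit_cube_vertices[where 'a="(real ^ 'n) \<times> real"] by simp
  qed
  ultimately show ?thesis
    using cantor_bump_near[OF a p] by (elim eventually_rev_mp) (auto intro!: always_eventually)
qed

text \<open>Vanishing near each point of \<open>E\<close>, and not just on \<open>E\<close>, is what
  keeps the closed support away from \<open>E\<close>.\<close>

lemma test_function_off_cantor_set:
  assumes "test_function_on UNIV \<phi>" "\<And>p. p \<in> E \<Longrightarrow> eventually (\<lambda>q. \<phi> q = 0) (nhds p)"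
  shows "test_function_on (- E) \<phi>"
proof -
  have "closure {x. \<phi> x \<noteq> 0} \<subseteq> - E"
  proof
    fix p assume p: "p \<in> closure {x. \<phi> x \<noteq> 0}"
    show "p \<in> - E"
    proof
      assume "p \<in> E"
      from assms(2)[OF this] obtain S where S: "open S" "p \<in> S" "\<forall>q\<in>S. \<phi> q = 0"
        unfolding eventually_nhds by blast
      then have "S \<inter> {x. \<phi> x \<noteq> 0} = {}" by auto
      then show False using open_Int_closure_eq_empty[OF S(1)] S(2) p by auto
    qed
  qed
  then show ?thesis using assms(1) by (simp add: test_function_on_iff)
qed

subsection \<open>Sums over descendants\<close>

text \<open>\<open>tree_sum k j F a\<close> is the sum of \<open>F\<close> over the corners of generation \<open>k + j\<close> below the corner \<open>a\<close>
  of generation \<open>k\<close>.\<close>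
fun tree_sum :: "nat \<Rightarrow> nat \<Rightarrow> ((real ^ 'n::finite) \<times> real \<Rightarrow> 'c::comm_monoid_add) \<Rightarrow> (real ^ 'n) \<times> real \<Rightarrow> 'c" where
  "tree_sum k 0 F a = F a"
| "tree_sum k (Suc j) F a = (\<Sum>v\<in>unit_cube_vertices. tree_sum (Suc k) j F (cantor_child k a v))"

text \<open>Stated for an arbitrary relation compatible with addition, so that equality, comparison
  and the triangle inequality for sums over descendants are instances of one induction.\<close>

lemma tree_sum_induct:
  fixes F :: "(real ^ 'n::finite) \<times> real \<Rightarrow> 'c::comm_monoid_add" and G :: "(real ^ 'n) \<times> real \<Rightarrow> 'd::comm_monoid_add"
  assumes R0: "R 0 0" and Radd: "\<And>x y u v. R x u \<Longrightarrow> R y v \<Longrightarrow> R (x + y) (u + v)"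
    and a: "a \<in> cantor_corners k"
    and FG: "\<And>q. q \<in> cantor_corners (k + j) \<Longrightarrow> q \<in> axis_cube a (cantor_side TYPE('n) k) \<Longrightarrow> R (F q) (G q)"
  shows "R (tree_sum k j F a) (tree_sum k j G a)"
  using a FG
proof (induction j arbitrary: k a)
  case 0
  have "a \<in> axis_cube a (cantor_side TYPE('n) k)"
    by (rule corner_in_axis_cube[OF less_imp_le[OF cantor_side_pos]])
  then show ?case using 0(2)[of a] 0(1) by simp
next
  case (Suc j)
  have "R (\<Sum>v\<in>V. tree_sum (Suc k) j F (cantor_child k a v)) (\<Sum>v\<in>V. tree_sum (Suc k) j G (cantor_child k a v))"
    if "finite V" "V \<subseteq> unit_cube_vertices" for V
    using that
  proof (induction V)
    case (insert v V)
    have "R (tree_sum (Suc k) j F (cantor_child k a v)) (tree_sum (Suc k) j G (cantor_child k a v))"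
    proof (rule Suc.IH[OF cantor_child_corner[OF Suc.prems(1)]])
      show "R (F q) (G q)" if "q \<in> cantor_corners (Suc k + j)"
        "q \<in> axis_cube (cantor_child k a v) (cantor_side TYPE('n) (Suc k))" for q
        using that insert.prems cantor_child_subset[where v=v and k=k and a=a] by (intro Suc.prems(2)) auto
    qed (use insert.prems in auto)
    then show ?case using insert by (simp add: Radd)
  qed (simp add: R0)
  from this[OF finite_unit_cube_vertices] show ?case by simp
qed

lemma tree_sum_cong:
  fixes F :: "(real ^ 'n::finite) \<times> real \<Rightarrow> 'c::comm_monoid_add"
  assumes "a \<in> cantor_corners k"
    "\<And>q. q \<in> cantor_corners (k + j) \<Longrightarrow> q \<in> axis_cube a (cantor_side TYPE('n) k) \<Longrightarrow> F q = G q"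
  shows "tree_sum k j F a = tree_sum k j G a"
  by (rule tree_sum_induct[where R="(=)"]) (use assms in auto)

lemma tree_sum_mono:
  fixes F :: "(real ^ 'n::finite) \<times> real \<Rightarrow> real"
  assumes "a \<in> cantor_corners k"
    "\<And>q. q \<in> cantor_corners (k + j) \<Longrightarrow> q \<in> axis_cube a (cantor_side TYPE('n) k) \<Longrightarrow> F q \<le> G q"
  shows "tree_sum k j F a \<le> tree_sum k j G a"
  by (rule tree_sum_induct[where R="(\<le>)"]) (use assms in auto)

lemma tree_sum_norm_le:
  fixes F :: "(real ^ 'n::finite) \<times> real \<Rightarrow> complex"
  assumes "a \<in> cantor_corners k"
    "\<And>q. q \<in> cantor_corners (k + j) \<Longrightarrow> q \<in> axis_cube a (cantor_side TYPE('n) k) \<Longrightarrow> norm (F q) \<le> G q"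
  shows "norm (tree_sum k j F a) \<le> tree_sum k j G a"
  by (rule tree_sum_induct[where R="\<lambda>x u. norm x \<le> u"]) (use assms in \<open>auto intro: norm_triangle_mono\<close>)

lemma tree_sum_diff: "tree_sum k j (\<lambda>q. F q - G q) a = tree_sum k j F a - (tree_sum k j G a :: 'c::ab_group_add)"
  by (induction j arbitrary: k a) (auto simp: sum_subtractf)

lemma tree_sum_cmult: "tree_sum k j (\<lambda>q. c * F q) a = c * (tree_sum k j F a :: 'c::semiring_0)"
  by (induction j arbitrary: k a) (auto simp: sum_distrib_left)

lemma tree_sum_Re: "Re (tree_sum k j F a) = tree_sum k j (\<lambda>q. Re (F q)) a"
  by (induction j arbitrary: k a) auto

lemma tree_sum_const:
  "tree_sum k j (\<lambda>q. c) (a :: (real ^ 'n::finite) \<times> real) = (2 ^ (CARD('n) + 1)) ^ j * (c :: real)"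
proof (induction j arbitrary: k a)
  case (Suc j)
  have "card (unit_cube_vertices :: ((real ^ 'n) \<times> real) set) = 2 ^ (CARD('n) + 1)"
    by (simp add: card_unit_cube_vertices)
  then show ?case unfolding tree_sum.simps(2) Suc.IH by (simp del: power_Suc add: power_Suc[of _ j])
qed simp

lemma tree_sum_additive:
  fixes \<nu> :: "nat \<Rightarrow> (real ^ 'n::finite) \<times> real \<Rightarrow> 'c::comm_monoid_add"
  assumes "\<And>k a. a \<in> cantor_corners k \<Longrightarrow> \<nu> k a = (\<Sum>v\<in>unit_cube_vertices. \<nu> (Suc k) (cantor_child k a v))"
    and "a \<in> cantor_corners k"
  shows "tree_sum k j (\<nu> (k + j)) a = \<nu> k a"
  using assms(2)
proof (induction j arbitrary: k a)
  case (Suc j)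
  have "tree_sum (Suc k) j (\<nu> (k + Suc j)) (cantor_child k a v) = \<nu> (Suc k) (cantor_child k a v)" if "v \<in> unit_cube_vertices" for v
    using Suc.IH[OF cantor_child_corner[OF Suc.prems that]] by simp
  then show ?case unfolding tree_sum.simps(2) assms(1)[OF Suc.prems] by (intro sum.cong) auto
qed simp

section \<open>The distribution on the cubes\<close>

lemma cantor_bump_rescale: "cantor_bump k a p = cantor_bump 0 0 ((1 / cantor_side TYPE('n) k) *\<^sub>R (p - a))"
  for p :: "(real ^ 'n::finite) \<times> real"
  by (simp add: cantor_bump_def)

lemma cantor_bump_norm: "norm (cantor_bump k a (p :: (real ^ 'n::finite) \<times> real)) \<le> 1"
  using cube_bump_range[of "cantor_gap TYPE('n) / 4" "(1 / cantor_side TYPE('n) k) *\<^sub>R (p - a)"]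
  by (simp add: cantor_bump_def)

text \<open>All bumps are translated dilations of \<open>cantor_bump 0 0\<close>, so its constants
  serve every generation once lengths are divided by the side.\<close>

lemma cantor_bump_estimates:
  obtains L C where "L \<ge> 0" "C \<ge> 0"
    "\<And>k (a :: (real ^ 'n::finite) \<times> real) p q. norm (cantor_bump k a p - cantor_bump k a q) \<le> L * (norm (p - q) / cantor_side TYPE('n) k)"
    "\<And>k (a :: (real ^ 'n) \<times> real) p v. norm (frechet_derivative (cantor_bump k a) (at p) v) \<le> L * (norm v / cantor_side TYPE('n) k)"
    "\<And>k (a :: (real ^ 'n) \<times> real) p h. norm (second_diff (cantor_bump k a) h p) \<le> C * (norm h / cantor_side TYPE('n) k)\<^sup>2"
proof -
  let ?X = "cantor_bump 0 0 :: (real ^ 'n) \<times> real \<Rightarrow> complex"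
  have t: "test_function_on UNIV ?X" by (rule cantor_bump_test_function)
  obtain L where L: "L \<ge> 0" "\<And>x y. norm (?X x - ?X y) \<le> L * norm (x - y)"
    "\<And>x v. norm (frechet_derivative ?X (at x) v) \<le> L * norm v"
    using test_function_lipschitz[OF t] by metis
  obtain C where C: "C \<ge> 0" "\<And>x h. norm (second_diff ?X h x) \<le> C * (norm h)\<^sup>2"
    using test_function_second_difference[OF t] by metis
  have n: "norm ((1 / cantor_side TYPE('n) k) *\<^sub>R v) = norm v / cantor_side TYPE('n) k" for k and v :: "(real ^ 'n) \<times> real"
    using cantor_side_pos[of "TYPE('n)" k] by simp
  show ?thesis
  proof (rule that[OF L(1) C(1)])
    fix k and a p :: "(real ^ 'n) \<times> real"
    let ?c = "1 / cantor_side TYPE('n) k"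
    show "norm (cantor_bump k a p - cantor_bump k a q) \<le> L * (norm (p - q) / cantor_side TYPE('n) k)" for q
    proof -
      have "?c *\<^sub>R (p - a) - ?c *\<^sub>R (q - a) = ?c *\<^sub>R (p - q)" by (simp add: scaleR_diff_right[symmetric])
      then show ?thesis
        using L(2)[of "?c *\<^sub>R (p - a)" "?c *\<^sub>R (q - a)"] by (simp only: cantor_bump_rescale[of k a] n)
    qed
    show "norm (frechet_derivative (cantor_bump k a) (at p) v) \<le> L * (norm v / cantor_side TYPE('n) k)" for v
    proof -
      have "((\<lambda>p. ?X (?c *\<^sub>R (p - a))) has_derivative (\<lambda>v. frechet_derivative ?X (at (?c *\<^sub>R (p - a))) (?c *\<^sub>R v))) (at p)"
        by (rule has_derivative_compose[of "\<lambda>p. ?c *\<^sub>R (p - a)", OF _ test_function_has_derivative[OF t]])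
          (auto intro!: derivative_eq_intros)
      then have "(cantor_bump k a has_derivative (\<lambda>v. frechet_derivative ?X (at (?c *\<^sub>R (p - a))) (?c *\<^sub>R v))) (at p)"
        by (simp only: cantor_bump_rescale[of k a, symmetric])
      from frechet_derivative_at[OF this]
      have "frechet_derivative (cantor_bump k a) (at p) v = frechet_derivative ?X (at (?c *\<^sub>R (p - a))) (?c *\<^sub>R v)" by metis
      then show ?thesis using L(3)[of "?c *\<^sub>R (p - a)" "?c *\<^sub>R v"] by (simp only: n)
    qed
    show "norm (second_diff (cantor_bump k a) h p) \<le> C * (norm h / cantor_side TYPE('n) k)\<^sup>2" for h
    proof -
      have "?c *\<^sub>R (p + h - a) = ?c *\<^sub>R (p - a) + ?c *\<^sub>R h" "?c *\<^sub>R (p - h - a) = ?c *\<^sub>R (p - a) - ?c *\<^sub>R h"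
        by (simp_all add: scaleR_diff_right scaleR_add_right)
      then show ?thesis
        using C(2)[where x="?c *\<^sub>R (p - a)" and h="?c *\<^sub>R h"] by (simp only: cantor_bump_rescale[of k a] n)
    qed
  qed
qed

lemma emeasure_cantor_bump_box:
  "emeasure lborel (cantor_bump_box k (a :: (real ^ 'n::finite) \<times> real))
    = ennreal (((1 + cantor_gap TYPE('n)) * cantor_side TYPE('n) k) ^ (CARD('n) + 1))"
proof -
  let ?g = "cantor_gap TYPE('n)" and ?l = "cantor_side TYPE('n) k"
  let ?u = "a - (?g / 2 * ?l) *\<^sub>R One" and ?w = "a + ((1 + ?g / 2) * ?l) *\<^sub>R One"
  have d: "(?w - ?u) \<bullet> b = (1 + ?g) * ?l" if "b \<in> Basis" for b
  proof -
    have "One \<bullet> b = 1" using that by simp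
    then show ?thesis by (simp only: inner_diff_left inner_add_left inner_scaleR_left) (simp add: algebra_simps)
  qed
  have pos: "(1 + ?g) * ?l > 0" using cantor_gap_pos[of "TYPE('n)"] cantor_side_pos[of "TYPE('n)" k] by simp
  have "emeasure lborel (cbox ?u ?w) = ennreal (\<Prod>b\<in>Basis. (?w - ?u) \<bullet> b)"
  proof (rule emeasure_lborel_cbox)
    show "?u \<bullet> b \<le> ?w \<bullet> b" if "b \<in> Basis" for b
      using d[OF that] pos unfolding inner_diff_left[of ?w ?u] by linarith
  qed
  also have "(\<Prod>b\<in>Basis. (?w - ?u) \<bullet> b) = (\<Prod>b\<in>(Basis :: ((real ^ 'n) \<times> real) set). (1 + ?g) * ?l)"
    by (intro prod.cong d) auto
  also have "\<dots> = ((1 + ?g) * ?l) ^ (CARD('n) + 1)" by simp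
  finally show ?thesis by (simp only: cantor_bump_box_def)
qed

lemma cantor_bump_box_norm:
  assumes "p \<in> cantor_bump_box k (a :: (real ^ 'n::finite) \<times> real)"
  shows "norm (p - a) \<le> real (CARD('n) + 1) * (1 + cantor_gap TYPE('n)) * cantor_side TYPE('n) k"
proof -
  let ?g = "cantor_gap TYPE('n)" and ?l = "cantor_side TYPE('n) k"
  have gl: "?g * ?l > 0" "?l > 0" using cantor_gap_pos[of "TYPE('n)"] cantor_side_pos[of "TYPE('n)" k] by simp_all
  have "norm (p - a) \<le> (\<Sum>b\<in>Basis. \<bar>(p - a) \<bullet> b\<bar>)" by (rule norm_le_l1)
  also have "\<dots> \<le> (\<Sum>b\<in>(Basis :: ((real ^ 'n) \<times> real) set). (1 + ?g) * ?l)"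
  proof (rule sum_mono)
    fix b :: "(real ^ 'n) \<times> real" assume b: "b \<in> Basis"
    have "(a - (?g / 2 * ?l) *\<^sub>R One) \<bullet> b \<le> p \<bullet> b" "p \<bullet> b \<le> (a + ((1 + ?g / 2) * ?l) *\<^sub>R One) \<bullet> b"
      using assms b unfolding cantor_bump_box_def mem_box by blast+
    moreover have "One \<bullet> b = 1" using b by simp
    ultimately have "a \<bullet> b - ?g / 2 * ?l \<le> p \<bullet> b" "p \<bullet> b \<le> a \<bullet> b + (1 + ?g / 2) * ?l"
      by (simp_all only: inner_diff_left inner_add_left inner_scaleR_left mult_1_right)
    moreover have "(1 + ?g / 2) * ?l = ?l + (?g * ?l) / 2" "(1 + ?g) * ?l = ?l + ?g * ?l" "?g / 2 * ?l = (?g * ?l) / 2"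
      by (simp_all add: algebra_simps)
    ultimately show "\<bar>(p - a) \<bullet> b\<bar> \<le> (1 + ?g) * ?l"
      using gl unfolding inner_diff_left by linarith
  qed
  also have "\<dots> = real (CARD('n) + 1) * (1 + ?g) * ?l" by simp
  finally show ?thesis .
qed

text \<open>The discrete Leibniz rule, arranged so that every term is of second order in
  \<open>h\<close> when the factors are smooth.\<close>

lemma second_diff_mult:
  "second_diff (\<lambda>p. F p * G p) h p = F p * second_diff G h p + G p * second_diff F h p
     + (F (p + h) - F p) * (G (p + h) - G p) + (F (p - h) - F p) * (G (p - h) - G p)"
  by (simp add: algebra_simps)

text \<open>Subtracting the value at the corner leaves an amplitude of the order of the side, one
  power better than for the bump alone. The shape of the bounds is that of the hypotheses of
  \<open>theta_distr_cube_bound\<close> with amplitude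
  \<open>A * cantor_side TYPE('n) k\<close>.\<close>

lemma localized_test_function:
  fixes \<phi> :: "(real ^ 'n::finite) \<times> real \<Rightarrow> complex"
  assumes t: "test_function_on UNIV \<phi>"
  obtains A where "A \<ge> 0"
    "\<And>k a p. norm ((\<phi> p - \<phi> a) * cantor_bump k a p) \<le> A * cantor_side TYPE('n) k"
    "\<And>k a p h. norm (second_diff (\<lambda>p. (\<phi> p - \<phi> a) * cantor_bump k a p) h p)
       \<le> A * cantor_side TYPE('n) k * (norm h / cantor_side TYPE('n) k)\<^sup>2"
    "\<And>k a p v. norm (frechet_derivative (\<lambda>p. (\<phi> p - \<phi> a) * cantor_bump k a p) (at p) v)
       \<le> A * cantor_side TYPE('n) k / cantor_side TYPE('n) k * norm v"
proof -
  let ?l = "cantor_side TYPE('n)"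
  obtain L where L: "L \<ge> 0" "\<And>x y. norm (\<phi> x - \<phi> y) \<le> L * norm (x - y)"
    "\<And>x v. norm (frechet_derivative \<phi> (at x) v) \<le> L * norm v"
    using test_function_lipschitz[OF t] by metis
  obtain C where C: "C \<ge> 0" "\<And>x h. norm (second_diff \<phi> h x) \<le> C * (norm h)\<^sup>2"
    using test_function_second_difference[OF t] by metis
  obtain L' C' where L': "L' \<ge> 0" "C' \<ge> 0"
    "\<And>k (a :: (real ^ 'n) \<times> real) p q. norm (cantor_bump k a p - cantor_bump k a q) \<le> L' * (norm (p - q) / ?l k)"
    "\<And>k (a :: (real ^ 'n) \<times> real) p v. norm (frechet_derivative (cantor_bump k a) (at p) v) \<le> L' * (norm v / ?l k)"
    "\<And>k (a :: (real ^ 'n) \<times> real) p h. norm (second_diff (cantor_bump k a) h p) \<le> C' * (norm h / ?l k)\<^sup>2"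
    using cantor_bump_estimates by metis
  define \<rho> where "\<rho> = real (CARD('n) + 1) * (1 + cantor_gap TYPE('n))"
  have \<rho>: "\<rho> \<ge> 0" using cantor_gap_pos[of "TYPE('n)"] by (simp add: \<rho>_def)
  have box: "norm (p - a) \<le> \<rho> * ?l k" if "p \<in> cantor_bump_box k a" for p k and a :: "(real ^ 'n) \<times> real"
    using cantor_bump_box_norm[OF that] by (simp add: \<rho>_def)
  \<comment> \<open>One summand for each estimate: second differences with a long step, second
    differences with a short step, and first derivatives. The bound on values is covered by the
    first summand.\<close>
  define A where "A = 4 * L * \<rho> + (L * (\<rho> + 1) * C' + C + 2 * L * L') + L * (1 + \<rho> * L')"
  have parts: "4 * L * \<rho> \<ge> 0" "L * (\<rho> + 1) * C' + C + 2 * L * L' \<ge> 0" "L * (1 + \<rho> * L') \<ge> 0" "L * \<rho> \<ge> 0"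
    using L(1) C(1) L'(1,2) \<rho> by simp_all
  have lpos: "?l k > 0" for k by (rule cantor_side_pos)
  have val: "norm ((\<phi> p - \<phi> a) * cantor_bump k a p) \<le> L * \<rho> * ?l k" for k a p
  proof (cases "p \<in> cantor_bump_box k a")
    case True
    have "norm ((\<phi> p - \<phi> a) * cantor_bump k a p) \<le> (L * norm (p - a)) * 1"
      unfolding norm_mult using L(1) L(2)[of p a] cantor_bump_norm[of k a p] by (intro mult_mono) auto
    also have "\<dots> \<le> (L * (\<rho> * ?l k)) * 1" using box[OF True] L(1) by (intro mult_right_mono mult_left_mono) auto
    finally show ?thesis by simp
  next
    case False
    then show ?thesis using parts(4) lpos[of k] by (simp add: cantor_bump_outside)
  qed
  show ?thesis
  proof (rule that[of A])
    show "A \<ge> 0" using parts by (simp add: A_def)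
    fix k and a p :: "(real ^ 'n) \<times> real"
    show "norm ((\<phi> p - \<phi> a) * cantor_bump k a p) \<le> A * ?l k"
    proof -
      have "L * \<rho> \<le> A" using parts by (simp add: A_def)
      then show ?thesis using val[of p a k] lpos[of k] mult_right_mono[of "L * \<rho>" A "?l k"] by linarith
    qed
    show "norm (frechet_derivative (\<lambda>p. (\<phi> p - \<phi> a) * cantor_bump k a p) (at p) v) \<le> A * ?l k / ?l k * norm v" for v
    proof -
      have H: "((\<lambda>p. (\<phi> p - \<phi> a) * cantor_bump k a p) has_derivative
         (\<lambda>v. (\<phi> p - \<phi> a) * frechet_derivative (cantor_bump k a) (at p) v + frechet_derivative \<phi> (at p) v * cantor_bump k a p)) (at p)"
        by (rule has_derivative_mult[OF _ test_function_has_derivative[OF cantor_bump_test_function]])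
          (auto intro!: derivative_eq_intros test_function_has_derivative[OF t])
      have "norm (frechet_derivative (\<lambda>p. (\<phi> p - \<phi> a) * cantor_bump k a p) (at p) v) \<le> L * (1 + \<rho> * L') * norm v"
      proof (cases "p \<in> cantor_bump_box k a")
        case True
        have "norm ((\<phi> p - \<phi> a) * frechet_derivative (cantor_bump k a) (at p) v) \<le> (L * (\<rho> * ?l k)) * (L' * (norm v / ?l k))"
          unfolding norm_mult using L(2)[of p a] mult_left_mono[OF box[OF True] L(1)] L'(4)[of k a p v] L(1) \<rho> lpos[of k]
          by (intro mult_mono) auto
        also have "\<dots> = L * \<rho> * L' * norm v" using lpos[of k] by simp
        finally have 1: "norm ((\<phi> p - \<phi> a) * frechet_derivative (cantor_bump k a) (at p) v) \<le> L * \<rho> * L' * norm v" .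
        have 2: "norm (frechet_derivative \<phi> (at p) v * cantor_bump k a p) \<le> (L * norm v) * 1"
          unfolding norm_mult using L(1) L(3)[of p v] cantor_bump_norm[of k a p] by (intro mult_mono) auto
        have "norm (frechet_derivative (\<lambda>p. (\<phi> p - \<phi> a) * cantor_bump k a p) (at p) v) \<le> L * \<rho> * L' * norm v + (L * norm v) * 1"
          unfolding fun_cong[OF frechet_derivative_at[OF H, symmetric]] using 1 2 by (intro norm_triangle_mono)
        then show ?thesis by (simp add: algebra_simps)
      next
        case False
        have "open (- cantor_bump_box k a)" unfolding cantor_bump_box_def by (intro open_Compl closed_cbox)
        then have "((\<lambda>p. (\<phi> p - \<phi> a) * cantor_bump k a p) has_derivative (\<lambda>_. 0)) (at p)"
          by (intro has_derivative_transform_within_open[OF has_derivative_const, of "- cantor_bump_box k a" p 0])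
            (use False in \<open>auto simp: cantor_bump_outside\<close>)
        from frechet_derivative_at[OF this, symmetric] show ?thesis using parts by simp
      qed
      also have "\<dots> \<le> A * norm v" using parts by (intro mult_right_mono) (auto simp: A_def)
      finally show ?thesis using lpos[of k] by simp
    qed
    show "norm (second_diff (\<lambda>p. (\<phi> p - \<phi> a) * cantor_bump k a p) h p) \<le> A * ?l k * (norm h / ?l k)\<^sup>2" for h
    proof -
      let ?F = "\<lambda>p. \<phi> p - \<phi> a" and ?G = "cantor_bump k a"
      let ?q = "(norm h / ?l k)\<^sup>2"
      have lk: "?l k > 0" "?l k \<le> 1" by (simp_all add: cantor_side_pos cantor_side_le_1)
      have fin: ?thesis if "norm (second_diff (\<lambda>p. ?F p * ?G p) h p) \<le> c * (?l k * ?q)" "c \<le> A" for c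
      proof -
        have "c * (?l k * ?q) \<le> A * (?l k * ?q)" using that lk by (intro mult_right_mono) auto
        then show ?thesis using that(1) by (simp only: mult.assoc)
      qed
      \<comment> \<open>A step longer than the side is handled by the triangle inequality, since the
        quotient then exceeds 1. For a shorter step, a nonzero second difference forces
        \<open>p\<close> to within \<open>(\<rho> + 1) * ?l k\<close> of \<open>a\<close>, so that
        \<open>\<phi> p - \<phi> a\<close> is still of the order of the side.\<close>
      show ?thesis
      proof (cases "norm h > ?l k")
        case True
        have "norm (second_diff (\<lambda>p. ?F p * ?G p) h p) \<le> norm (?F (p + h) * ?G (p + h)) + norm (?F (p - h) * ?G (p - h)) + norm (2 * (?F p * ?G p))"
          by (rule norm_triangle_le_diff) (auto intro: norm_triangle_ineq add_mono)
        also have "\<dots> \<le> 4 * (L * \<rho> * ?l k)"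
          using val[of "p + h" a k] val[of "p - h" a k] val[of p a k] by (simp only: norm_mult norm_numeral)
        also have "\<dots> = (4 * L * \<rho>) * (?l k * 1)" by simp
        also have "\<dots> \<le> (4 * L * \<rho>) * (?l k * ?q)"
        proof -
          have "1 \<le> ?q" using True lk by (intro one_le_power) (simp add: le_divide_eq)
          then show ?thesis using parts(1) lk by (intro mult_left_mono) auto
        qed
        finally show ?thesis by (rule fin) (use parts in \<open>auto simp: A_def\<close>)
      next
        case hl: False
        show ?thesis
        proof (cases "p + h \<in> cantor_bump_box k a \<or> p - h \<in> cantor_bump_box k a \<or> p \<in> cantor_bump_box k a")
          case False
          then have "second_diff (\<lambda>p. ?F p * ?G p) h p = 0" by (simp add: cantor_bump_outside)
          then show ?thesis by (intro fin[of 0]) (use parts in \<open>auto simp: A_def\<close>)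
        next
          case True
          have "norm (p - a) \<le> \<rho> * ?l k + norm h"
          proof -
            have "norm (p - a) \<le> norm (p + h - a) + norm h" using norm_triangle_ineq4[of "p + h - a" h] by (simp add: algebra_simps)
            moreover have "norm (p - a) \<le> norm (p - h - a) + norm h" using norm_triangle_ineq[of "p - h - a" h] by (simp add: algebra_simps)
            moreover have "norm h \<ge> 0" by simp
            ultimately show ?thesis using True box[of "p + h" k a] box[of "p - h" k a] box[of p k a] by linarith
          qed
          then have pa: "norm (p - a) \<le> (\<rho> + 1) * ?l k" using hl by (simp add: distrib_right)
          have q: "(norm h)\<^sup>2 = ?l k * (?l k * ?q)" using lk by (simp add: power2_eq_square)
          have q0: "0 \<le> ?l k * ?q" using lk by simp
          have 1: "norm (?F p * second_diff ?G h p) \<le> (L * (\<rho> + 1) * C') * (?l k * ?q)"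
          proof -
            have "norm (?F p * second_diff ?G h p) \<le> (L * ((\<rho> + 1) * ?l k)) * (C' * ?q)"
              unfolding norm_mult using L(2)[of p a] mult_left_mono[OF pa L(1)] L'(5)[where k=k and a=a and p=p and h=h] L(1) \<rho> lk
              by (intro mult_mono) auto
            then show ?thesis by (simp only: mult_ac)
          qed
          have 2: "norm (?G p * second_diff ?F h p) \<le> C * (?l k * ?q)"
          proof -
            have eq: "second_diff ?F h p = second_diff \<phi> h p" by simp
            have "norm (?G p * second_diff ?F h p) \<le> 1 * (C * (norm h)\<^sup>2)"
              unfolding norm_mult eq using C(2)[where x=p and h=h] cantor_bump_norm[of k a p] by (intro mult_mono) auto
            also have "\<dots> = C * (?l k * (?l k * ?q))" unfolding q by simp
            \<comment> \<open>Second differences of \<open>\<phi>\<close> alone are better by one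
              power of the side, which is given up because the side is at most 1.\<close>
            also have "\<dots> \<le> C * (1 * (?l k * ?q))" using lk q0 C(1) by (intro mult_left_mono mult_right_mono) auto
            finally show ?thesis by simp
          qed
          have 3: "norm ((?F z - ?F p) * (?G z - ?G p)) \<le> (L * L') * (?l k * ?q)" if "norm (z - p) = norm h" for z
          proof -
            have "norm ((?F z - ?F p) * (?G z - ?G p)) \<le> (L * norm h) * (L' * (norm h / ?l k))"
              unfolding norm_mult using L(1) L(2)[of z p] L'(3)[of k a z p] that lk by (intro mult_mono) auto
            also have "\<dots> = (L * L') * (?l k * ?q)" using lk by (simp add: power2_eq_square)
            finally show ?thesis .
          qed
          have "norm (second_diff (\<lambda>p. ?F p * ?G p) h p)
            \<le> (L * (\<rho> + 1) * C') * (?l k * ?q) + C * (?l k * ?q) + (L * L') * (?l k * ?q) + (L * L') * (?l k * ?q)"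
            unfolding second_diff_mult[where F="?F" and G="?G" and h=h and p=p] by (intro norm_triangle_mono 1 2 3) (simp_all add: norm_minus_commute)
          also have "\<dots> = (L * (\<rho> + 1) * C' + C + 2 * L * L') * (?l k * ?q)"
            by (simp add: algebra_simps)
          finally show ?thesis by (rule fin) (use parts in \<open>auto simp: A_def\<close>)
        qed
      qed
    qed
  qed
qed

section \<open>Growth, additivity and Riemann sums of the distribution on the cubes\<close>

context
  fixes f :: "(real ^ 'n::finite) \<times> real \<Rightarrow> real" and M :: real
  assumes f: "f \<in> borel_measurable lebesgue" and M: "\<And>p. \<bar>f p\<bar> \<le> M"
begin

lemma M_nonneg: "M \<ge> 0"
  using M[of 0] abs_ge_zero[of "f 0"] by linarith

definition cube_const :: real where
  "cube_const = M * theta_const CARD('n) * (1 + cantor_gap TYPE('n)) ^ (CARD('n) + 1)"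

lemma cube_const_nonneg: "cube_const \<ge> 0"
  using M_nonneg cantor_gap_pos[of "TYPE('n)"] by (simp add: cube_const_def theta_const_def)

text \<open>The box has volume of order \<open>l ^ (N + 1)\<close> and the operator costs a factor
  \<open>1 / l\<close>, which leaves \<open>l ^ N\<close>. With amplitude of order 1 this is the
  growth bound for bumps; with amplitude of order \<open>l\<close> it is the error of freezing a
  test function on a cube.\<close>

lemma theta_distr_cube_bound:
  assumes t: "test_function_on UNIV \<psi>"
    and B: "\<And>p. p \<notin> cantor_bump_box k a \<Longrightarrow> \<psi> p = 0"
    and A: "\<And>p. norm (\<psi> p) \<le> A"
      "\<And>p h. norm (second_diff \<psi> h p) \<le> A * (norm h / cantor_side TYPE('n) k)\<^sup>2"
      "\<And>p v. norm (frechet_derivative \<psi> (at p) v) \<le> A / cantor_side TYPE('n) k * norm v"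
  shows "norm (theta_distr f \<psi>) \<le> cube_const * A * cantor_side TYPE('n) k ^ CARD('n)"
proof -
  let ?l = "cantor_side TYPE('n) k" and ?N = "CARD('n)" and ?g = "1 + cantor_gap TYPE('n)"
  have l: "?l > 0" by (rule cantor_side_pos)
  have A0: "A \<ge> 0" using A(1)[of 0] norm_ge_zero[of "\<psi> 0"] by linarith
  have g: "?g > 0" using cantor_gap_pos[of "TYPE('n)"] by simp
  have tc: "theta_const ?N \<ge> 0" by (simp add: theta_const_def)
  have "ennreal (norm (theta_distr f \<psi>)) \<le> ennreal M * (\<integral>\<^sup>+p. ennreal (norm (theta_transpose \<psi> p)) \<partial>lborel)"
    by (rule theta_distr_bound[OF f M t])
  also have "\<dots> \<le> ennreal M * (ennreal (theta_const ?N * A / ?l) * emeasure lborel (cantor_bump_box k a))"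
    by (intro mult_left_mono theta_transpose_bound[OF t l _ B A]) (auto simp: cantor_bump_box_def)
  also have "\<dots> = ennreal (M * (theta_const ?N * A / ?l * (?g * ?l) ^ (?N + 1)))"
    unfolding emeasure_cantor_bump_box using M_nonneg tc A0 l g
    by (simp only: ennreal_mult[symmetric] mult_nonneg_nonneg divide_nonneg_nonneg zero_le_power less_imp_le)
  also have "M * (theta_const ?N * A / ?l * (?g * ?l) ^ (?N + 1)) = cube_const * A * ?l ^ ?N"
    using l by (simp add: cube_const_def power_mult_distrib)
  finally show ?thesis
    using cube_const_nonneg A0 l by (subst (asm) ennreal_le_iff) auto
qed

lemma theta_distr_bump_bound:
  obtains C where "C \<ge> 0"
    "\<And>k a. norm (theta_distr f (cantor_bump k a)) \<le> C * cantor_side TYPE('n) k ^ CARD('n)"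
proof -
  obtain L' C' where L': "L' \<ge> 0" "C' \<ge> 0"
    "\<And>k (a :: (real ^ 'n) \<times> real) p v. norm (frechet_derivative (cantor_bump k a) (at p) v) \<le> L' * (norm v / cantor_side TYPE('n) k)"
    "\<And>k (a :: (real ^ 'n) \<times> real) p h. norm (second_diff (cantor_bump k a) h p) \<le> C' * (norm h / cantor_side TYPE('n) k)\<^sup>2"
    using cantor_bump_estimates by metis
  define A where "A = 1 + L' + C'"
  have "norm (theta_distr f (cantor_bump k a)) \<le> cube_const * A * cantor_side TYPE('n) k ^ CARD('n)" for k a
  proof (rule theta_distr_cube_bound[OF cantor_bump_test_function cantor_bump_outside])
    show "norm (cantor_bump k a p) \<le> A" for p using cantor_bump_norm[of k a p] L' by (simp add: A_def)
    show "norm (second_diff (cantor_bump k a) h p) \<le> A * (norm h / cantor_side TYPE('n) k)\<^sup>2" for p h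
      using L'(4)[where k=k and a=a and p=p and h=h] L'(1,2) mult_right_mono[of C' A "(norm h / cantor_side TYPE('n) k)\<^sup>2"] by (simp add: A_def)
    show "norm (frechet_derivative (cantor_bump k a) (at p) v) \<le> A / cantor_side TYPE('n) k * norm v" for p v
    proof -
      have "L' * (norm v / cantor_side TYPE('n) k) \<le> A * (norm v / cantor_side TYPE('n) k)"
        using L'(1,2) cantor_side_pos[of "TYPE('n)" k] by (intro mult_right_mono) (auto simp: A_def)
      then show ?thesis using L'(3)[of k a p v] by simp
    qed
  qed
  moreover have "cube_const * A \<ge> 0" using cube_const_nonneg L' by (simp add: A_def)
  ultimately show ?thesis using that by blast
qed

lemma theta_distr_sum:
  "finite I \<Longrightarrow> (\<And>i. i \<in> I \<Longrightarrow> test_function_on UNIV (g i)) \<Longrightarrow>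
     theta_distr f (\<lambda>p. \<Sum>i\<in>I. g i p) = (\<Sum>i\<in>I. theta_distr f (g i))"
proof (induction I rule: finite_induct)
  case empty
  show ?case using theta_distr_cmult[OF f M, of "\<lambda>_. 0" 0] by simp
next
  case (insert i I)
  then show ?case by (simp add: theta_distr_add[OF f M] test_function_sum)
qed

context
  assumes hc: "half_caloric_on (- cantor_set) f"
begin

text \<open>The difference of the two test functions is supported off the Cantor set, where the
  equation holds; hence only the germ of a test function along the set matters.\<close>

lemma theta_distr_cong_near:
  assumes "test_function_on UNIV \<phi>" "test_function_on UNIV \<psi>"
    and "\<And>p. p \<in> cantor_set \<Longrightarrow> eventually (\<lambda>q. \<phi> q = \<psi> q) (nhds p)"
  shows "theta_distr f \<phi> = theta_distr f \<psi>"
proof -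
  have t: "test_function_on UNIV (\<lambda>p. \<phi> p - \<psi> p)" by (rule test_function_diff[OF assms(1,2)])
  have "test_function_on (- cantor_set) (\<lambda>p. \<phi> p - \<psi> p)"
    by (rule test_function_off_cantor_set[OF t]) (use assms(3) in simp)
  then have "theta_distr f (\<lambda>p. \<phi> p - \<psi> p) = 0"
    using hc by (simp add: half_caloric_on_def theta_distr_def)
  moreover have "theta_distr f (\<lambda>p. (\<phi> p - \<psi> p) + \<psi> p) = theta_distr f (\<lambda>p. \<phi> p - \<psi> p) + theta_distr f \<psi>"
    by (rule theta_distr_add[OF f M t assms(2)])
  ultimately show ?thesis by simp
qed

lemma theta_distr_children:
  assumes t: "test_function_on UNIV \<phi>" and a: "a \<in> cantor_corners k"
  shows "theta_distr f (\<lambda>p. \<phi> p * cantor_bump k a p)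
    = (\<Sum>v\<in>unit_cube_vertices. theta_distr f (\<lambda>p. \<phi> p * cantor_bump (Suc k) (cantor_child k a v) p))"
proof -
  have tt: "test_function_on UNIV (\<lambda>p. \<phi> p * cantor_bump j b p)" for j b
    by (rule test_function_mult(1)[OF t cantor_bump_smooth])
  have "theta_distr f (\<lambda>p. \<phi> p * cantor_bump k a p)
    = theta_distr f (\<lambda>p. \<Sum>v\<in>unit_cube_vertices. \<phi> p * cantor_bump (Suc k) (cantor_child k a v) p)"
  proof (rule theta_distr_cong_near[OF tt test_function_sum[OF tt]])
    fix p assume "p \<in> (cantor_set :: ((real ^ 'n) \<times> real) set)"
    from cantor_bump_children_near[OF a this]
    show "eventually (\<lambda>q. \<phi> q * cantor_bump k a q = (\<Sum>v\<in>unit_cube_vertices. \<phi> q * cantor_bump (Suc k) (cantor_child k a v) q)) (nhds p)"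
      by eventually_elim (simp add: sum_distrib_left)
  qed
  then show ?thesis using theta_distr_sum[OF finite_unit_cube_vertices tt] by simp
qed

lemma theta_distr_bump_children:
  assumes a: "a \<in> cantor_corners k"
  shows "theta_distr f (cantor_bump k a) = (\<Sum>v\<in>unit_cube_vertices. theta_distr f (cantor_bump (Suc k) (cantor_child k a v)))"
proof -
  have "theta_distr f (cantor_bump k a) = theta_distr f (\<lambda>p. \<Sum>v\<in>unit_cube_vertices. cantor_bump (Suc k) (cantor_child k a v) p)"
    by (rule theta_distr_cong_near[OF cantor_bump_test_function test_function_sum[OF cantor_bump_test_function]
          cantor_bump_children_near[OF a]])
  then show ?thesis
    using theta_distr_sum[OF finite_unit_cube_vertices cantor_bump_test_function] by simp
qed

lemma theta_distr_tree_sum: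
  assumes t: "test_function_on UNIV \<phi>"
  shows "theta_distr f \<phi> = tree_sum 0 n (\<lambda>a. theta_distr f (\<lambda>p. \<phi> p * cantor_bump n a p)) 0"
proof -
  have "theta_distr f \<phi> = theta_distr f (\<lambda>p. \<phi> p * cantor_bump 0 0 p)"
    by (rule theta_distr_cong_near[OF t test_function_mult(1)[OF t cantor_bump_smooth]])
      (auto elim!: eventually_mono[OF cantor_bump_0_near])
  also have "\<dots> = tree_sum 0 n (\<lambda>a. theta_distr f (\<lambda>p. \<phi> p * cantor_bump (0 + n) a p)) 0"
    by (rule tree_sum_additive[symmetric, where \<nu>="\<lambda>n a. theta_distr f (\<lambda>p. \<phi> p * cantor_bump n a p)"])
      (auto simp: theta_distr_children[OF t] simp del: cantor_corners.simps(2))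
  finally show ?thesis by simp
qed

text \<open>A Riemann sum: on each of the \<open>2 ^ (n * (N + 1))\<close> cubes, freezing
  \<open>\<phi>\<close> at the corner costs at most the order of \<open>l ^ (N + 1)\<close>, and the
  total is of order \<open>l\<close>. The distribution is thereby determined by its values on the
  bumps.\<close>

lemma theta_distr_approx:
  assumes t: "test_function_on UNIV \<phi>"
  obtains C where "C \<ge> 0"
    "\<And>n. norm (theta_distr f \<phi> - tree_sum 0 n (\<lambda>a. \<phi> a * theta_distr f (cantor_bump n a)) 0) \<le> C * cantor_side TYPE('n) n"
proof -
  let ?l = "cantor_side TYPE('n)"
  obtain A where A: "A \<ge> 0"
    "\<And>k a p. norm ((\<phi> p - \<phi> a) * cantor_bump k a p) \<le> A * ?l k"
    "\<And>k a p h. norm (second_diff (\<lambda>p. (\<phi> p - \<phi> a) * cantor_bump k a p) h p) \<le> A * ?l k * (norm h / ?l k)\<^sup>2"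
    "\<And>k a p v. norm (frechet_derivative (\<lambda>p. (\<phi> p - \<phi> a) * cantor_bump k a p) (at p) v) \<le> A * ?l k / ?l k * norm v"
    using localized_test_function[OF t] by blast
  have loc: "norm (theta_distr f (\<lambda>p. \<phi> p * cantor_bump n a p) - \<phi> a * theta_distr f (cantor_bump n a)) \<le> cube_const * (A * ?l n) * ?l n ^ CARD('n)" for n a
  proof -
    have t1: "test_function_on UNIV (\<lambda>p. \<phi> p * cantor_bump n a p)"
      by (rule test_function_mult(1)[OF t cantor_bump_smooth])
    have t2: "test_function_on UNIV (\<lambda>p. \<phi> a * cantor_bump n a p)"
      by (rule test_function_cmult[OF cantor_bump_test_function])
    have eq: "(\<phi> p - \<phi> a) * cantor_bump n a p = \<phi> p * cantor_bump n a p - \<phi> a * cantor_bump n a p" for p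
      by (simp add: left_diff_distrib)
    have t3: "test_function_on UNIV (\<lambda>p. (\<phi> p - \<phi> a) * cantor_bump n a p)"
      unfolding eq by (rule test_function_diff[OF t1 t2])
    have "theta_distr f (\<lambda>p. (\<phi> p - \<phi> a) * cantor_bump n a p + \<phi> a * cantor_bump n a p)
      = theta_distr f (\<lambda>p. (\<phi> p - \<phi> a) * cantor_bump n a p) + \<phi> a * theta_distr f (cantor_bump n a)"
      using theta_distr_add[OF f M t3 t2] theta_distr_cmult[OF f M cantor_bump_test_function, of "\<phi> a" n a] by simp
    moreover have "(\<lambda>p. (\<phi> p - \<phi> a) * cantor_bump n a p + \<phi> a * cantor_bump n a p) = (\<lambda>p. \<phi> p * cantor_bump n a p)"
      by (simp add: algebra_simps)
    ultimately have "theta_distr f (\<lambda>p. \<phi> p * cantor_bump n a p) - \<phi> a * theta_distr f (cantor_bump n a)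
      = theta_distr f (\<lambda>p. (\<phi> p - \<phi> a) * cantor_bump n a p)" by simp
    also have "norm \<dots> \<le> cube_const * (A * ?l n) * ?l n ^ CARD('n)"
      by (rule theta_distr_cube_bound[where a=a, OF t3 _ A(2-4)]) (simp add: cantor_bump_outside)
    finally show ?thesis .
  qed
  have "norm (theta_distr f \<phi> - tree_sum 0 n (\<lambda>a. \<phi> a * theta_distr f (cantor_bump n a)) 0) \<le> cube_const * A * ?l n" for n
  proof -
    have "norm (theta_distr f \<phi> - tree_sum 0 n (\<lambda>a. \<phi> a * theta_distr f (cantor_bump n a)) 0)
      = norm (tree_sum 0 n (\<lambda>a. theta_distr f (\<lambda>p. \<phi> p * cantor_bump n a p) - \<phi> a * theta_distr f (cantor_bump n a)) 0)"
      unfolding tree_sum_diff theta_distr_tree_sum[OF t, of n] ..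
    also have "\<dots> \<le> tree_sum 0 n (\<lambda>a. cube_const * (A * ?l n) * ?l n ^ CARD('n)) (0 :: (real ^ 'n) \<times> real)"
      by (rule tree_sum_norm_le) (auto intro: loc)
    also have "\<dots> = (2 ^ (CARD('n) + 1)) ^ n * (cube_const * (A * ?l n) * (1 / 2 ^ (CARD('n) + 1)) ^ n)"
      unfolding tree_sum_const cantor_side_power ..
    also have "\<dots> = cube_const * A * ?l n" by (simp add: power_divide del: power_Suc)
    finally show ?thesis .
  qed
  moreover have "cube_const * A \<ge> 0" using cube_const_nonneg A(1) by simp
  ultimately show ?thesis using that by blast
qed

end

end

section \<open>The extremal argument\<close>

lemma smooth_step_derivative:
  obtains \<beta> C where "\<And>x. (smooth_step has_real_derivative \<beta> x) (at x)" "continuous_on UNIV \<beta>" "C \<ge> 0"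
    "\<And>x. \<bar>\<beta> x\<bar> \<le> C * indicator {0..1} x"
proof -
  define \<beta> where "\<beta> = (\<lambda>x. frechet_derivative smooth_step (at x) 1)"
  have s1: "smooth_upto (Suc 0) UNIV smooth_step" by (rule smooth_upto_smooth_step)
  have d: "(smooth_step has_real_derivative \<beta> x) (at x)" for x
  proof -
    have H: "(smooth_step has_derivative frechet_derivative smooth_step (at x)) (at x)"
      by (rule smooth_upto_Suc_has_derivative[OF s1]) simp
    have "frechet_derivative smooth_step (at x) = (\<lambda>h. \<beta> x * h)"
    proof
      fix h :: real
      show "frechet_derivative smooth_step (at x) h = \<beta> x * h"
        using linear_scale[OF has_derivative_linear[OF H], of h 1] by (simp add: \<beta>_def)
    qed
    then show ?thesis using H by (simp only: has_field_derivative_def)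
  qed
  have cont: "continuous_on UNIV \<beta>" using s1 by (simp add: \<beta>_def)
  have "bounded (\<beta> ` {0..1})"
    by (intro compact_imp_bounded compact_continuous_image continuous_on_subset[OF cont]) auto
  then obtain C where "\<forall>y\<in>\<beta> ` {0..1}. norm y \<le> C" unfolding bounded_iff by blast
  then have C: "\<bar>\<beta> x\<bar> \<le> C" if "x \<in> {0..1}" for x using that by auto
  have z: "\<beta> x = 0" if "x \<notin> {0..1}" for x
  proof -
    have "(smooth_step has_real_derivative 0) (at x)"
    proof (cases "x < 0")
      case True
      then show ?thesis
        by - (rule has_field_derivative_transform_within_open[where S="{..<0}" and f="\<lambda>_. 0"], auto)
    next
      case False
      then have "x > 1" using that by auto
      then show ?thesis
        by - (rule has_field_derivative_transform_within_open[where S="{1<..}" and f="\<lambda>_. 1"], auto)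
    qed
    then show ?thesis using d DERIV_unique by blast
  qed
  have "\<bar>\<beta> x\<bar> \<le> C * indicator {0..1} x" for x using C[of x] z[of x] by (cases "x \<in> {0..1}") auto
  moreover have "C \<ge> 0" using C[of 0] by simp
  ultimately show ?thesis using that d cont by blast
qed

text \<open>The ramps over \<open>[t0 - 2 * l, t0 - l]\<close> and \<open>[t0, t0 + r / 2]\<close>
  have slopes of order \<open>1 / l\<close> and \<open>1 / r\<close>, so each has variation at most
  \<open>C\<close> however short it is. This is why \<open>V\<close> can be fixed before
  \<open>l\<close> and \<open>r\<close>, and the final descent may be as steep as the position of
  the apex demands.\<close>

lemma time_cutoff:
  obtains V where "V \<ge> 0"
    "\<And>t0 l r :: real. l > 0 \<Longrightarrow> r > 0 \<Longrightarrow> \<exists>\<theta> \<theta>'. (\<forall>k. smooth_upto k UNIV \<theta>) \<and> (\<forall>t. (\<theta> has_real_derivative \<theta>' t) (at t))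
       \<and> \<theta>' \<in> borel_measurable borel \<and> (\<forall>t. 0 \<le> \<theta> t \<and> \<theta> t \<le> 1) \<and> (\<forall>t\<ge>t0 + r / 2. \<theta> t = 0) \<and> (\<forall>t\<le>t0 - 2 * l. \<theta> t = 0)
       \<and> (\<forall>t. t0 - l \<le> t \<longrightarrow> t \<le> t0 \<longrightarrow> \<theta> t = 1) \<and> (\<integral>\<^sup>+t. ennreal \<bar>\<theta>' t\<bar> \<partial>lborel) \<le> ennreal V"
proof -
  obtain \<beta> C where \<beta>: "\<And>x. (smooth_step has_real_derivative \<beta> x) (at x)" "continuous_on UNIV \<beta>" "C \<ge> 0"
    "\<And>x. \<bar>\<beta> x\<bar> \<le> C * indicator {0..1} x" using smooth_step_derivative by blast
  have [measurable]: "\<beta> \<in> borel_measurable borel" by (rule borel_measurable_continuous_onI[OF \<beta>(2)])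
  have [measurable]: "smooth_step \<in> borel_measurable borel"
    using smooth_upto_smooth_step[of 0] by (intro borel_measurable_continuous_onI) simp
  show ?thesis
  proof (rule that[of "2 * C"])
    show "2 * C \<ge> 0" using \<beta>(3) by simp
    fix t0 l r :: real assume l: "l > 0" and r: "r > 0"
    define u w where "u = (\<lambda>t. - (t0 - 2 * l) / l + t / l)" and "w = (\<lambda>t. (t0 + r / 2) / (r / 2) + - (t / (r / 2)))"
    define \<theta> where "\<theta> = (\<lambda>t. smooth_step (u t) * smooth_step (w t))"
    define \<theta>' where "\<theta>' = (\<lambda>t. \<beta> (u t) * (1 / l) * smooth_step (w t) + \<beta> (w t) * (- (1 / (r / 2))) * smooth_step (u t))"
    have ueq: "u t = (t - (t0 - 2 * l)) / l" and weq: "w t = (t0 + r / 2 - t) / (r / 2)" for t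
      using l r by (simp_all add: u_def w_def field_simps)
    have "smooth_upto k UNIV \<theta>" for k
    proof -
      have bl: "bounded_linear (\<lambda>t. t / l)" "bounded_linear (\<lambda>t. - (t / (r / 2)))"
        by (intro bounded_linear_divide bounded_linear_minus bounded_linear_ident)+
      have "smooth_upto k UNIV (\<lambda>t. smooth_step (u t))"
        unfolding u_def by (rule smooth_upto_compose_affine[OF open_UNIV bl(1) smooth_upto_smooth_step]) simp
      moreover have "smooth_upto k UNIV (\<lambda>t. smooth_step (w t))"
        unfolding w_def by (rule smooth_upto_compose_affine[OF open_UNIV bl(2) smooth_upto_smooth_step]) simp
      ultimately have "smooth_upto k UNIV (\<lambda>t. smooth_step (u t))" "smooth_upto k UNIV (\<lambda>t. smooth_step (w t))" .
      then show ?thesis unfolding \<theta>_def by (intro smooth_upto_mult) auto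
    qed
    moreover have "(\<theta> has_real_derivative \<theta>' t) (at t)" for t
    proof -
      have "(u has_real_derivative 1 / l) (at t)" "(w has_real_derivative - (1 / (r / 2))) (at t)"
        unfolding u_def w_def using l r by (auto intro!: derivative_eq_intros)
      then show ?thesis unfolding \<theta>_def \<theta>'_def by (intro DERIV_mult DERIV_chain2[OF \<beta>(1)])
    qed
    moreover have [measurable]: "u \<in> borel_measurable borel" "w \<in> borel_measurable borel" unfolding u_def w_def by measurable
    moreover have "\<theta>' \<in> borel_measurable borel" unfolding \<theta>'_def by measurable
    moreover have "0 \<le> \<theta> t \<and> \<theta> t \<le> 1" for t
      unfolding \<theta>_def using smooth_step_range by (auto intro: mult_le_one)
    moreover have "\<theta> t = 0" if "t \<ge> t0 + r / 2" for t
      using that r unfolding \<theta>_def weq by (simp add: divide_nonpos_pos)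
    moreover have "\<theta> t = 0" if "t \<le> t0 - 2 * l" for t
      using that l unfolding \<theta>_def ueq by (simp add: divide_nonpos_pos)
    moreover have "\<theta> t = 1" if "t0 - l \<le> t" "t \<le> t0" for t
      using that l r unfolding \<theta>_def ueq weq by (simp add: le_divide_eq)
    moreover have "(\<integral>\<^sup>+t. ennreal \<bar>\<theta>' t\<bar> \<partial>lborel) \<le> ennreal (2 * C)"
    proof -
      let ?A = "{t0 - 2 * l..t0 - l}" and ?B = "{t0..t0 + r / 2}"
      have "\<bar>\<theta>' t\<bar> \<le> C / l * indicator ?A t + C / (r / 2) * indicator ?B t" for t
      proof -
        have iu: "indicator {0..1} (u t) = (indicator ?A t :: real)" unfolding ueq using l
          by (auto simp: indicator_def divide_le_eq le_divide_eq)
        have iw: "indicator {0..1} (w t) = (indicator ?B t :: real)" unfolding weq using r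
          by (auto simp: indicator_def divide_le_eq le_divide_eq)
        have "\<bar>\<beta> (u t) * (1 / l) * smooth_step (w t)\<bar> \<le> (C * indicator ?A t) * (1 / l) * 1"
          unfolding abs_mult using \<beta>(4)[of "u t"] smooth_step_range[of "w t"] l \<beta>(3) unfolding iu
          by (intro mult_mono) auto
        moreover have "\<bar>\<beta> (w t) * (- (1 / (r / 2))) * smooth_step (u t)\<bar> \<le> (C * indicator ?B t) * (1 / (r / 2)) * 1"
          unfolding abs_mult using \<beta>(4)[of "w t"] smooth_step_range[of "u t"] r \<beta>(3) unfolding iw
          by (intro mult_mono) auto
        ultimately show ?thesis unfolding \<theta>'_def
          by (intro order_trans[OF abs_triangle_ineq]) (simp add: mult_ac)
      qed
      moreover have "ennreal (C / l * indicator ?A t + C / (r / 2) * indicator ?B t)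
          = ennreal (C / l) * indicator ?A t + ennreal (C / (r / 2)) * indicator ?B t" for t
        using l r \<beta>(3) by (cases "t \<in> ?A"; cases "t \<in> ?B") simp_all
      ultimately have "ennreal \<bar>\<theta>' t\<bar> \<le> ennreal (C / l) * indicator ?A t + ennreal (C / (r / 2)) * indicator ?B t" for t
        by (metis ennreal_leI)
      then have "(\<integral>\<^sup>+t. ennreal \<bar>\<theta>' t\<bar> \<partial>lborel) \<le> (\<integral>\<^sup>+t. ennreal (C / l) * indicator ?A t + ennreal (C / (r / 2)) * indicator ?B t \<partial>lborel)"
        by (intro nn_integral_mono)
      also have "\<dots> = ennreal (C / l) * ennreal l + ennreal (C / (r / 2)) * ennreal (r / 2)"
        using l r by (subst nn_integral_add) (auto simp: nn_integral_cmult_indicator)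
      also have "\<dots> = ennreal C + ennreal C"
        using l r \<beta>(3) by (simp only: ennreal_mult[symmetric] divide_nonneg_nonneg less_imp_le) (simp add: ennreal_mult[symmetric])
      also have "\<dots> = ennreal (2 * C)" using \<beta>(3) by (simp add: ennreal_plus[symmetric] del: ennreal_plus)
      finally show ?thesis .
    qed
    ultimately show "\<exists>\<theta> \<theta>'. (\<forall>k. smooth_upto k UNIV \<theta>) \<and> (\<forall>t. (\<theta> has_real_derivative \<theta>' t) (at t))
       \<and> \<theta>' \<in> borel_measurable borel \<and> (\<forall>t. 0 \<le> \<theta> t \<and> \<theta> t \<le> 1) \<and> (\<forall>t\<ge>t0 + r / 2. \<theta> t = 0) \<and> (\<forall>t\<le>t0 - 2 * l. \<theta> t = 0)
       \<and> (\<forall>t. t0 - l \<le> t \<longrightarrow> t \<le> t0 \<longrightarrow> \<theta> t = 1) \<and> (\<integral>\<^sup>+t. ennreal \<bar>\<theta>' t\<bar> \<partial>lborel) \<le> ennreal (2 * C)"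
      by blast
  qed
qed

section \<open>Sums over cubes weighted by natural mass\<close>

abbreviation cantor_mass :: "'n::finite itself \<Rightarrow> nat \<Rightarrow> real" where
  "cantor_mass T k \<equiv> cantor_side T k ^ CARD('n)"

lemma cantor_mass_eq: "cantor_mass TYPE('n::finite) k = (1 / 2 ^ (CARD('n) + 1)) ^ k"
  by (rule cantor_side_power)

lemma cantor_mass_pos: "cantor_mass TYPE('n::finite) k > 0"
  by (simp add: cantor_side_pos)

lemma cantor_mass_add: "cantor_mass TYPE('n::finite) (k + j) = cantor_mass TYPE('n) k * cantor_mass TYPE('n) j"
  unfolding cantor_mass_eq by (rule power_add)

lemma cantor_mass_Suc: "2 ^ (CARD('n) + 1) * cantor_mass TYPE('n::finite) (Suc k) = cantor_mass TYPE('n) k"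
  unfolding cantor_mass_eq by (simp add: power_divide)

lemma tree_sum_cantor_mass:
  "tree_sum k j (\<lambda>q. c * cantor_mass TYPE('n) (k + j)) (a :: (real ^ 'n::finite) \<times> real) = c * cantor_mass TYPE('n) k"
proof -
  have "(2 ^ (CARD('n) + 1)) ^ j * cantor_mass TYPE('n) (k + j) = cantor_mass TYPE('n) k"
    unfolding cantor_mass_add unfolding cantor_mass_eq by (simp add: power_divide)
  then show ?thesis unfolding tree_sum_const by (simp only: mult.left_commute)
qed

text \<open>The cubes not below \<open>a\<close> are grouped by the last ancestor that they share
  with \<open>a\<close>. If it has generation \<open>i\<close>, they lie in a sibling of the next
  ancestor of \<open>a\<close>, at least the gap of generation \<open>Suc i\<close> away from
  \<open>p0\<close>, and the group has natural mass at most that of generation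
  \<open>i\<close>.\<close>

lemma tree_sum_outside:
  fixes F :: "(real ^ 'n::finite) \<times> real \<Rightarrow> complex"
  assumes "a \<in> cantor_corners k" "p0 \<in> axis_cube a (cantor_side TYPE('n) k)"
    and "\<And>i q. i < k \<Longrightarrow> q \<in> cantor_corners (k + j) \<Longrightarrow> norm (p0 - q) \<ge> cantor_gap TYPE('n) * cantor_side TYPE('n) (Suc i)
      \<Longrightarrow> norm (F q) \<le> B i * cantor_mass TYPE('n) (k + j)"
    and B: "\<And>i. B i \<ge> 0"
  shows "norm (tree_sum 0 (k + j) F 0 - tree_sum k j F a) \<le> (\<Sum>i<k. B i * cantor_mass TYPE('n) i)"
  using assms(1-3)
proof (induction k arbitrary: a j)
  case 0
  then show ?case by simp
next
  case (Suc k)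
  let ?V = "unit_cube_vertices :: ((real ^ 'n) \<times> real) set"
  obtain c v where a: "a = cantor_child k c v" "c \<in> cantor_corners k" "v \<in> ?V"
    using Suc.prems(1) unfolding cantor_corners.simps by blast
  have p0c: "p0 \<in> axis_cube c (cantor_side TYPE('n) k)"
    using Suc.prems(2) cantor_child_subset[OF a(3), where k=k and a=c] a(1) by blast
  have IH: "norm (tree_sum 0 (k + Suc j) F 0 - tree_sum k (Suc j) F c) \<le> (\<Sum>i<k. B i * cantor_mass TYPE('n) i)"
  proof (rule Suc.IH[OF a(2) p0c])
    fix i q assume "i < k" "q \<in> cantor_corners (k + Suc j)" "norm (p0 - q) \<ge> cantor_gap TYPE('n) * cantor_side TYPE('n) (Suc i)"
    then show "norm (F q) \<le> B i * cantor_mass TYPE('n) (k + Suc j)"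
      using Suc.prems(3)[of i q] by (simp del: cantor_corners.simps)
  qed
  have sib: "norm (tree_sum (Suc k) j F (cantor_child k c w)) \<le> B k * cantor_mass TYPE('n) (Suc k)" if w: "w \<in> ?V" "w \<noteq> v" for w
  proof -
    have cw: "cantor_child k c w \<in> cantor_corners (Suc k)" by (rule cantor_child_corner[OF a(2) w(1)])
    have "cantor_side TYPE('n) k - cantor_side TYPE('n) (Suc k) \<noteq> 0"
      using cantor_side_pos[of "TYPE('n)" k] cantor_ratio_bounds[of "TYPE('n)"] by (auto simp: cantor_side_Suc)
    then have ne: "a \<noteq> cantor_child k c w" using w(2) unfolding a(1) by simp
    have "norm (tree_sum (Suc k) j F (cantor_child k c w)) \<le> tree_sum (Suc k) j (\<lambda>q. B k * cantor_mass TYPE('n) (Suc k + j)) (cantor_child k c w)"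
    proof (rule tree_sum_norm_le[OF cw])
      fix q assume q: "q \<in> cantor_corners (Suc k + j)" "q \<in> axis_cube (cantor_child k c w) (cantor_side TYPE('n) (Suc k))"
      have "norm (p0 - q) \<ge> cantor_gap TYPE('n) * cantor_side TYPE('n) (Suc k)"
        by (rule cantor_cubes_distance[OF Suc.prems(1) cw ne Suc.prems(2) q(2)])
      then show "norm (F q) \<le> B k * cantor_mass TYPE('n) (Suc k + j)"
        by (rule Suc.prems(3)[OF lessI q(1)])
    qed
    then show ?thesis unfolding tree_sum_cantor_mass .
  qed
  have fin: "finite ?V" by (rule finite_unit_cube_vertices)
  have "tree_sum k (Suc j) F c = tree_sum (Suc k) j F a + (\<Sum>w\<in>?V - {v}. tree_sum (Suc k) j F (cantor_child k c w))"
    unfolding tree_sum.simps(2) sum.remove[OF fin a(3)] a(1) ..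
  then have "norm (tree_sum k (Suc j) F c - tree_sum (Suc k) j F a) = norm (\<Sum>w\<in>?V - {v}. tree_sum (Suc k) j F (cantor_child k c w))"
    by simp
  also have "\<dots> \<le> (\<Sum>w\<in>?V - {v}. B k * cantor_mass TYPE('n) (Suc k))"
    by (intro sum_norm_le sib) auto
  \<comment> \<open>Restoring the excluded child makes the count \<open>2 ^ (N + 1)\<close>, which
    turns the mass of generation \<open>Suc k\<close> into that of generation
    \<open>k\<close>.\<close>
  also have "\<dots> \<le> (\<Sum>w\<in>?V. B k * cantor_mass TYPE('n) (Suc k))"
    using fin B[of k] cantor_mass_pos[where 'n='n, of "Suc k"] by (intro sum_mono2) auto
  also have "\<dots> = B k * (2 ^ (CARD('n) + 1) * cantor_mass TYPE('n) (Suc k))"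
    by (simp add: card_unit_cube_vertices)
  also have "\<dots> = B k * cantor_mass TYPE('n) k" unfolding cantor_mass_Suc ..
  finally have "norm (tree_sum k (Suc j) F c - tree_sum (Suc k) j F a) \<le> B k * cantor_mass TYPE('n) k" .
  moreover have "norm (tree_sum 0 (Suc k + j) F 0 - tree_sum (Suc k) j F a)
     \<le> norm (tree_sum 0 (k + Suc j) F 0 - tree_sum k (Suc j) F c) + norm (tree_sum k (Suc j) F c - tree_sum (Suc k) j F a)"
    using norm_triangle_ineq[of "tree_sum 0 (k + Suc j) F 0 - tree_sum k (Suc j) F c" "tree_sum k (Suc j) F c - tree_sum (Suc k) j F a"] by simp
  ultimately show ?case using IH by simp
qed

lemma zero_vertex: "0 \<in> unit_cube_vertices"
  by (simp add: unit_cube_vertices_def)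

lemma top_vertex: "(0, 1) \<in> (unit_cube_vertices :: ('a::euclidean_space \<times> real) set)"
  by (auto simp: unit_cube_vertices_def Basis_prod_def)

text \<open>The chain consists of the nested cubes that have \<open>p0\<close> as the vertex
  \<open>(0, 1)\<close>, on top in time and lowest in space. Each of them passes this role to its
  child at \<open>(0, 1)\<close>, while its child at \<open>0\<close>, with the fraction
  \<open>1 / 2 ^ (N + 1)\<close> of its mass, contributes \<open>c / 2 ^ (N + 1)\<close>; the other
  children only add nonnegative terms.\<close>

lemma tree_sum_chain:
  fixes w :: "(real ^ 'n::finite) \<times> real \<Rightarrow> real"
  assumes w0: "\<And>q. w q \<ge> 0" and c0: "c \<ge> 0"
    and w: "\<And>i b q. i < K \<Longrightarrow> b + cantor_side TYPE('n) i *\<^sub>R (0, 1) = p0 \<Longrightarrow> k0 \<le> i \<Longrightarrow> q \<in> axis_cube b (cantor_side TYPE('n) (Suc i))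
      \<Longrightarrow> w q * cantor_mass TYPE('n) i \<ge> c"
    and "a \<in> cantor_corners k" "a + cantor_side TYPE('n) k *\<^sub>R (0, 1) = p0" "k + d = K" "d \<le> j" "k0 \<le> k"
  shows "tree_sum k j (\<lambda>q. w q * cantor_mass TYPE('n) (k + j)) a \<ge> real d * (c / 2 ^ (CARD('n) + 1))"
  using assms(4-)
proof (induction d arbitrary: k j a)
  case 0
  have "tree_sum k j (\<lambda>q. 0) a \<le> tree_sum k j (\<lambda>q. w q * cantor_mass TYPE('n) (k + j)) a"
    using w0 cantor_mass_pos[where 'n='n, of "k + j"] by (intro tree_sum_mono[OF 0(1)]) auto
  then show ?case using tree_sum_const[of k j "0::real" a] by simp
next
  case (Suc d)
  let ?V = "unit_cube_vertices :: ((real ^ 'n) \<times> real) set"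
  obtain j' where j: "j = Suc j'" using Suc.prems(4) by (cases j) auto
  let ?F = "\<lambda>q. w q * cantor_mass TYPE('n) (k + j)"
  let ?S = "\<lambda>v. tree_sum (Suc k) j' ?F (cantor_child k a v)"
  have kj: "k + j = Suc k + j'" by (simp add: j)
  have nn: "?S v \<ge> 0" if "v \<in> ?V" for v
  proof -
    have "tree_sum (Suc k) j' (\<lambda>q. 0) (cantor_child k a v) \<le> ?S v"
      using w0 cantor_mass_pos[where 'n='n, of "k + j"]
      by (intro tree_sum_mono[OF cantor_child_corner[OF Suc.prems(1) that]]) auto
    then show ?thesis using tree_sum_const[of "Suc k" j' "0::real" "cantor_child k a v"] by simp
  qed
  have 1: "?S (0, 1) \<ge> real d * (c / 2 ^ (CARD('n) + 1))"
    unfolding kj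
  proof (rule Suc.IH)
    show "cantor_child k a (0, 1) \<in> cantor_corners (Suc k)" by (rule cantor_child_corner[OF Suc.prems(1) top_vertex])
    show "cantor_child k a (0, 1) + cantor_side TYPE('n) (Suc k) *\<^sub>R (0, 1) = p0"
      unfolding Suc.prems(2)[symmetric] by (simp add: scaleR_diff_left)
  qed (use Suc.prems j in auto)
  have 2: "?S 0 \<ge> c / 2 ^ (CARD('n) + 1)"
  proof -
    have a: "a \<in> cantor_corners (Suc k)" using cantor_child_corner[OF Suc.prems(1) zero_vertex] by simp
    have "tree_sum (Suc k) j' (\<lambda>q. (c / cantor_mass TYPE('n) k) * cantor_mass TYPE('n) (Suc k + j')) a \<le> tree_sum (Suc k) j' ?F a"
    proof (rule tree_sum_mono[OF a])
      fix q assume q: "q \<in> axis_cube a (cantor_side TYPE('n) (Suc k))"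
      have "w q * cantor_mass TYPE('n) k \<ge> c"
        by (rule w[OF _ Suc.prems(2) _ q]) (use Suc.prems in auto)
      then have "c / cantor_mass TYPE('n) k \<le> w q" using cantor_mass_pos[where 'n='n, of k] by (simp add: divide_le_eq)
      then show "(c / cantor_mass TYPE('n) k) * cantor_mass TYPE('n) (Suc k + j') \<le> ?F q"
        unfolding kj using cantor_mass_pos[where 'n='n, of "Suc k + j'"] by (intro mult_right_mono) auto
    qed
    then have "(c / cantor_mass TYPE('n) k) * cantor_mass TYPE('n) (Suc k) \<le> tree_sum (Suc k) j' ?F a"
      unfolding tree_sum_cantor_mass .
    moreover have "(c / cantor_mass TYPE('n) k) * cantor_mass TYPE('n) (Suc k) = c / 2 ^ (CARD('n) + 1)"
      unfolding cantor_mass_Suc[symmetric, of k, where 'n='n] using cantor_side_pos[of "TYPE('n)" "Suc k"] by simp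
    ultimately show ?thesis by simp
  qed
  have "?S (0, 1) + ?S 0 = (\<Sum>v\<in>{(0, 1), 0}. ?S v)" by (simp add: zero_prod_def)
  also have "\<dots> \<le> (\<Sum>v\<in>?V. ?S v)"
    using nn zero_vertex top_vertex by (intro sum_mono2 finite_unit_cube_vertices) auto
  also have "\<dots> = tree_sum k j ?F a" unfolding j by simp
  finally have "?S (0, 1) + ?S 0 \<le> tree_sum k j ?F a" .
  moreover have "real (Suc d) * (c / 2 ^ (CARD('n) + 1)) = real d * (c / 2 ^ (CARD('n) + 1)) + c / 2 ^ (CARD('n) + 1)"
    by (simp only: of_nat_Suc distrib_right mult_1)
  ultimately show ?case using 1 2 by linarith
qed

lemma cantor_corner_in_unit_cube:
  "q \<in> cantor_corners n \<Longrightarrow> axis_cube q (cantor_side TYPE('n) n) \<subseteq> axis_cube (0 :: (real ^ 'n::finite) \<times> real) 1"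
proof (induction n arbitrary: q)
  case (Suc n)
  then obtain c v where "q = cantor_child n c v" "c \<in> cantor_corners n" "v \<in> unit_cube_vertices"
    unfolding cantor_corners.simps by blast
  then show ?case using Suc.IH[of c] cantor_child_subset[of v, where k=n and a=c] by blast
qed simp

lemma poisson_le:
  assumes "s > 0" "\<rho> > 0" "\<rho> \<le> norm (u, s)"
  shows "poisson s (u :: 'a::euclidean_space) \<le> poisson_const TYPE('a) * s * (1 / \<rho>) ^ (DIM('a) + 1)"
proof -
  have "poisson s u \<le> poisson_const TYPE('a) * s / \<rho> ^ (DIM('a) + 1)"
    unfolding poisson_def using assms
    by (intro divide_left_mono power_mono mult_nonneg_nonneg less_imp_le[OF poisson_const_pos] mult_pos_pos zero_less_power norm_Pair_pos) auto
  then show ?thesis by (simp add: power_divide)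
qed

lemma poisson_ge:
  assumes "s' > 0" "s' \<le> s" "norm (u, s) \<le> \<rho>"
  shows "poisson s (u :: 'a::euclidean_space) \<ge> poisson_const TYPE('a) * s' / \<rho> ^ (DIM('a) + 1)"
  unfolding poisson_def using assms
  by (intro frac_le mult_left_mono power_mono mult_nonneg_nonneg less_imp_le[OF poisson_const_pos] zero_less_power norm_Pair_pos) auto

lemma sum_half_powers: "(\<Sum>i<k. (1 / 2 :: real) ^ (k - Suc i)) \<le> 2"
proof -
  have "(\<Sum>i<k. (1 / 2 :: real) ^ i) = 2 - 2 * (1 / 2) ^ k" by (induction k) auto
  then show ?thesis using sum.nat_diff_reindex[of "\<lambda>i. (1 / 2 :: real) ^ i" k] by simp
qed

lemma cantor_side_tendsto_0: "C \<ge> 0 \<Longrightarrow> \<exists>n. \<forall>j\<ge>n. C * cantor_side T j \<le> 1"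
proof -
  assume C: "C \<ge> 0"
  have r: "0 < cantor_ratio T" "cantor_ratio T < 1" using cantor_ratio_bounds[of T] by auto
  obtain n where n: "cantor_ratio T ^ n < 1 / (C + 1)"
    using real_arch_pow_inv[of "1 / (C + 1)" "cantor_ratio T"] C r by auto
  have "C * cantor_side T j \<le> 1" if "j \<ge> n" for j
  proof -
    have "cantor_side T j \<le> cantor_ratio T ^ n" unfolding cantor_side_eq_power using that r by (intro power_decreasing) auto
    then have "C * cantor_side T j \<le> C * (1 / (C + 1))" using n C by (intro mult_left_mono) auto
    also have "\<dots> \<le> 1" using C by simp
    finally show ?thesis .
  qed
  then show ?thesis by blast
qed

section \<open>Pointwise bounds for the cut-off kernel with apex above \<open>p0\<close>\<close>

context
  fixes \<theta> :: "real \<Rightarrow> real" and k m :: nat and p0 :: "(real ^ 'n::finite) \<times> real"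
  assumes \<theta>_range: "\<And>t. 0 \<le> \<theta> t \<and> \<theta> t \<le> 1"
    and \<theta>_late: "\<And>t. t \<ge> snd p0 + cantor_side TYPE('n) (k + m) / 2 \<Longrightarrow> \<theta> t = 0"
    and \<theta>_early: "\<And>t. t \<le> snd p0 - 2 * cantor_side TYPE('n) k \<Longrightarrow> \<theta> t = 0"
    and \<theta>_one: "\<And>t. snd p0 - cantor_side TYPE('n) k \<le> t \<Longrightarrow> t \<le> snd p0 \<Longrightarrow> \<theta> t = 1"
begin

definition truncated_kernel :: "(real ^ 'n) \<times> real \<Rightarrow> real" where
  "truncated_kernel q = \<theta> (snd q) * poisson (snd p0 + cantor_side TYPE('n) (k + m) - snd q) (fst q - fst p0)"

text \<open>The late end of \<open>\<theta>\<close> keeps the height below the apex at least half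
  the side of generation \<open>k + m\<close>. The early end allows twice the side of generation
  \<open>k\<close>, to which the elevation of the apex adds at most one more, whence the 3.\<close>

lemma truncated_kernel_cases:
  obtains "truncated_kernel q = 0"
  | "snd p0 + cantor_side TYPE('n) (k + m) - snd q \<ge> cantor_side TYPE('n) (k + m) / 2"
    "snd p0 + cantor_side TYPE('n) (k + m) - snd q \<le> 3 * cantor_side TYPE('n) k"
    "0 \<le> truncated_kernel q"
    "truncated_kernel q \<le> poisson (snd p0 + cantor_side TYPE('n) (k + m) - snd q) (fst q - fst p0)"
proof (cases "\<theta> (snd q) = 0")
  case True
  then show ?thesis using that(1) by (simp add: truncated_kernel_def)
next
  case False
  let ?s = "snd p0 + cantor_side TYPE('n) (k + m) - snd q"
  have r: "cantor_side TYPE('n) (k + m) > 0" by (rule cantor_side_pos)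
  have rl: "cantor_side TYPE('n) (k + m) \<le> cantor_side TYPE('n) k"
    unfolding cantor_side_eq_power using cantor_ratio_bounds[of "TYPE('n)"] by (intro power_decreasing) auto
  have 1: "?s \<ge> cantor_side TYPE('n) (k + m) / 2" using False \<theta>_late[of "snd q"] by argo
  have 2: "?s \<le> 3 * cantor_side TYPE('n) k" using False \<theta>_early[of "snd q"] rl by argo
  have p: "poisson ?s (fst q - fst p0) \<ge> 0" using 1 r by (intro poisson_nonneg) auto
  show ?thesis
    using that(2)[OF 1 2] \<theta>_range[of "snd q"] p by (simp add: truncated_kernel_def mult_left_le_one_le)
qed

lemma truncated_kernel_nonneg: "truncated_kernel q \<ge> 0"
  by (cases rule: truncated_kernel_cases[of q]) auto

text \<open>Since \<open>norm (u, s) \<ge> s\<close>, the kernel is at most its constant times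
  \<open>1 / s ^ N\<close>, and \<open>s\<close> is at least half the side of generation
  \<open>k + m\<close>; this is the source of \<open>2 ^ N\<close>.\<close>

lemma truncated_kernel_le:
  "truncated_kernel q * cantor_mass TYPE('n) (k + m) \<le> poisson_const TYPE(real ^ 'n) * 2 ^ CARD('n)"
proof (cases rule: truncated_kernel_cases[of q])
  case 1
  then show ?thesis using poisson_const_pos[where 'a="real ^ 'n"] by simp
next
  case 2
  let ?r = "cantor_side TYPE('n) (k + m)" and ?c = "poisson_const TYPE(real ^ 'n)"
  let ?s = "snd p0 + ?r - snd q" and ?u = "fst q - fst p0"
  have r: "?r > 0" by (rule cantor_side_pos)
  have s: "?s > 0" using 2(1) r by linarith
  have "?s \<le> norm (?u, ?s)" using norm_snd_le[of "?s" ?u] s by simp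
  then have "poisson ?s ?u \<le> ?c * ?s * (1 / ?s) ^ (CARD('n) + 1)" using poisson_le[OF s s, of ?u] by simp
  also have "\<dots> = ?c * (1 / ?s) ^ CARD('n)" using s by simp
  also have "\<dots> \<le> ?c * (2 / ?r) ^ CARD('n)"
  proof -
    have "1 / ?s \<le> 2 / ?r" using 2(1) r s by (simp add: field_simps)
    then show ?thesis using s by (intro mult_left_mono power_mono less_imp_le[OF poisson_const_pos]) auto
  qed
  finally have "truncated_kernel q * ?r ^ CARD('n) \<le> ?c * (2 / ?r) ^ CARD('n) * ?r ^ CARD('n)"
    using 2(4) r by (intro mult_right_mono) auto
  then show ?thesis using r by (simp add: power_divide)
qed

text \<open>The height in the numerator stays below three sides of generation \<open>k\<close>, so
  the kernel decays one power faster than the natural mass of a ball grows. The 2 arises because the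
  time difference between \<open>q\<close> and \<open>p0\<close> is at most twice the height below
  the apex, so that \<open>norm (p0 - q)\<close> is at most twice the norm in the kernel.\<close>

lemma truncated_kernel_far:
  assumes "\<rho> > 0" "norm (p0 - q) \<ge> \<rho>"
  shows "truncated_kernel q \<le> poisson_const TYPE(real ^ 'n) * (3 * cantor_side TYPE('n) k) * (2 / \<rho>) ^ (CARD('n) + 1)"
proof (cases rule: truncated_kernel_cases[of q])
  case 1
  show ?thesis unfolding 1
    using assms(1) by (intro mult_nonneg_nonneg less_imp_le[OF poisson_const_pos] zero_le_power less_imp_le[OF cantor_side_pos]) auto
next
  case 2
  let ?r = "cantor_side TYPE('n) (k + m)" and ?c = "poisson_const TYPE(real ^ 'n)"
  let ?s = "snd p0 + ?r - snd q" and ?u = "fst q - fst p0"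
  have r: "?r > 0" by (rule cantor_side_pos)
  have s: "?s > 0" using 2(1) r by linarith
  have "snd p0 - snd q \<le> 2 * ?s" "- (snd p0 - snd q) \<le> 2 * ?s" using 2(1) r by argo+
  then have "\<bar>snd p0 - snd q\<bar> \<le> 2 * ?s" by (simp only: abs_le_iff)
  then have "(snd p0 - snd q)\<^sup>2 \<le> (2 * ?s)\<^sup>2" using s by (intro abs_le_square_iff[THEN iffD1]) simp
  then have "(norm (p0 - q))\<^sup>2 \<le> (2 * norm (?u, ?s))\<^sup>2"
    unfolding power_mult_distrib norm_Pair_power2 by (cases p0; cases q) (simp add: norm_Pair_power2 norm_minus_commute add_increasing power_mult_distrib)
  then have "norm (p0 - q) \<le> 2 * norm (?u, ?s)" by (rule power2_le_imp_le) simp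
  then have "poisson ?s ?u \<le> ?c * ?s * (1 / (\<rho> / 2)) ^ (CARD('n) + 1)"
    using poisson_le[OF s, of "\<rho> / 2" ?u] assms by simp
  also have "\<dots> \<le> ?c * (3 * cantor_side TYPE('n) k) * (1 / (\<rho> / 2)) ^ (CARD('n) + 1)"
    using 2(2) assms(1) by (intro mult_right_mono mult_left_mono less_imp_le[OF poisson_const_pos]) auto
  finally show ?thesis using 2(4) by simp
qed

text \<open>The child at the lower corner \<open>b\<close> fills at most the lower half of its
  parent, so all of it lies between \<open>?l / 2\<close> and \<open>2 * ?l\<close> below the apex,
  and within \<open>?N * ?l\<close> of it in space. At such points the kernel is of order
  \<open>1 / ?l ^ ?N\<close>, the reciprocal of the mass of the parent.\<close>

lemma truncated_kernel_near:
  assumes i: "i < k + m" "k \<le> i" and b: "b + cantor_side TYPE('n) i *\<^sub>R (0, 1) = p0"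
    and q: "q \<in> axis_cube b (cantor_side TYPE('n) (Suc i))"
  shows "truncated_kernel q * cantor_mass TYPE('n) i \<ge> poisson_const TYPE(real ^ 'n) / (2 * real (CARD('n) + 2) ^ (CARD('n) + 1))"
proof -
  let ?N = "CARD('n)"
  let ?r = "cantor_side TYPE('n) (k + m)" and ?c = "poisson_const TYPE(real ^ 'n)" and ?l = "cantor_side TYPE('n) i"
  let ?s = "snd p0 + ?r - snd q" and ?u = "fst q - fst p0"
  have r: "?r > 0" by (rule cantor_side_pos)
  have l: "?l > 0" by (rule cantor_side_pos)
  have rl: "?r \<le> ?l" "?l \<le> cantor_side TYPE('n) k"
    unfolding cantor_side_eq_power using cantor_ratio_bounds[of "TYPE('n)"] i by (auto intro!: power_decreasing)
  have half: "cantor_side TYPE('n) (Suc i) \<le> ?l / 2"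
    using cantor_ratio_bounds[of "TYPE('n)"] l by (simp add: cantor_side_Suc)
  have b': "fst p0 = fst b" "snd p0 = snd b + ?l" using b by auto
  have "(0, 1) \<in> (Basis :: ((real ^ 'n) \<times> real) set)" by (simp add: Basis_prod_def)
  then have t: "snd b \<le> snd q" "snd q \<le> snd b + cantor_side TYPE('n) (Suc i)"
    using q unfolding mem_axis_cube by (force simp: inner_prod_def)+
  have u: "norm ?u \<le> real ?N * ?l"
  proof -
    have "norm ?u \<le> (\<Sum>c\<in>Basis. \<bar>?u \<bullet> c\<bar>)" by (rule norm_le_l1)
    also have "\<dots> \<le> (\<Sum>c\<in>(Basis :: (real ^ 'n) set). ?l)"
    proof (rule sum_mono)
      fix c :: "real ^ 'n" assume "c \<in> Basis"
      then have "(c, 0) \<in> (Basis :: ((real ^ 'n) \<times> real) set)" by (simp add: Basis_prod_def)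
      then have "b \<bullet> (c, 0) \<le> q \<bullet> (c, 0)" "q \<bullet> (c, 0) \<le> b \<bullet> (c, 0) + cantor_side TYPE('n) (Suc i)"
        using q unfolding mem_axis_cube by blast+
      then have "fst b \<bullet> c \<le> fst q \<bullet> c" "fst q \<bullet> c \<le> fst b \<bullet> c + cantor_side TYPE('n) (Suc i)"
        by (simp_all add: inner_prod_def)
      then show "\<bar>?u \<bullet> c\<bar> \<le> ?l" using half l unfolding b'(1) inner_diff_left by linarith
    qed
    finally show ?thesis by simp
  qed
  have s: "?l / 2 \<le> ?s" "?s \<le> 2 * ?l" using t half rl r unfolding b'(2) by linarith+
  have "norm (?u, ?s) \<le> norm ?u + norm ?s" by (rule norm_Pair_le)
  also have "\<dots> \<le> real (?N + 2) * ?l" using u s l by (simp add: algebra_simps)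
  finally have nb: "norm (?u, ?s) \<le> real (?N + 2) * ?l" .
  have D: "DIM(real ^ 'n) = ?N" by simp
  have l2: "?l / 2 > 0" using l by simp
  have "?c * (?l / 2) / (real (?N + 2) * ?l) ^ (?N + 1) \<le> poisson ?s ?u"
    by (rule poisson_ge[OF l2 s(1) nb, unfolded D])
  moreover have "\<theta> (snd q) = 1"
    using t half rl l unfolding b'(2) by (intro \<theta>_one) (unfold b'(2), linarith+)
  ultimately have "truncated_kernel q \<ge> ?c * (?l / 2) / (real (?N + 2) * ?l) ^ (?N + 1)"
    by (simp add: truncated_kernel_def)
  then have "truncated_kernel q * ?l ^ ?N \<ge> ?c * (?l / 2) / (real (?N + 2) * ?l) ^ (?N + 1) * ?l ^ ?N"
    using l by (intro mult_right_mono) auto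
  also have "?c * (?l / 2) / (real (?N + 2) * ?l) ^ (?N + 1) * ?l ^ ?N = ?c / (2 * real (?N + 2) ^ (?N + 1))"
  proof -
    have "(real (?N + 2) * ?l) ^ (?N + 1) = real (?N + 2) ^ (?N + 1) * (?l ^ ?N * ?l)"
      by (simp add: power_mult_distrib)
    then show ?thesis using l by (simp only: field_simps) simp
  qed
  finally show ?thesis .
qed

end

section \<open>The nearly extremal cube and the contradiction\<close>

lemma near_maximiser:
  fixes \<nu> :: "nat \<Rightarrow> (real ^ 'n::finite) \<times> real \<Rightarrow> complex"
  assumes C: "\<And>k a. a \<in> cantor_corners k \<Longrightarrow> norm (\<nu> k a) \<le> C * cantor_mass TYPE('n) k"
    and nz: "a0 \<in> cantor_corners k0" "\<nu> k0 a0 \<noteq> 0"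
  obtains D where "D > 0" "\<And>k a. a \<in> cantor_corners k \<Longrightarrow> norm (\<nu> k a) \<le> D * cantor_mass TYPE('n) k"
    "\<And>\<epsilon>. \<epsilon> > 0 \<Longrightarrow> \<exists>k. \<exists>a\<in>cantor_corners k. norm (\<nu> k a) > D * (1 - \<epsilon>) * cantor_mass TYPE('n) k"
proof -
  let ?\<mu> = "cantor_mass TYPE('n)"
  define S where "S = {norm (\<nu> k a) / ?\<mu> k | k a. a \<in> cantor_corners k}"
  define D where "D = Sup S"
  have bdd: "bdd_above S"
    unfolding S_def bdd_above_def using C cantor_mass_pos[where 'n='n] by (auto simp: divide_le_eq intro!: exI[of _ C] simp del: cantor_corners.simps)
  have ne: "S \<noteq> {}" unfolding S_def using nz(1) by blast
  have ub: "norm (\<nu> k a) / ?\<mu> k \<le> D" if "a \<in> cantor_corners k" for k a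
    unfolding D_def using that by (intro cSup_upper[OF _ bdd]) (unfold S_def, blast)
  have "D > 0"
  proof -
    have "0 < norm (\<nu> k0 a0) / ?\<mu> k0" using nz(2) cantor_mass_pos[where 'n='n, of k0] by simp
    then show ?thesis using ub[OF nz(1)] by linarith
  qed
  moreover have "norm (\<nu> k a) \<le> D * ?\<mu> k" if "a \<in> cantor_corners k" for k a
    using ub[OF that] cantor_mass_pos[where 'n='n, of k] by (simp add: divide_le_eq)
  moreover have "\<exists>k. \<exists>a\<in>cantor_corners k. norm (\<nu> k a) > D * (1 - \<epsilon>) * ?\<mu> k" if "\<epsilon> > 0" for \<epsilon>
  proof -
    have "D * (1 - \<epsilon>) < Sup S" using \<open>D > 0\<close> that by (simp add: D_def[symmetric] algebra_simps)
    then obtain y where "y \<in> S" "D * (1 - \<epsilon>) < y" using less_cSup_iff[OF ne bdd] by blast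
    moreover from this obtain k a where ka: "a \<in> cantor_corners k" "y = norm (\<nu> k a) / ?\<mu> k" unfolding S_def by blast
    ultimately have "D * (1 - \<epsilon>) * ?\<mu> k < norm (\<nu> k a)"
      using cantor_mass_pos[where 'n='n, of k] by (simp add: less_divide_eq)
    then show ?thesis using ka(1) by blast
  qed
  ultimately show ?thesis using that by blast
qed

lemma theta_distr_cantor_bump_eq_0:
  fixes f :: "(real ^ 'n::finite) \<times> real \<Rightarrow> real"
  assumes f: "f \<in> borel_measurable lebesgue" and M: "\<And>p. \<bar>f p\<bar> \<le> M"
    and hc: "half_caloric_on (- cantor_set) f" and corner: "a0 \<in> cantor_corners k0"
  shows "theta_distr f (cantor_bump k0 a0) = 0"
proof (rule ccontr)
  let ?N = "CARD('n)" and ?l = "cantor_side TYPE('n)" and ?\<mu> = "cantor_mass TYPE('n)" and ?g = "cantor_gap TYPE('n)"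
  let ?c = "poisson_const TYPE(real ^ 'n)"
  define \<nu> where "\<nu> = (\<lambda>k a. theta_distr f (cantor_bump k a))"
  assume "theta_distr f (cantor_bump k0 a0) \<noteq> 0"
  then have nz: "\<nu> k0 a0 \<noteq> 0" by (simp add: \<nu>_def)
  have M0: "M \<ge> 0" by (rule M_nonneg[OF f M])
  obtain C0 where C0: "\<And>k a. norm (\<nu> k a) \<le> C0 * ?\<mu> k"
    using theta_distr_bump_bound[OF f M] unfolding \<nu>_def by metis
  obtain D where D: "D > 0" "\<And>k a. a \<in> cantor_corners k \<Longrightarrow> norm (\<nu> k a) \<le> D * ?\<mu> k"
    "\<And>\<epsilon>. \<epsilon> > 0 \<Longrightarrow> \<exists>k. \<exists>a\<in>cantor_corners k. norm (\<nu> k a) > D * (1 - \<epsilon>) * ?\<mu> k"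
    using near_maximiser[of \<nu>, OF C0 corner nz] by blast
  obtain V where V: "V \<ge> 0"
    "\<And>t0 l r :: real. l > 0 \<Longrightarrow> r > 0 \<Longrightarrow> \<exists>\<theta> \<theta>'. (\<forall>k. smooth_upto k UNIV \<theta>) \<and> (\<forall>t. (\<theta> has_real_derivative \<theta>' t) (at t))
       \<and> \<theta>' \<in> borel_measurable borel \<and> (\<forall>t. 0 \<le> \<theta> t \<and> \<theta> t \<le> 1) \<and> (\<forall>t\<ge>t0 + r / 2. \<theta> t = 0) \<and> (\<forall>t\<le>t0 - 2 * l. \<theta> t = 0)
       \<and> (\<forall>t. t0 - l \<le> t \<longrightarrow> t \<le> t0 \<longrightarrow> \<theta> t = 1) \<and> (\<integral>\<^sup>+t. ennreal \<bar>\<theta>' t\<bar> \<partial>lborel) \<le> ennreal V"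
    using time_cutoff by blast
  \<comment> \<open>\<open>c1\<close> is the lower bound of \<open>truncated_kernel_near\<close>. In
    \<open>K4\<close> the last factor is the number of children of a cube, the other factors come
    from \<open>truncated_kernel_far\<close>.\<close>
  define c1 where "c1 = ?c / (2 * real (?N + 2) ^ (?N + 1))"
  define K4 where "K4 = ?c * 3 * (2 / ?g) ^ (?N + 1) * 2 ^ (?N + 1)"
  have cpos: "?c > 0" by (rule poisson_const_pos)
  have gpos: "?g > 0" by (rule cantor_gap_pos)
  have c1: "c1 > 0" using cpos by (simp add: c1_def)
  have K4: "K4 \<ge> 0" using cpos gpos by (simp add: K4_def)
  \<comment> \<open>The left-hand side grows linearly in \<open>m\<close>, while \<open>D\<close>,
    \<open>V\<close> and all other constants are fixed before \<open>m\<close>.\<close>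
  have main: "D * (real m * (c1 / 2 ^ (?N + 1)) - ?c * 2 ^ ?N - 2 * K4) \<le> M * (V + 1) + 1" for m
  proof -
    obtain k a where a: "a \<in> cantor_corners k" "norm (\<nu> k a) > D * (1 - ?\<mu> m) * ?\<mu> k"
      using D(3)[OF cantor_mass_pos, of m] by blast
    define p0 where "p0 = a + ?l k *\<^sub>R (0, 1)"
    define r where "r = ?l (k + m)"
    have l: "?l k > 0" by (rule cantor_side_pos)
    have r: "r > 0" unfolding r_def by (rule cantor_side_pos)
    obtain \<theta> \<theta>' where \<theta>: "\<And>k. smooth_upto k UNIV \<theta>" "\<And>t. (\<theta> has_real_derivative \<theta>' t) (at t)"
      "\<theta>' \<in> borel_measurable borel" "\<And>t. 0 \<le> \<theta> t \<and> \<theta> t \<le> 1" "\<And>t. t \<ge> snd p0 + r / 2 \<Longrightarrow> \<theta> t = 0"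
      "\<And>t. t \<le> snd p0 - 2 * ?l k \<Longrightarrow> \<theta> t = 0" "\<And>t. snd p0 - ?l k \<le> t \<Longrightarrow> t \<le> snd p0 \<Longrightarrow> \<theta> t = 1"
      "(\<integral>\<^sup>+t. ennreal \<bar>\<theta>' t\<bar> \<partial>lborel) \<le> ennreal V"
      using V(2)[OF l r, of "snd p0"] by blast
    define w where "w = truncated_kernel \<theta> k m p0"
    note \<theta>k = \<theta>(4) \<theta>(5)[unfolded r_def] \<theta>(6) \<theta>(7)
    have w0: "w q \<ge> 0" for q unfolding w_def by (rule truncated_kernel_nonneg[OF \<theta>k])
    have p0_cube: "p0 \<in> axis_cube a (?l k)"
      unfolding mem_axis_cube
    proof
      fix b :: "(real ^ 'n) \<times> real" assume "b \<in> Basis"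
      then show "a \<bullet> b \<le> p0 \<bullet> b \<and> p0 \<bullet> b \<le> a \<bullet> b + ?l k"
        using vertex_inner[OF top_vertex, of b] l unfolding p0_def inner_add_left inner_scaleR_left by auto
    qed
    then have p0_unit: "p0 \<in> axis_cube 0 1" using cantor_corner_in_unit_cube[OF a(1)] by blast
    obtain \<Phi> where \<Phi>: "test_function_on UNIV \<Phi>"
      "\<And>x t. (\<And>b. b \<in> Basis \<Longrightarrow> \<bar>(x - fst p0) \<bullet> b\<bar> \<le> 1) \<Longrightarrow> \<Phi> (x, t) = of_real (\<theta> t * poisson (snd p0 + r - t) (x - fst p0))"
      "(\<integral>\<^sup>+p. ennreal (norm (theta_transpose \<Phi> p)) \<partial>lborel) \<le> ennreal (V + 1)"
    \<comment> \<open>The apex is at time \<open>snd p0 + r\<close>, and \<open>s0 = r / 2\<close>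
      because \<open>\<theta>\<close> ends halfway between \<open>p0\<close> and the apex;
      \<open>S\<close> reaches back from the apex to where \<open>\<theta>\<close> begins.\<close>
    proof (rule truncated_poisson[where \<theta>=\<theta> and \<theta>'=\<theta>' and ?s0.0="r / 2" and ?t1.0="snd p0 + r" and S="2 * ?l k + r" and V=V and ?x0.0="fst p0"])
      show "\<bar>\<theta> t\<bar> \<le> 1" for t using \<theta>(4)[of t] by simp
      show "\<theta> t = 0" if "t \<ge> snd p0 + r - r / 2" for t using that by (intro \<theta>(5)) simp
      show "\<theta> t = 0" if "t \<le> snd p0 + r - (2 * ?l k + r)" for t using that by (intro \<theta>(6)) simp
    qed (use r \<theta> V(1) in auto)
    have \<Phi>w: "\<Phi> q = of_real (w q)" if q: "q \<in> axis_cube 0 1" for q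
    proof -
      have "\<bar>(fst q - fst p0) \<bullet> b\<bar> \<le> 1" if "b \<in> Basis" for b
      proof -
        have "(b, 0) \<in> (Basis :: ((real ^ 'n) \<times> real) set)" using that by (simp add: Basis_prod_def)
        then have "0 \<le> fst q \<bullet> b" "fst q \<bullet> b \<le> 1" "0 \<le> fst p0 \<bullet> b" "fst p0 \<bullet> b \<le> 1"
          using q p0_unit unfolding mem_axis_cube by (force simp: inner_prod_def)+
        then show ?thesis unfolding inner_diff_left by linarith
      qed
      from \<Phi>(2)[of "fst q" "snd q", OF this] show ?thesis by (simp add: w_def truncated_kernel_def[OF \<theta>k] r_def)
    qed
    have corner_unit: "q \<in> axis_cube 0 1" if "q \<in> cantor_corners n" for q :: "(real ^ 'n) \<times> real" and n
      using cantor_corner_in_unit_cube[OF that] corner_in_axis_cube[OF less_imp_le[OF cantor_side_pos], of q "TYPE('n)" n] by blast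
    obtain C where C: "C \<ge> 0"
      "\<And>n. norm (theta_distr f \<Phi> - tree_sum 0 n (\<lambda>a. \<Phi> a * theta_distr f (cantor_bump n a)) 0) \<le> C * ?l n"
      using theta_distr_approx[OF f M hc \<Phi>(1)] by blast
    obtain n0 where n0: "\<And>j. j \<ge> n0 \<Longrightarrow> C * ?l j \<le> 1" using cantor_side_tendsto_0[OF C(1)] by blast
    \<comment> \<open>\<open>C\<close> depends on \<open>\<Phi>\<close> and hence on
      \<open>m\<close>, so the generation of the Riemann sum is fixed only now: fine enough for an
      error of at most 1, and at least \<open>m\<close> generations below the cube to leave room for
      the chain.\<close>
    define j where "j = max m n0"
    define n where "n = k + j"
    define F where "F = (\<lambda>q. \<Phi> q * \<nu> n q)"
    have up: "norm (tree_sum 0 n F 0) \<le> M * (V + 1) + 1"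
    proof -
      have "ennreal (norm (theta_distr f \<Phi>)) \<le> ennreal M * (\<integral>\<^sup>+p. ennreal (norm (theta_transpose \<Phi> p)) \<partial>lborel)"
        by (rule theta_distr_bound[OF f M \<Phi>(1)])
      also have "\<dots> \<le> ennreal M * ennreal (V + 1)" by (intro mult_left_mono \<Phi>(3)) simp
      also have "\<dots> = ennreal (M * (V + 1))" using M0 V(1) by (simp only: ennreal_mult add_nonneg_nonneg zero_le_one)
      finally have 1: "norm (theta_distr f \<Phi>) \<le> M * (V + 1)" using M0 V(1) by (subst (asm) ennreal_le_iff) auto
      have 2: "norm (theta_distr f \<Phi> - tree_sum 0 n F 0) \<le> 1"
        using C(2)[of n] n0[of n] unfolding F_def \<nu>_def n_def j_def by (meson le_max_iff_disj order_trans le_add2 order_refl max.cobounded2)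
      show ?thesis using 1 2 norm_triangle_ineq3[of "tree_sum 0 n F 0" "theta_distr f \<Phi>"]
        by (simp add: norm_minus_commute abs_le_iff)
    qed
    define B where "B = (\<lambda>i. D * (?c * (3 * ?l k) * (2 / (?g * ?l (Suc i))) ^ (?N + 1)))"
    have B0: "B i \<ge> 0" for i
      unfolding B_def using D(1) cpos gpos cantor_side_pos[of "TYPE('n)" "Suc i"] l by (intro mult_nonneg_nonneg zero_le_power) auto
    have out: "norm (tree_sum 0 (k + j) F 0 - tree_sum k j F a) \<le> (\<Sum>i<k. B i * ?\<mu> i)"
    proof (rule tree_sum_outside[OF a(1) p0_cube _ B0])
      fix i q assume q: "q \<in> cantor_corners (k + j)" "norm (p0 - q) \<ge> ?g * ?l (Suc i)"
      have 1: "w q \<le> ?c * (3 * ?l k) * (2 / (?g * ?l (Suc i))) ^ (?N + 1)"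
        unfolding w_def using q(2) gpos cantor_side_pos[of "TYPE('n)" "Suc i"]
        by (intro truncated_kernel_far[OF \<theta>k]) auto
      have 2: "norm (\<nu> n q) \<le> D * ?\<mu> n" using D(2) q(1) by (simp only: n_def)
      have 3: "norm (F q) = w q * norm (\<nu> n q)"
        unfolding F_def \<Phi>w[OF corner_unit[OF q(1)]] using w0[of q] by (simp add: norm_mult)
      have "norm (F q) \<le> (?c * (3 * ?l k) * (2 / (?g * ?l (Suc i))) ^ (?N + 1)) * (D * ?\<mu> n)"
        unfolding 3 by (rule mult_mono[OF 1 2 order_trans[OF w0 1] norm_ge_zero])
      then show "norm (F q) \<le> B i * ?\<mu> (k + j)" by (simp only: B_def n_def mult_ac)
    qed
    also have "(\<Sum>i<k. B i * ?\<mu> i) \<le> (\<Sum>i<k. D * K4 * (1 / 2) ^ (k - Suc i))"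
    proof (rule sum_mono)
      fix i assume i: "i \<in> {..<k}"
      define L where "L = ?l (Suc i)"
      have L: "L > 0" unfolding L_def by (rule cantor_side_pos)
      \<comment> \<open>The mass of generation \<open>i\<close> supplies \<open>L ^ ?N\<close>
        against the \<open>L ^ (?N + 1)\<close> in the denominator of the far bound. The surplus
        \<open>?l k / L\<close> is a power of the contraction ratio, so the sum over
        \<open>i\<close> is geometric.\<close>
      have "?\<mu> i = 2 ^ (?N + 1) * L ^ ?N" unfolding L_def cantor_mass_Suc ..
      then have "B i * ?\<mu> i = D * K4 * (?l k / L)"
        unfolding B_def L_def[symmetric] K4_def using L gpos by (simp add: power_divide power_mult_distrib field_simps)
      also have "?l k / L = cantor_ratio TYPE('n) ^ (k - Suc i)"
      proof -
        have "k = (k - Suc i) + Suc i" using i by simp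
        then have "?l k = cantor_ratio TYPE('n) ^ (k - Suc i) * L"
          unfolding L_def cantor_side_eq_power by (metis power_add)
        then show ?thesis using L by simp
      qed
      also have "D * K4 * cantor_ratio TYPE('n) ^ (k - Suc i) \<le> D * K4 * (1 / 2) ^ (k - Suc i)"
        using D(1) K4 cantor_ratio_bounds[of "TYPE('n)"] by (intro mult_left_mono power_mono) auto
      finally show "B i * ?\<mu> i \<le> D * K4 * (1 / 2) ^ (k - Suc i)" .
    qed
    also have "\<dots> \<le> D * K4 * 2"
      unfolding sum_distrib_left[symmetric] using D(1) K4 by (intro mult_left_mono sum_half_powers) auto
    finally have out': "norm (tree_sum 0 n F 0 - tree_sum k j F a) \<le> D * K4 * 2" by (simp only: n_def)
    have \<nu>0: "\<nu> k a \<noteq> 0"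
    proof -
      have "?\<mu> m \<le> 1" using cantor_side_le_1[of "TYPE('n)" m] cantor_side_pos[of "TYPE('n)" m] by (intro power_le_one) auto
      then have "0 \<le> D * (1 - ?\<mu> m) * ?\<mu> k" using D(1) cantor_mass_pos[where 'n='n, of k] by (intro mult_nonneg_nonneg) auto
      then show ?thesis using a(2) by auto
    qed
    define c where "c = cnj (\<nu> k a) / of_real (norm (\<nu> k a))"
    have nc: "norm c = 1" using \<nu>0 by (simp add: c_def norm_divide)
    have c\<nu>: "c * \<nu> k a = of_real (norm (\<nu> k a))"
      using \<nu>0 complex_norm_square[of "\<nu> k a", symmetric] by (simp add: c_def power2_eq_square mult.commute)
    \<comment> \<open>the defect \<open>D ?\<mu> n - Re (c * \<nu> n q)\<close> is nonnegative with total at most \<open>D ?\<mu> m ?\<mu> k\<close>, which is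
      so small that multiplying it by the maximum \<open>W\<close> of the kernel loses only a constant\<close>
    define W where "W = ?c * 2 ^ ?N / ?\<mu> (k + m)"
    have wW: "w q \<le> W" for q
      using truncated_kernel_le[where \<theta>=\<theta> and k=k and m=m and ?p0.0=p0 and q=q, OF \<theta>k] cantor_mass_pos[where 'n='n, of "k + m"] by (simp add: W_def w_def le_divide_eq)
    have W\<mu>: "W * (?\<mu> m * ?\<mu> k) = ?c * 2 ^ ?N"
      using cantor_side_pos[of "TYPE('n)" m] cantor_side_pos[of "TYPE('n)" k] by (simp add: W_def cantor_mass_add)
    have W0: "W \<ge> 0" using w0 wW order_trans by blast
    have Rec: "tree_sum k j (\<lambda>q. Re (c * \<nu> n q)) a = norm (\<nu> k a)"
    proof -
      have "tree_sum k j (\<nu> (k + j)) a = \<nu> k a"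
        by (rule tree_sum_additive[OF _ a(1)]) (unfold \<nu>_def, rule theta_distr_bump_children[OF f M hc])
      then have "Re (c * tree_sum k j (\<nu> n) a) = norm (\<nu> k a)" by (simp add: n_def c\<nu>)
      then show ?thesis by (simp only: tree_sum_cmult[symmetric] tree_sum_Re)
    qed
    \<comment> \<open>Termwise the inequality below says
      \<open>0 \<le> (W - w q) * (D * ?\<mu> n - Re (c * \<nu> n q))\<close>. Replacing the weight
      of the defect by the maximum \<open>W\<close> decouples it from the kernel, so that only the
      total defect of the cube is left.\<close>
    have "D * tree_sum k j (\<lambda>q. w q * ?\<mu> n) a - W * (D * ?\<mu> k - norm (\<nu> k a))
       = tree_sum k j (\<lambda>q. D * (w q * ?\<mu> n) - W * (D * ?\<mu> n - Re (c * \<nu> n q))) a"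
      unfolding tree_sum_diff tree_sum_cmult[of k j W] tree_sum_cmult[of k j D "\<lambda>q. w q * ?\<mu> n"] Rec
      using tree_sum_cantor_mass[of k j D a] by (simp only: n_def)
    also have "\<dots> \<le> tree_sum k j (\<lambda>q. Re (c * F q)) a"
    proof (rule tree_sum_mono[OF a(1)])
      fix q :: "(real ^ 'n) \<times> real" assume q: "q \<in> cantor_corners (k + j)"
      have "Re (c * \<nu> n q) \<le> norm (c * \<nu> n q)" by (rule complex_Re_le_cmod)
      also have "\<dots> \<le> D * ?\<mu> n" using D(2)[OF q] nc by (simp add: norm_mult n_def)
      finally have "0 \<le> (W - w q) * (D * ?\<mu> n - Re (c * \<nu> n q))"
        using wW[of q] by (intro mult_nonneg_nonneg) auto
      moreover have "Re (c * F q) = w q * Re (c * \<nu> n q)"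
        unfolding F_def \<Phi>w[OF corner_unit[OF q]] by (simp add: algebra_simps)
      ultimately show "D * (w q * ?\<mu> n) - W * (D * ?\<mu> n - Re (c * \<nu> n q)) \<le> Re (c * F q)"
        by (simp add: algebra_simps)
    qed
    also have "\<dots> = Re (c * tree_sum k j F a)" by (simp only: tree_sum_cmult[symmetric] tree_sum_Re)
    also have "\<dots> \<le> norm (c * tree_sum k j F a)" by (rule complex_Re_le_cmod)
    also have "\<dots> = norm (tree_sum k j F a)" by (simp add: norm_mult nc)
    finally have inside: "D * tree_sum k j (\<lambda>q. w q * ?\<mu> n) a - W * (D * ?\<mu> k - norm (\<nu> k a)) \<le> norm (tree_sum k j F a)" .
    have "W * (D * ?\<mu> k - norm (\<nu> k a)) \<le> W * (D * (?\<mu> m * ?\<mu> k))"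
      using a(2) W0 by (intro mult_left_mono) (auto simp: algebra_simps)
    also have "\<dots> = D * (?c * 2 ^ ?N)" unfolding W\<mu>[symmetric] by (simp only: mult_ac)
    finally have loss: "W * (D * ?\<mu> k - norm (\<nu> k a)) \<le> D * (?c * 2 ^ ?N)" .
    have "tree_sum k j (\<lambda>q. w q * ?\<mu> (k + j)) a \<ge> real m * (c1 / 2 ^ (?N + 1))"
    proof (rule tree_sum_chain[where K="k + m" and ?k0.0=k])
      show "w q * ?\<mu> i \<ge> c1" if "i < k + m" "b + ?l i *\<^sub>R (0, 1) = p0" "k \<le> i" "q \<in> axis_cube b (?l (Suc i))" for i b q
        unfolding w_def c1_def by (rule truncated_kernel_near[OF \<theta>k that(1,3,2,4)])
    qed (use w0 c1 a(1) in \<open>auto simp: p0_def j_def\<close>)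
    then have "D * (real m * (c1 / 2 ^ (?N + 1))) \<le> D * tree_sum k j (\<lambda>q. w q * ?\<mu> n) a"
      using D(1) by (simp only: n_def) (intro mult_left_mono, auto)
    moreover have "norm (tree_sum k j F a) \<le> norm (tree_sum 0 n F 0) + norm (tree_sum 0 n F 0 - tree_sum k j F a)"
      using norm_triangle_ineq4[of "tree_sum 0 n F 0" "tree_sum 0 n F 0 - tree_sum k j F a"] by simp
    moreover have "D * (real m * (c1 / 2 ^ (?N + 1)) - ?c * 2 ^ ?N - 2 * K4)
       = D * (real m * (c1 / 2 ^ (?N + 1))) - D * (?c * 2 ^ ?N) - D * K4 * 2" by (simp only: right_diff_distrib mult_ac)
    ultimately show ?thesis using inside loss up out' by linarith
  qed
  define e where "e = c1 / 2 ^ (?N + 1)"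
  have e: "e > 0" using c1 by (simp add: e_def)
  obtain m where m: "real m * (D * e) > M * (V + 1) + 1 + D * (?c * 2 ^ ?N) + D * (2 * K4)"
    using reals_Archimedean3[of "D * e"] D(1) e by (meson mult_pos_pos)
  show False using main[of m] m unfolding e_def[symmetric] by (simp add: algebra_simps)
qed

theorem theorem5p3:
  "removable_bounded_half_caloric (cantor_set :: ((real ^ 'n::finite) \<times> real) set)"
  unfolding removable_bounded_half_caloric_def
proof (intro conjI allI impI compact_cantor_set)
  fix f :: "(real ^ 'n) \<times> real \<Rightarrow> real"
  assume "f \<in> borel_measurable lebesgue \<and> bounded (range f) \<and> half_caloric_on (- cantor_set) f"
  then have f: "f \<in> borel_measurable lebesgue" and b: "bounded (range f)" and hc: "half_caloric_on (- cantor_set) f" by auto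
  obtain M where "\<forall>y\<in>range f. norm y \<le> M" using b unfolding bounded_iff by blast
  then have M: "\<And>p. \<bar>f p\<bar> \<le> M" by auto
  have "theta_distr f \<phi> = 0" if t: "test_function_on UNIV \<phi>" for \<phi>
  proof -
    obtain C where C: "C \<ge> 0"
      "\<And>n. norm (theta_distr f \<phi> - tree_sum 0 n (\<lambda>a. \<phi> a * theta_distr f (cantor_bump n a)) 0) \<le> C * cantor_side TYPE('n) n"
      using theta_distr_approx[OF f M hc t] by blast
    \<comment> \<open>All values on bumps are 0, so every Riemann sum vanishes and the pairing with
      \<open>\<phi>\<close> is bounded by the approximation error alone.\<close>
    have z: "tree_sum 0 n (\<lambda>a. \<phi> a * theta_distr f (cantor_bump n a)) 0 = 0" for n
    proof -
      have "tree_sum 0 n (\<lambda>a. \<phi> a * theta_distr f (cantor_bump n a)) 0 = tree_sum 0 n (\<lambda>a. 0 * \<phi> a) 0"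
        by (rule tree_sum_cong) (simp_all add: theta_distr_cantor_bump_eq_0[OF f M hc] del: cantor_corners.simps(2))
      then show ?thesis using tree_sum_cmult[of 0 n 0 \<phi> 0] by simp
    qed
    have "norm (theta_distr f \<phi>) \<le> C * cantor_side TYPE('n) n" for n using C(2)[of n] unfolding z by simp
    moreover have "\<exists>n. C * cantor_side TYPE('n) n < e" if "e > 0" for e
    proof -
      have "2 * C / e \<ge> 0" using C(1) that by simp
      from cantor_side_tendsto_0[OF this] obtain n where "2 * C / e * cantor_side TYPE('n) n \<le> 1" by blast
      then have "2 * (C * cantor_side TYPE('n) n) \<le> e" using that by (simp add: field_simps)
      then have "C * cantor_side TYPE('n) n < e" using that by linarith
      then show ?thesis by blast
    qed
    ultimately have "norm (theta_distr f \<phi>) \<le> 0"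
      by (meson leI order_less_le_trans less_irrefl)
    then show ?thesis by simp
  qed
  then show "half_caloric_on UNIV f" by (simp add: half_caloric_on_def theta_distr_def)
qed

end
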